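(* Let $m \ge 2$ and let $A$ be an $m \times m$ matrix with integer entries, all of whose (complex) eigenvalues are strictly larger than $1$ in absolute value. Let $f_A : \mathbb{T}^m \to \mathbb{T}^m$ be the toral endomorphism induced by $A$, and let $\mu_m$ be the Lebesgue (Haar) probability measure on $\mathbb{T}^m$. Then the measure-preserving system $(\mathbb{T}^m, \mu_m, f_A)$ is isomorphic to a uniform model 1-sided Bernoulli shift, i.e. there is a positive integer $r$ such that $(\mathbb{T}^m, \mu_m, f_A)$ is measure-theoretically isomorphic to $(\Sigma_r^+, \nu_{(1/r, \ldots, 1/r)}, \sigma_r)$.
   Context: $\mathbb{T}^m = \mathbb{R}^m/\mathbb{Z}^m$, and $f_A(x) = Ax \pmod{\mathbb{Z}^m}$; $f_A$ preserves $\mu_m$. For a positive integer $r$, $\Sigma_r^+ = \{(\omega_0, \omega_1, \ldots) : \omega_j \in \{1, \ldots, r\},\ j \ge 0\}$ is the space of one-sided sequences on $r$ symbols, $\sigma_r : \Sigma_r^+ \to \Sigma_r^+$ is the left shift $(\sigma_r \omega)_j = \omega_{j+1}$, and for a probability vector $p = (p_1, \ldots, p_r)$, $\nu_p$ is the product (Bernoulli) measure on $\Sigma_r^+$ with $\nu_p(\{\omega : \omega_0 = i\}) = p_i$. The uniform model 1-sided Bernoulli shift on $r$ symbols is $(\Sigma_r^+, \nu_{(1/r,\ldots,1/r)}, \sigma_r)$. Measure-preserving systems $(X, \mu, f)$ and $(Y, \nu, g)$ on Lebesgue spaces, with $f, g$ not necessarily invertible, are (measure-theoretically) isomorphic if there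 are measurable sets $X_0 \subset X$, $Y_0 \subset Y$ of full measure with $f(X_0) \subset X_0$, $g(Y_0) \subset Y_0$, and a bimeasurable measure-preserving bijection $\Phi : X_0 \to Y_0$ with $\Phi \circ f = g \circ \Phi$ on $X_0$. *)

theory Defs
  imports "HOL-Probability.Probability"
begin

definition of_int_matrix :: "int ^ 'n ^ 'm \<Rightarrow> 'a::ring_1 ^ 'n ^ 'm" where
  "of_int_matrix A = (\<chi> i j. of_int (A $ i $ j))"

definition complex_eigenvalue :: "int ^ 'n ^ 'n \<Rightarrow> complex \<Rightarrow> bool" where
  "complex_eigenvalue A c \<longleftrightarrow>
     (\<exists>v :: complex ^ 'n. v \<noteq> 0 \<and> of_int_matrix A *v v = c *s v)"

definition lattice_rel :: "real ^ 'n \<Rightarrow> real ^ 'n \<Rightarrow> bool" where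
  "lattice_rel x y \<longleftrightarrow> (\<forall>i. x $ i - y $ i \<in> \<int>)"

lemma equivp_lattice_rel: "equivp (lattice_rel :: real ^ 'n \<Rightarrow> _)"
proof (rule equivpI)
  show "reflp lattice_rel"
    by (simp add: reflp_def lattice_rel_def)
  show "symp lattice_rel"
    unfolding symp_def lattice_rel_def by (metis Ints_minus minus_diff_eq)
  show "transp (lattice_rel :: real ^ 'n \<Rightarrow> _)"
  proof (rule transpI)
    fix x y z :: "real ^ 'n"
    assume *: "lattice_rel x y" "lattice_rel y z"
    have "(x $ i - y $ i) + (y $ i - z $ i) \<in> \<int>" for i
      using * by (intro Ints_add) (auto simp: lattice_rel_def)
    then show "lattice_rel x z"
      by (simp add: lattice_rel_def)
  qed
qed

quotient_type 'n torus = "real ^ 'n" / lattice_rel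
  morphisms rep_torus torus_proj
  by (rule equivp_lattice_rel)

lift_definition toral_endomorphism :: "int ^ 'n ^ 'n \<Rightarrow> 'n::finite torus \<Rightarrow> 'n torus"
  is "\<lambda>A x. of_int_matrix A *v x"
proof -
  fix A :: "int ^ 'n ^ 'n" and x y :: "real ^ 'n"
  assume "lattice_rel x y"
  then have "(\<Sum>j\<in>UNIV. of_int (A $ i $ j) * (x $ j - y $ j)) \<in> \<int>" for i
    by (intro Ints_sum Ints_mult) (auto simp: lattice_rel_def)
  then show "lattice_rel (of_int_matrix A *v x) (of_int_matrix A *v y)"
    by (simp add: lattice_rel_def matrix_vector_mult_def of_int_matrix_def
        right_diff_distrib sum_subtractf)
qed

definition unit_cube :: "(real ^ 'n) set" where
  "unit_cube = {x. \<forall>i. 0 \<le> x $ i \<and> x $ i < 1}"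

text \<open>
  The measurable sets are those with Lebesgue measurable preimage in \<open>\<real>\<^sup>n\<close>. Since the half-open
  unit cube is a fundamental domain for the integer lattice, the image of Lebesgue measure on it is
  the normalised (complete) Lebesgue--Haar measure of the quotient.
\<close>
definition torus_lebesgue :: "'n::finite torus measure" where
  "torus_lebesgue =
     distr (lebesgue_on unit_cube) (sigma UNIV {B. torus_proj -` B \<in> sets lebesgue}) torus_proj"

lemma space_torus_lebesgue [simp]: "space torus_lebesgue = UNIV"
  by (simp add: torus_lebesgue_def)

lemma sets_torus_lebesgue: "sets torus_lebesgue = {B. torus_proj -` B \<in> sets lebesgue}"
proof -
  have "sigma_algebra UNIV {B :: 'a torus set. torus_proj -` B \<in> sets lebesgue}"
    unfolding sigma_algebra_iff2
  proof (intro conjI ballI allI impI)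
    fix B :: "'a torus set"
    assume "B \<in> {B. torus_proj -` B \<in> sets lebesgue}"
    then have "space lebesgue - torus_proj -` B \<in> sets lebesgue"
      by (intro sets.compl_sets) simp
    then show "UNIV - B \<in> {B. torus_proj -` B \<in> sets lebesgue}"
      by (simp add: vimage_Diff)
  next
    fix B :: "nat \<Rightarrow> 'a torus set"
    assume "range B \<subseteq> {B. torus_proj -` B \<in> sets lebesgue}"
    then have "(\<Union>i. torus_proj -` B i) \<in> sets lebesgue"
      by (intro sets.countable_UN) auto
    then show "\<Union> (range B) \<in> {B. torus_proj -` B \<in> sets lebesgue}"
      by (simp add: vimage_UN)
  qed simp_all
  then show ?thesis
    by (simp add: torus_lebesgue_def sigma_algebra.sigma_sets_eq)
qed

lemma unit_cube_sets: "(unit_cube :: (real ^ 'n::finite) set) \<in> sets lebesgue"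
proof -
  have "unit_cube = (\<Inter>i. {x :: real ^ 'n. 0 \<le> x $ i} \<inter> {x. x $ i < 1})"
    by (auto simp: unit_cube_def)
  moreover have "{x :: real ^ 'n. 0 \<le> x $ i} \<inter> {x. x $ i < 1} \<in> sets borel" for i
    by (intro sets.Int borel_closed borel_open closed_halfspace_component_ge_cart
        open_halfspace_component_lt_cart)
  ultimately have "(unit_cube :: (real ^ 'n) set) \<in> sets borel"
    by (metis (no_types, lifting) UNIV_not_empty finite_class.finite_UNIV sets.finite_INT)
  then show ?thesis
    by auto
qed

lemma emeasure_torus_lebesgue:
  fixes B :: "'n::finite torus set"
  assumes "B \<in> sets torus_lebesgue"
  shows "emeasure torus_lebesgue B = emeasure lebesgue (torus_proj -` B \<inter> unit_cube)"
proof -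
  let ?S = "sigma UNIV {B :: 'n torus set. torus_proj -` B \<in> sets lebesgue}"
  have sets_S: "sets ?S = {B. torus_proj -` B \<in> sets lebesgue}"
    using sets_torus_lebesgue[where ?'a = 'n] by (simp add: torus_lebesgue_def)
  have "torus_proj \<in> measurable lebesgue ?S"
    by (rule measurableI) (use sets_S in auto)
  then have "torus_proj \<in> measurable (lebesgue_on unit_cube) ?S"
    by (rule measurable_restrict_space1)
  then have "emeasure torus_lebesgue B =
      emeasure (lebesgue_on unit_cube) (torus_proj -` B \<inter> unit_cube)"
    using assms sets_S sets_torus_lebesgue
    by (simp add: torus_lebesgue_def emeasure_distr space_restrict_space)
  also have "\<dots> = emeasure lebesgue (torus_proj -` B \<inter> unit_cube)"
    using unit_cube_sets by (intro emeasure_restrict_space) auto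
  finally show ?thesis .
qed

lemma prob_space_torus_lebesgue: "prob_space (torus_lebesgue :: 'n::finite torus measure)"
proof
  have sub: "box 0 1 \<subseteq> (unit_cube :: (real ^ 'n) set)" "unit_cube \<subseteq> (cbox 0 1 :: (real ^ 'n) set)"
    by (auto simp: unit_cube_def mem_box_cart less_imp_le)
  have le: "\<And>b. b \<in> Basis \<Longrightarrow> (0 :: real ^ 'n) \<bullet> b \<le> 1 \<bullet> b"
    by (auto simp: Basis_vec_def inner_axis)
  have pr: "(\<Prod>b\<in>Basis. ((1 :: real ^ 'n) - 0) \<bullet> b) = 1"
    by (rule prod.neutral) (auto simp: Basis_vec_def inner_axis)
  have "emeasure lebesgue (unit_cube :: (real ^ 'n) set) \<le> emeasure lebesgue (cbox 0 (1 :: real ^ 'n))"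
    using sub by (intro emeasure_mono) auto
  moreover have "emeasure lebesgue (box 0 (1 :: real ^ 'n)) \<le> emeasure lebesgue (unit_cube :: (real ^ 'n) set)"
    using sub unit_cube_sets by (intro emeasure_mono) auto
  moreover have "emeasure lebesgue (cbox 0 (1 :: real ^ 'n)) = 1"
    using le pr by (simp add: emeasure_lborel_cbox_eq)
  moreover have "emeasure lebesgue (box 0 (1 :: real ^ 'n)) = 1"
    using le pr by (simp add: emeasure_lborel_box_eq)
  ultimately have "emeasure lebesgue (unit_cube :: (real ^ 'n) set) = 1"
    by (metis order_antisym)
  moreover have "UNIV \<in> sets (torus_lebesgue :: 'n torus measure)"
    by (simp add: sets_torus_lebesgue)
  ultimately show "emeasure torus_lebesgue (space torus_lebesgue :: 'n torus set) = 1"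
    by (simp add: emeasure_torus_lebesgue)
qed

text \<open>
  The product measure is completed so that the one-sided shift, like the torus, lives on a
  Lebesgue space.
\<close>
definition bernoulli_measure :: "nat \<Rightarrow> (nat \<Rightarrow> real) \<Rightarrow> (nat \<Rightarrow> nat) measure" where
  "bernoulli_measure r p =
     completion (PiM UNIV (\<lambda>_. point_measure {1..r} (\<lambda>i. ennreal (p i))))"

definition left_shift :: "(nat \<Rightarrow> 'a) \<Rightarrow> nat \<Rightarrow> 'a" where
  "left_shift \<omega> = (\<lambda>j. \<omega> (Suc j))"

lemma space_bernoulli_measure: "space (bernoulli_measure r p) = {\<omega>. \<forall>j. \<omega> j \<in> {1..r}}"
  by (auto simp: bernoulli_measure_def space_PiM space_point_measure PiE_def)

definition mp_isomorphic ::
  "'a measure \<Rightarrow> ('a \<Rightarrow> 'a) \<Rightarrow> 'b measure \<Rightarrow> ('b \<Rightarrow> 'b) \<Rightarrow> bool" where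
  "mp_isomorphic M f N g \<longleftrightarrow>
     (\<exists>X\<^sub>0 Y\<^sub>0 \<Phi>.
        X\<^sub>0 \<in> sets M \<and> space M - X\<^sub>0 \<in> null_sets M \<and> f ` X\<^sub>0 \<subseteq> X\<^sub>0 \<and>
        Y\<^sub>0 \<in> sets N \<and> space N - Y\<^sub>0 \<in> null_sets N \<and> g ` Y\<^sub>0 \<subseteq> Y\<^sub>0 \<and>
        bij_betw \<Phi> X\<^sub>0 Y\<^sub>0 \<and>
        \<Phi> \<in> measurable (restrict_space M X\<^sub>0) (restrict_space N Y\<^sub>0) \<and>
        inv_into X\<^sub>0 \<Phi> \<in> measurable (restrict_space N Y\<^sub>0) (restrict_space M X\<^sub>0) \<and>
        distr (restrict_space M X\<^sub>0) (restrict_space N Y\<^sub>0) \<Phi> = restrict_space N Y\<^sub>0 \<and>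
        (\<forall>x\<in>X\<^sub>0. \<Phi> (f x) = g (\<Phi> x)))"

end

theory Submission
  imports Defs "HOL-Computational_Algebra.Fundamental_Theorem_Algebra"
begin

text \<open>
  Let \<open>L = \<int>\<^sup>n\<close>, let \<open>a\<close> be the linear map \<open>x \<mapsto> A x\<close> of \<open>\<real>\<^sup>n\<close>, let \<open>B\<close> be its inverse, and let
  \<open>r\<close> be the index of \<open>a(L)\<close> in \<open>L\<close>. Every point of the torus has \<open>r\<close> preimages. Name them
  \<open>1, \<dots>, r\<close> in any measurable way: the labels met along an orbit are then independent and uniform
  (\<open>prob_itinerary_in\<close>), so the itinerary map always carries Haar measure to the uniform Bernoulli measure
  and \<open>f\<^sub>A\<close> to the shift. The whole question is whether itineraries separate points. They need not: for
  \<open>x \<mapsto> 2 x\<close>, naming the preimages of \<open>y \<in> [-1/2, 1/2)\<close> by \<open>y/2\<close> and \<open>(y + 1)/2\<close> gives \<open>y\<close> and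
  \<open>-y\<close> the same itinerary for almost every \<open>y\<close>. The labelling has to be chosen with some care.

  The choice is this. Fix a norm \<open>N\<close> that \<open>B\<close> contracts by a factor \<open>\<theta> < 1\<close>. To \<open>y\<close> add a vector
  \<open>H y\<close> of \<open>L\<close> that nearly minimises \<open>N (y + H y)\<close>, and name the preimages \<open>B (y + H y + d\<^sub>i)\<close>,
  where the \<open>d\<^sub>i\<close> represent \<open>L\<close> modulo \<open>a(L)\<close> and \<open>d\<^sub>z = 0\<close>. Reduction to a near-minimal lift never
  increases \<open>N\<close> by much, so the branch \<open>z\<close> pulls every point towards \<open>0\<close>, and a long run of \<open>z\<close> maps
  the whole torus into a small ball about \<open>0\<close> (\<open>synchronising_word\<close>).

  Take \<open>H\<close> constant on the cells of a cubical grid. Only the grid makes branches discontinuous. A word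
  \<open>w\<close> is good at scale \<open>\<delta>\<close> if the successive images of the \<open>\<delta>\<close>-ball about \<open>0\<close> under its letters
  avoid the grid; the composite of these branches is then a translate of \<open>B\<^sup>n\<close> on the ball. The offset
  of the grid is chosen so that the grid avoids all points of \<open>B\<^sup>j(L)\<close>, and the proportion of words that
  are not good tends to \<open>0\<close> with \<open>\<delta>\<close>, uniformly in their length (\<open>few_split_words\<close>): finitely many short
  words are harmless by the choice of offset, and long ones are counted by volume.

  The first \<open>n\<close> labels are independent of all later ones. Looking at the last run of \<open>z\<close> in a long
  window shows that almost every itinerary has, for infinitely many \<open>n\<close>, a good prefix of length \<open>n\<close>
  followed by a long run of \<open>z\<close> (\<open>prob_good_prefix_before_run\<close>). The run puts the \<open>n\<close>-th iterate near
  \<open>0\<close>, and the good prefix shrinks this uncertainty by \<open>\<theta>\<^sup>n\<close>. Hence the itinerary determines the point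
  as a limit of branches applied to \<open>0\<close> (\<open>limit_of_branches\<close>), and an almost everywhere defined inverse of
  the itinerary map is all that an isomorphism requires (\<open>mp_isomorphic_completionI\<close>).
\<close>

section \<open>Decay along backward orbits\<close>

definition poly_action :: "(complex ^ 'n \<Rightarrow> complex ^ 'n) \<Rightarrow> complex poly \<Rightarrow> complex ^ 'n \<Rightarrow> complex ^ 'n" where
  "poly_action L p v = (\<Sum>i\<le>degree p. coeff p i *s (L ^^ i) v)"

lemma poly_action_altdef:
  assumes "degree p \<le> n"
  shows "poly_action L p v = (\<Sum>i\<le>n. coeff p i *s (L ^^ i) v)"
  unfolding poly_action_def using assms
  by (intro sum.mono_neutral_left) (auto simp: coeff_eq_0)

lemma norm_vector_scalar_mult: "norm (c *s (v :: complex ^ 'n)) = cmod c * norm v"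
  by (simp add: norm_vec_def L2_set_def norm_mult power_mult_distrib
      flip: sum_distrib_left) (simp add: real_sqrt_mult)

locale complex_linear_iso =
  fixes L B :: "complex ^ 'n \<Rightarrow> complex ^ 'n"
  assumes L_add: "L (x + y) = L x + L y"
    and L_scale: "L (c *s x) = c *s L x"
    and BL: "B (L x) = x"
    and LB: "L (B x) = x"
begin

lemma L_diff: "L (x - y) = L x - L y"
  using L_add[of "x - y" y] by (simp add: algebra_simps)

lemma L_0: "L 0 = 0"
  using L_scale[of 0 0] by simp

lemma L_sum: "L (sum f I) = (\<Sum>i\<in>I. L (f i))"
  by (induction I rule: infinite_finite_induct) (auto simp: L_0 L_add)

lemma B_add: "B (x + y) = B x + B y"
  by (metis BL LB L_add)

lemma B_scale: "B (c *s x) = c *s B x"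
  by (metis BL LB L_scale)

lemma B_diff: "B (x - y) = B x - B y"
  by (metis BL LB L_diff)

lemma funpow_B_diff: "(B ^^ k) (x - y) = (B ^^ k) x - (B ^^ k) y"
  by (induction k arbitrary: x y) (auto simp: B_diff)

lemma funpow_B_scale: "(B ^^ k) (c *s x) = c *s (B ^^ k) x"
  by (induction k arbitrary: x) (auto simp: B_scale)

lemma poly_action_root_factor:
  "poly_action L ([:- c, 1:] * q) v = L (poly_action L q v) - c *s poly_action L q v"
proof -
  let ?n = "degree q"
  have deg: "degree ([:- c, 1:] * q) \<le> Suc ?n"
    using degree_mult_le[of "[:- c, 1:]" q] by (simp del: mult_pCons_left)
  have coeff: "coeff ([:- c, 1:] * q) i = (case i of 0 \<Rightarrow> 0 | Suc j \<Rightarrow> coeff q j) - c * coeff q i" for i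
    by (simp add: coeff_pCons split: nat.splits)
  have "poly_action L ([:- c, 1:] * q) v =
      (\<Sum>i\<le>Suc ?n. (case i of 0 \<Rightarrow> 0 | Suc j \<Rightarrow> coeff q j) *s (L ^^ i) v)
      - (\<Sum>i\<le>Suc ?n. (c * coeff q i) *s (L ^^ i) v)"
    unfolding poly_action_altdef[OF deg] coeff by (simp add: vec.scale_left_diff_distrib sum_subtractf)
  also have "(\<Sum>i\<le>Suc ?n. (case i of 0 \<Rightarrow> 0 | Suc j \<Rightarrow> coeff q j) *s (L ^^ i) v) = L (poly_action L q v)"
    unfolding poly_action_def
    by (subst sum.atMost_Suc_shift) (simp add: L_sum L_scale)
  also have "(\<Sum>i\<le>Suc ?n. (c * coeff q i) *s (L ^^ i) v) = c *s poly_action L q v"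
    by (subst poly_action_altdef[of q "Suc ?n"]) (simp_all only: vec.scale_sum_right vec.scale_scale le_SucI order_refl)
  finally show ?thesis .
qed

definition decays :: "complex ^ 'n \<Rightarrow> bool" where
  "decays v \<longleftrightarrow> (\<exists>C \<theta>. 0 < \<theta> \<and> \<theta> < 1 \<and> (\<forall>k. norm ((B ^^ k) v) \<le> C * \<theta> ^ k))"

lemma decays_0: "decays 0"
proof -
  have "B 0 = 0" using B_scale[of 0 0] by simp
  then have "(B ^^ k) 0 = 0" for k by (induction k) auto
  then show ?thesis unfolding decays_def by (intro exI[of _ 1] exI[of _ "1/2"]) auto
qed

text \<open>If \<open>u = (L - c) w\<close>, then \<open>b\<^sub>k = B\<^sup>k w\<close> obeys \<open>b\<^sub>k\<^sub>+\<^sub>1 = (b\<^sub>k - B\<^sup>k\<^sup>+\<^sup>1 u) / c\<close>, a contracting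
  recursion with a forcing term that decays exponentially.\<close>
lemma decays_if_decays_shifted:
  assumes c: "cmod c > 1" and u: "decays (L w - c *s w)"
  shows "decays w"
proof -
  define u where "u = L w - c *s w"
  from u obtain C \<theta> where \<theta>: "0 < \<theta>" "\<theta> < 1" and C: "\<And>k. norm ((B ^^ k) u) \<le> C * \<theta> ^ k"
    unfolding decays_def u_def by blast
  have C0: "C \<ge> 0" using C[of 0] norm_ge_zero[of u] by (simp add: order_trans[OF norm_ge_zero])
  define b where "b k = norm ((B ^^ k) w)" for k
  have rec: "cmod c * b (Suc k) \<le> b k + C * \<theta> ^ k" for k
  proof -
    have "w = c *s B w + B u"
      unfolding u_def by (simp add: B_diff B_scale BL)
    then have "c *s B w = w - B u" by (metis add_diff_cancel_right')
    then have "c *s (B ^^ k) (B w) = (B ^^ k) w - (B ^^ k) (B u)"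
      by (metis funpow_B_diff funpow_B_scale)
    then have "cmod c * norm ((B ^^ Suc k) w) = norm ((B ^^ k) w - (B ^^ Suc k) u)"
      by (metis norm_vector_scalar_mult funpow_Suc_right comp_apply)
    also have "\<dots> \<le> norm ((B ^^ k) w) + norm ((B ^^ Suc k) u)" by (rule norm_triangle_ineq4)
    also have "norm ((B ^^ Suc k) u) \<le> C * \<theta> ^ Suc k" by (rule C)
    also have "C * \<theta> ^ Suc k \<le> C * \<theta> ^ k"
      using \<theta> C0 by (intro mult_left_mono) (auto intro: power_decreasing)
    finally show ?thesis by (simp add: b_def)
  qed
  \<comment> \<open>a rate strictly slower than both \<open>\<theta>\<close> and \<open>1 / |c|\<close>\<close>
  have "max \<theta> (1 / cmod c) < 1" using \<theta> c by (auto simp: divide_less_eq)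
  then obtain t where t: "max \<theta> (1 / cmod c) < t" "t < 1" by (rule dense[THEN exE]) blast
  have t0: "t > 0" using t \<theta> by auto
  have "cmod c > 0" using c by linarith
  then have ct: "cmod c * t > 1" using t by (simp add: pos_divide_less_eq mult.commute)
  define D where "D = max (b 0) (C / (cmod c * t - 1))"
  have D: "b 0 \<le> D" "C \<le> D * (cmod c * t - 1)"
  proof -
    show "b 0 \<le> D" by (simp add: D_def)
    have "C / (cmod c * t - 1) \<le> D" by (simp add: D_def)
    then show "C \<le> D * (cmod c * t - 1)" using ct by (simp add: divide_le_eq)
  qed
  have "b k \<le> D * t ^ k" for k
  proof (induction k)
    case (Suc k)
    have "cmod c * b (Suc k) \<le> D * t ^ k + C * \<theta> ^ k" using rec[of k] Suc by linarith
    also have "C * \<theta> ^ k \<le> C * t ^ k" using C0 \<theta> t by (intro mult_left_mono power_mono) auto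
    also have "C * t ^ k \<le> D * (cmod c * t - 1) * t ^ k"
      using D t0 by (intro mult_right_mono) auto
    finally have "cmod c * b (Suc k) \<le> cmod c * (D * t ^ Suc k)" by (simp add: algebra_simps)
    then show ?case using \<open>cmod c > 0\<close> mult_le_cancel_left_pos by blast
  qed (use D in simp)
  then show ?thesis unfolding decays_def b_def using t t0 by blast
qed

text \<open>A product of linear factors that kills \<open>v\<close> is peeled off one factor at a time: what is left after
  each step decays because it did before the factor was removed.\<close>
lemma decays_if_product_annihilates:
  assumes "\<And>c. c \<in># R \<Longrightarrow> cmod c > 1" and "decays (poly_action L (\<Prod>c\<in>#R. [:- c, 1:]) v)"
  shows "decays v"
  using assms
proof (induction R)
  case empty
  then show ?case by (simp add: poly_action_def)
next
  case (add c R)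
  let ?q = "\<Prod>c\<in>#R. [:- c, 1:]"
  have "decays (poly_action L ([:- c, 1:] * ?q) v)"
    using add.prems(2) by (simp del: mult_pCons_left)
  then have "decays (poly_action L ?q v)"
    unfolding poly_action_root_factor
    by (rule decays_if_decays_shifted[rotated]) (use add.prems(1) in simp)
  with add show ?case by simp
qed

lemma annihilating_poly_exists: "\<exists>p. p \<noteq> 0 \<and> poly_action L p v = 0"
proof -
  define n where "n = CARD('n)"
  define f where "f i = (L ^^ i) v" for i
  show ?thesis
  proof (cases "inj_on f {..n}")
    case True
    then have "card (f ` {..n}) = Suc n" by (simp add: card_image)
    then have "vec.dependent (f ` {..n})"
      using vec.independent_card_le_dim[of "f ` {..n}" UNIV] by (auto simp: n_def vec.dim_UNIV vec.dimension_def card_cart_basis)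
    then obtain u where u: "(\<Sum>w\<in>f ` {..n}. u w *s w) = 0" "\<exists>w\<in>f ` {..n}. u w \<noteq> 0"
      by (auto simp: vec.dependent_finite)
    define p where "p = (\<Sum>i\<le>n. monom (u (f i)) i)"
    have co: "coeff p i = (if i \<le> n then u (f i) else 0)" for i
      by (simp add: p_def coeff_sum if_distrib cong: if_cong)
    have "p \<noteq> 0"
    proof
      assume "p = 0"
      then have "\<forall>i\<le>n. u (f i) = 0" using co by (metis coeff_0)
      with u show False by auto
    qed
    moreover have "degree p \<le> n" by (rule degree_le) (simp add: co)
    then have "poly_action L p v = (\<Sum>i\<le>n. u (f i) *s f i)"
      by (simp add: poly_action_altdef co f_def)
    then have "poly_action L p v = 0"
      using u(1) by (simp add: sum.reindex[OF True])
    ultimately show ?thesis by blast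
  next
    case False
    then obtain i j where ij: "i \<noteq> j" "f i = f j" by (auto simp: inj_on_def)
    define p where "p = monom 1 i - monom (1::complex) j"
    have "coeff p i = 1" using ij by (simp add: p_def)
    then have "p \<noteq> 0" by auto
    moreover have "degree p \<le> max i j"
      unfolding p_def by (intro degree_diff_le_max[THEN order_trans] max.mono degree_monom_le)
    then have "poly_action L p v = (\<Sum>k\<le>max i j. (if k = i then f k else 0) - (if k = j then f k else 0))"
      unfolding poly_action_altdef[OF \<open>degree p \<le> max i j\<close>]
      using ij by (intro sum.cong) (auto simp: p_def f_def vec.scale_left_diff_distrib)
    then have "poly_action L p v = 0" using ij by (simp add: sum_subtractf)
    ultimately show ?thesis by blast
  qed
qed

text \<open>Every root of the minimal polynomial of \<open>v\<close> is an eigenvalue, so peeling off its linear factors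
  one at a time stays in the range of the previous lemma.\<close>
lemma decays_if_eigenvalues_large:
  assumes eig: "\<And>c w. w \<noteq> 0 \<Longrightarrow> L w = c *s w \<Longrightarrow> cmod c > 1"
  shows "decays v"
proof -
  obtain p where p: "p \<noteq> 0" "poly_action L p v = 0"
    and min: "\<And>q. q \<noteq> 0 \<Longrightarrow> poly_action L q v = 0 \<Longrightarrow> degree p \<le> degree q"
    using ex_has_least_nat[of "\<lambda>p. p \<noteq> 0 \<and> poly_action L p v = 0" _ degree] annihilating_poly_exists[of v]
    by metis
  obtain R where R: "p = smult (lead_coeff p) (\<Prod>x\<in>#R. [:-x, 1:])"
    using alg_closed_imp_factorization[OF p(1)] by blast
  define q where "q = (\<Prod>x\<in>#R. [:-x, 1:])"
  have "lead_coeff p \<noteq> 0" using p by simp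
  have dq: "degree q = degree p" "q \<noteq> 0"
    using R \<open>lead_coeff p \<noteq> 0\<close> p(1) unfolding q_def by (metis degree_smult_eq, metis smult_0_right)
  have "poly_action L p v = lead_coeff p *s poly_action L q v"
    unfolding poly_action_altdef[of p "degree p", OF order_refl] poly_action_altdef[of q "degree p", OF eq_refl[OF dq(1)]]
    by (subst R) (simp add: q_def vec.scale_sum_right)
  then have q0: "poly_action L q v = 0" using p \<open>lead_coeff p \<noteq> 0\<close> by simp
  have "cmod c > 1" if c: "c \<in># R" for c
  proof -
    obtain R' where R': "R = add_mset c R'" using c by (metis multi_member_split)
    define s where "s = (\<Prod>x\<in>#R'. [:-x, 1:])"
    have q: "q = [:-c, 1:] * s" by (simp add: q_def s_def R')
    have "s \<noteq> 0" using q dq by auto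
    then have "degree q = Suc (degree s)" unfolding q by (subst degree_mult_eq) auto
    then have "poly_action L s v \<noteq> 0" using min[of s] \<open>s \<noteq> 0\<close> dq by auto
    moreover have "L (poly_action L s v) = c *s poly_action L s v"
      using q0 unfolding q poly_action_root_factor by simp
    ultimately show ?thesis using eig by blast
  qed
  then show ?thesis
    using decays_if_product_annihilates[of R v] q0 by (simp add: q_def decays_0)
qed

end

lemma linear_funpow: "linear (f :: 'a::real_vector \<Rightarrow> 'a) \<Longrightarrow> linear (f ^^ k)"
  by (induction k) (auto simp: linear_iff)

lemma invertible_if_no_zero_eigenvalue:
  fixes M :: "'a::field ^ 'n ^ 'n"
  assumes "\<And>v. M *v v = 0 \<Longrightarrow> v = 0"
  obtains M' where "M ** M' = mat 1" "M' ** M = mat 1"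
proof -
  have "inj ((*v) M)"
  proof (rule injI)
    fix x y assume "M *v x = M *v y"
    then have "M *v (x - y) = 0" by (simp add: matrix_vector_mult_diff_distrib)
    then show "x = y" using assms[of "x - y"] by simp
  qed
  then obtain M' where "M' ** M = mat 1"
    using matrix_left_invertible_injective[of M] by blast
  then show thesis using that matrix_left_right_inverse[of M' M] by blast
qed

text \<open>An integer matrix acts on complex vectors as on real ones, so the decay along complex
  backward orbits carries over, uniformly by summing over the unit vectors.\<close>
lemma expanding_inverse:
  fixes A :: "int ^ 'n::finite ^ 'n"
  assumes eig: "\<And>c. complex_eigenvalue A c \<Longrightarrow> 1 < cmod c"
  obtains B :: "real ^ 'n \<Rightarrow> real ^ 'n" and C \<theta> where "linear B"
    "\<And>x. of_int_matrix A *v B x = x" "\<And>x. B (of_int_matrix A *v x) = x"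
    "0 < \<theta>" "\<theta> < 1" "\<And>k x. norm ((B ^^ k) x) \<le> C * \<theta> ^ k * norm x"
proof -
  define emb :: "real ^ 'n \<Rightarrow> complex ^ 'n" where "emb x = (\<chi> i. complex_of_real (x $ i))" for x
  define L :: "complex ^ 'n \<Rightarrow> complex ^ 'n" where "L = (*v) (of_int_matrix A)"
  have norm_emb: "norm (emb x) = norm x" for x
    by (simp add: emb_def norm_vec_def)
  have L_emb: "L (emb x) = emb (of_int_matrix A *v x)" for x
    by (simp add: L_def emb_def matrix_vector_mult_def of_int_matrix_def vec_eq_iff)
  have eigL: "cmod c > 1" if "w \<noteq> 0" "L w = c *s w" for c w
    using eig[of c] that by (auto simp: complex_eigenvalue_def L_def)
  have L0: "v = 0" if "L v = 0" for v
    using eigL[of v 0] that by auto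
  obtain M' :: "complex ^ 'n ^ 'n" where M': "of_int_matrix A ** M' = mat 1" "M' ** of_int_matrix A = mat 1"
    using invertible_if_no_zero_eigenvalue[of "of_int_matrix A :: complex ^ 'n ^ 'n"] L0 by (auto simp: L_def)
  define Bc where "Bc = (*v) M'"
  interpret complex_linear_iso L Bc
    by standard (auto simp: L_def Bc_def matrix_vector_right_distrib vec.scale M' matrix_vector_mul_assoc)
  have "x = 0" if "of_int_matrix A *v x = 0" for x :: "real ^ 'n"
  proof -
    have "L (emb x) = 0" unfolding L_emb that by (simp add: emb_def vec_eq_iff)
    then have "norm (emb x) = 0" using L0 by simp
    then show ?thesis by (simp add: norm_emb)
  qed
  then obtain M :: "real ^ 'n ^ 'n" where M: "of_int_matrix A ** M = mat 1" "M ** of_int_matrix A = mat 1"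
    using invertible_if_no_zero_eigenvalue[of "of_int_matrix A :: real ^ 'n ^ 'n"] by blast
  define B where "B = (*v) M"
  have AB: "of_int_matrix A *v B x = x" "B (of_int_matrix A *v x) = x" for x
    by (auto simp: B_def matrix_vector_mul_assoc M)
  have "linear B" by (simp add: B_def)
  have "emb (B x) = Bc (emb x)" for x
    by (metis AB(1) BL L_emb)
  then have emb_pow: "emb ((B ^^ k) x) = (Bc ^^ k) (emb x)" for k x
    by (induction k) auto
  have "\<exists>C \<theta>. 0 < \<theta> \<and> \<theta> < 1 \<and> (\<forall>k. norm ((B ^^ k) (axis i 1)) \<le> C * \<theta> ^ k)" for i
    using decays_if_eigenvalues_large[of "emb (axis i 1)"] eigL
    unfolding decays_def by (simp flip: emb_pow add: norm_emb)
  then obtain Ci \<theta>i where i: "0 < \<theta>i i" "\<theta>i i < 1" "norm ((B ^^ k) (axis i 1)) \<le> Ci i * \<theta>i i ^ k" for i k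
    by metis
  have Ci0: "Ci i \<ge> 0" for i using order_trans[OF norm_ge_zero i(3)[of 0 i]] by simp
  define \<theta> where "\<theta> = Max (range \<theta>i)"
  have \<theta>: "0 < \<theta>" "\<theta> < 1" "\<theta>i i \<le> \<theta>" for i
    using i by (auto simp: \<theta>_def Max_gr_iff)
  have bound: "norm ((B ^^ k) x) \<le> (\<Sum>i\<in>UNIV. Ci i) * \<theta> ^ k * norm x" for k x
  proof -
    have "linear (B ^^ k)" by (rule linear_funpow[OF \<open>linear B\<close>])
    have "x = (\<Sum>i\<in>UNIV. (x $ i) *\<^sub>R axis i 1)"
      using basis_expansion[of x] by (simp add: scalar_mult_eq_scaleR)
    then have "(B ^^ k) x = (\<Sum>i\<in>UNIV. (x $ i) *\<^sub>R (B ^^ k) (axis i 1))"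
      using \<open>linear (B ^^ k)\<close> by (metis (no_types, lifting) linear_cmul linear_sum sum.cong)
    also have "norm \<dots> \<le> (\<Sum>i\<in>UNIV. norm x * (Ci i * \<theta> ^ k))"
    proof (rule sum_norm_le)
      fix i
      have "\<bar>x $ i\<bar> * norm ((B ^^ k) (axis i 1)) \<le> norm x * (Ci i * \<theta>i i ^ k)"
        using i(3)[of k i] component_le_norm_cart[of x i] by (intro mult_mono) auto
      also have "\<dots> \<le> norm x * (Ci i * \<theta> ^ k)"
        using Ci0[of i] \<theta>(3)[of i] i(1)[of i] by (intro mult_left_mono power_mono) auto
      finally show "norm ((x $ i) *\<^sub>R (B ^^ k) (axis i 1)) \<le> norm x * (Ci i * \<theta> ^ k)" by simp
    qed
    finally show ?thesis by (simp add: sum_distrib_left sum_distrib_right mult_ac)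
  qed
  show thesis using that[OF \<open>linear B\<close> AB \<theta>(1,2) bound] .
qed

text \<open>The supremum of \<open>\<parallel>B\<^sup>k x\<parallel> / \<theta>\<^sup>k\<close> absorbs the constant \<open>C\<close>: applying \<open>B\<close> shifts the family by
  one index and costs the factor \<open>\<theta>\<close>.\<close>
lemma adapted_norm:
  fixes B :: "'a::real_normed_vector \<Rightarrow> 'a"
  assumes "linear B" and \<theta>: "0 < \<theta>" and C: "\<And>k x. norm ((B ^^ k) x) \<le> C * \<theta> ^ k * norm x"
  obtains N :: "'a \<Rightarrow> real" where "\<And>x. norm x \<le> N x" "\<And>x. N x \<le> C * norm x"
    "\<And>x y. N (x + y) \<le> N x + N y" "\<And>x. N (- x) = N x" "\<And>x. N (B x) \<le> \<theta> * N x"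
proof -
  define N where "N x = (SUP k. norm ((B ^^ k) x) / \<theta> ^ k)" for x
  have lin: "linear (B ^^ k)" for k by (rule linear_funpow[OF \<open>linear B\<close>])
  have le_C: "norm ((B ^^ k) x) / \<theta> ^ k \<le> C * norm x" for k x
    using C[of k x] \<theta> by (simp add: divide_le_eq mult_ac)
  have bdd: "bdd_above (range (\<lambda>k. norm ((B ^^ k) x) / \<theta> ^ k))" for x
    using le_C by (intro bdd_aboveI2)
  have le_N: "norm ((B ^^ k) x) / \<theta> ^ k \<le> N x" for k x
    unfolding N_def by (rule cSUP_upper[OF _ bdd]) simp
  have N_le: "N x \<le> t" if "\<And>k. norm ((B ^^ k) x) / \<theta> ^ k \<le> t" for x t
    unfolding N_def using that by (intro cSUP_least) auto
  have 1: "norm x \<le> N x" for x using le_N[of 0 x] by simp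
  have 2: "N x \<le> C * norm x" for x by (rule N_le[OF le_C])
  have 3: "N (x + y) \<le> N x + N y" for x y
  proof (rule N_le)
    fix k
    have "norm ((B ^^ k) (x + y)) / \<theta> ^ k \<le> norm ((B ^^ k) x) / \<theta> ^ k + norm ((B ^^ k) y) / \<theta> ^ k"
      using \<theta> by (simp add: linear_add[OF lin] norm_triangle_ineq divide_right_mono flip: add_divide_distrib)
    then show "norm ((B ^^ k) (x + y)) / \<theta> ^ k \<le> N x + N y"
      using le_N[of k x] le_N[of k y] by linarith
  qed
  have 4: "N (- x) = N x" for x
    by (simp add: N_def linear_neg[OF lin])
  have 5: "N (B x) \<le> \<theta> * N x" for x
  proof (rule N_le)
    fix k
    have "norm ((B ^^ k) (B x)) / \<theta> ^ k = \<theta> * (norm ((B ^^ Suc k) x) / \<theta> ^ Suc k)"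
      using \<theta> by (simp add: funpow_swap1)
    also have "\<dots> \<le> \<theta> * N x" using \<theta> by (intro mult_left_mono le_N) auto
    finally show "norm ((B ^^ k) (B x)) / \<theta> ^ k \<le> \<theta> * N x" .
  qed
  show thesis by (rule that[OF 1 2 3 4 5])
qed
section \<open>The integer lattice and its fundamental domains\<close>

definition int_lattice :: "(real ^ 'n) set" where
  "int_lattice = {x. \<forall>i. x $ i \<in> \<int>}"

lemma lattice_rel_iff: "lattice_rel x y \<longleftrightarrow> x - y \<in> int_lattice"
  by (simp add: lattice_rel_def int_lattice_def)

lemma int_lattice_add [intro]: "x \<in> int_lattice \<Longrightarrow> y \<in> int_lattice \<Longrightarrow> x + y \<in> int_lattice"
  by (simp add: int_lattice_def)

lemma int_lattice_minus_iff [simp]: "- x \<in> int_lattice \<longleftrightarrow> x \<in> int_lattice"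
  by (simp add: int_lattice_def)

lemma int_lattice_minus [intro]: "x \<in> int_lattice \<Longrightarrow> - x \<in> int_lattice"
  by simp

lemma int_lattice_diff [intro]: "x \<in> int_lattice \<Longrightarrow> y \<in> int_lattice \<Longrightarrow> x - y \<in> int_lattice"
  by (simp add: int_lattice_def)

lemma int_lattice_0 [simp, intro]: "0 \<in> int_lattice"
  by (simp add: int_lattice_def)

lemma int_lattice_norm_less_1:
  assumes "x \<in> int_lattice" "norm x < 1"
  shows "x = 0"
proof -
  have "x $ i = 0" for i
    using assms component_le_norm_cart[of x i] Ints_nonzero_abs_less1[of "x $ i"]
    by (simp add: int_lattice_def)
  then show ?thesis by (simp add: vec_eq_iff)
qed

definition vec_floor :: "real ^ 'n \<Rightarrow> real ^ 'n" where
  "vec_floor x = (\<chi> i. of_int \<lfloor>x $ i\<rfloor>)"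

lemma vec_floor_lattice [simp]: "vec_floor x \<in> int_lattice"
  by (simp add: vec_floor_def int_lattice_def)

lemma vec_floor_unit_cube: "x - vec_floor x \<in> unit_cube"
  by (auto simp: vec_floor_def unit_cube_def) linarith

lemma unit_cube_lattice_unique:
  assumes "x \<in> unit_cube" "y \<in> unit_cube" "x - y \<in> int_lattice"
  shows "x = y"
proof -
  have "x $ i = y $ i" for i
  proof -
    have "\<bar>x $ i - y $ i\<bar> < 1" "x $ i - y $ i \<in> \<int>"
      using assms(1,2)[unfolded unit_cube_def, simplified, THEN spec[of _ i]] assms(3) by (auto simp: int_lattice_def)
    then show ?thesis using Ints_nonzero_abs_less1[of "x $ i - y $ i"] by simp
  qed
  then show ?thesis by (simp add: vec_eq_iff)
qed

lemma norm_unit_cube: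
  fixes x :: "real ^ 'n::finite"
  assumes "x \<in> unit_cube"
  shows "norm x \<le> CARD('n)"
proof -
  have "norm x \<le> (\<Sum>i\<in>UNIV. \<bar>x $ i\<bar>)" by (rule norm_le_l1_cart)
  also have "\<dots> \<le> (\<Sum>i\<in>(UNIV::'n set). 1)"
    using assms by (intro sum_mono) (auto simp: unit_cube_def less_imp_le)
  finally show ?thesis by simp
qed

lemma countable_int_lattice: "countable (int_lattice :: (real ^ 'n::finite) set)"
proof -
  have "int_lattice \<subseteq> range (\<lambda>v :: int ^ 'n. \<chi> i. real_of_int (v $ i))"
  proof
    fix x :: "real ^ 'n" assume "x \<in> int_lattice"
    then have "x = (\<chi> i. real_of_int ((\<chi> i. \<lfloor>x $ i\<rfloor>) $ i))"
      by (simp add: int_lattice_def vec_eq_iff)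
    then show "x \<in> range (\<lambda>v :: int ^ 'n. \<chi> i. real_of_int (v $ i))" by blast
  qed
  then show ?thesis by (rule countable_subset) simp
qed

definition lattice_invariant :: "(real ^ 'n) set \<Rightarrow> bool" where
  "lattice_invariant E \<longleftrightarrow> (\<forall>x e. e \<in> int_lattice \<longrightarrow> (x + e \<in> E \<longleftrightarrow> x \<in> E))"

definition fundamental_domain :: "(real ^ 'n::finite) set \<Rightarrow> bool" where
  "fundamental_domain F \<longleftrightarrow> F \<in> sets lebesgue \<and> (\<forall>x. \<exists>!e. e \<in> int_lattice \<and> x + e \<in> F)"

lemma fundamental_domain_unit_cube: "fundamental_domain (unit_cube :: (real ^ 'n::finite) set)"
  unfolding fundamental_domain_def
proof (intro conjI allI)
  fix x :: "real ^ 'n"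
  show "\<exists>!e. e \<in> int_lattice \<and> x + e \<in> unit_cube"
  proof (rule ex1I[of _ "- vec_floor x"])
    show "- vec_floor x \<in> int_lattice \<and> x + - vec_floor x \<in> unit_cube"
      using vec_floor_unit_cube[of x] by simp
    fix e assume "e \<in> int_lattice \<and> x + e \<in> unit_cube"
    then have "x + e = x - vec_floor x"
      by (intro unit_cube_lattice_unique vec_floor_unit_cube) auto
    then show "e = - vec_floor x" by (simp add: algebra_simps eq_neg_iff_add_eq_0)
  qed
qed (rule unit_cube_sets)

lemma emeasure_translation:
  fixes S :: "'a::euclidean_space set"
  shows "emeasure lebesgue ((+) c ` S) = emeasure lebesgue S"
  using emeasure_lebesgue_affine[of 1 c S] by (simp add: add.commute cong: image_cong_simp)

text \<open>Cut \<open>E \<inter> F\<close> along the lattice translates of \<open>F'\<close>, move each piece into \<open>F'\<close>.\<close>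
lemma emeasure_fundamental_domains:
  fixes E F F' :: "(real ^ 'n::finite) set"
  assumes E: "E \<in> sets lebesgue" "lattice_invariant E"
    and F: "fundamental_domain F" and F': "fundamental_domain F'"
  shows "emeasure lebesgue (E \<inter> F) = emeasure lebesgue (E \<inter> F')"
proof -
  have sets: "F \<in> sets lebesgue" "F' \<in> sets lebesgue"
    using F F' by (simp_all add: fundamental_domain_def)
  define X where "X e = E \<inter> F \<inter> {x. x + e \<in> F'}" for e
  define Y where "Y e = E \<inter> F' \<inter> {x. x + - e \<in> F}" for e
  have "{x. x + e \<in> S} = (+) (- e) ` S" for e :: "real ^ 'n" and S by force
  then have shift_sets: "{x. x + e \<in> S} \<in> sets lebesgue" if "S \<in> sets lebesgue" for e :: "real ^ 'n" and S
    using that by (simp only: lebesgue_sets_translation)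
  have XY: "(+) e ` X e = Y e" if "e \<in> int_lattice" for e
  proof -
    have "x - e \<in> E \<longleftrightarrow> x \<in> E" for x
      using E(2)[unfolded lattice_invariant_def, rule_format, OF that, of "x - e"] by simp
    moreover have "x \<in> (+) e ` S \<longleftrightarrow> x - e \<in> S" for x S by force
    ultimately show ?thesis by (auto simp: set_eq_iff X_def Y_def)
  qed
  have ex1: "\<exists>!e. e \<in> int_lattice \<and> x + e \<in> F" "\<exists>!e. e \<in> int_lattice \<and> x + e \<in> F'" for x
    using F F' by (simp_all add: fundamental_domain_def)
  have "x \<in> (\<Union>e\<in>int_lattice. X e)" if x: "x \<in> E \<inter> F" for x
  proof -
    obtain e where "e \<in> int_lattice" "x + e \<in> F'" using ex1(2) by blast
    then show ?thesis using x by (intro UN_I[of e]) (auto simp: X_def)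
  qed
  then have EF: "E \<inter> F = (\<Union>e\<in>int_lattice. X e)" by (auto simp: X_def)
  have disjX: "disjoint_family_on X int_lattice"
    unfolding disjoint_family_on_def
  proof (intro ballI impI)
    fix e e' :: "real ^ 'n" assume e: "e \<in> int_lattice" "e' \<in> int_lattice" "e \<noteq> e'"
    have False if "x \<in> X e" "x \<in> X e'" for x
    proof -
      have "x + e \<in> F'" "x + e' \<in> F'" using that by (auto simp: X_def)
      then show False using ex1(2)[of x] e by blast
    qed
    then show "X e \<inter> X e' = {}" by blast
  qed
  have 1: "emeasure lebesgue (E \<inter> F) = (\<integral>\<^sup>+e. emeasure lebesgue (X e) \<partial>count_space int_lattice)"
    unfolding EF by (rule emeasure_UN_countable[OF _ countable_int_lattice disjX])
      (unfold X_def, intro sets.Int shift_sets E sets)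
  have "x \<in> (\<Union>e\<in>int_lattice. Y e)" if x: "x \<in> E \<inter> F'" for x
  proof -
    obtain e where "e \<in> int_lattice" "x + e \<in> F" using ex1(1) by blast
    then show ?thesis using x by (intro UN_I[of "- e"]) (auto simp: Y_def)
  qed
  then have EF': "E \<inter> F' = (\<Union>e\<in>int_lattice. Y e)" by (auto simp: Y_def)
  have disjY: "disjoint_family_on Y int_lattice"
    unfolding disjoint_family_on_def
  proof (intro ballI impI)
    fix e e' :: "real ^ 'n" assume e: "e \<in> int_lattice" "e' \<in> int_lattice" "e \<noteq> e'"
    have False if "x \<in> Y e" "x \<in> Y e'" for x
    proof -
      have "x + - e \<in> F" "x + - e' \<in> F" using that by (auto simp: Y_def)
      then have "- e = - e'" using ex1(1)[of x] e by (metis int_lattice_minus_iff)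
      then show False using e by simp
    qed
    then show "Y e \<inter> Y e' = {}" by blast
  qed
  have 2: "emeasure lebesgue (E \<inter> F') = (\<integral>\<^sup>+e. emeasure lebesgue (Y e) \<partial>count_space int_lattice)"
    unfolding EF' by (rule emeasure_UN_countable[OF _ countable_int_lattice disjY])
      (unfold Y_def, intro sets.Int shift_sets E sets)
  show ?thesis unfolding 1 2
    by (intro nn_integral_cong) (simp add: XY[symmetric] emeasure_translation)
qed

lemma measure_slab_le:
  fixes i :: "'n::finite"
  assumes "0 \<le> b" "0 \<le> \<rho>"
  shows "measure lebesgue {x \<in> cbox (\<chi> j. - b) (\<chi> j. b) :: (real ^ 'n) set. \<bar>x $ i - t\<bar> \<le> \<rho>}
    \<le> 2 * \<rho> * (2 * b) ^ (CARD('n) - 1)"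
proof -
  define lo :: "real ^ 'n" where "lo = (\<chi> j. if j = i then t - \<rho> else - b)"
  define hi :: "real ^ 'n" where "hi = (\<chi> j. if j = i then t + \<rho> else b)"
  have ne: "cbox lo hi \<noteq> {}"
    using assms unfolding interval_ne_empty_cart by (auto simp: lo_def hi_def)
  have "measure lebesgue {x \<in> cbox (\<chi> j. - b) (\<chi> j. b) :: (real ^ 'n) set. \<bar>x $ i - t\<bar> \<le> \<rho>} \<le> measure lebesgue (cbox lo hi)"
  proof (rule measure_mono_fmeasurable)
    show "{x \<in> cbox (\<chi> j. - b) (\<chi> j. b) :: (real ^ 'n) set. \<bar>x $ i - t\<bar> \<le> \<rho>} \<subseteq> cbox lo hi"
      by (auto simp: mem_box_cart lo_def hi_def abs_le_iff)
    have "closed ({x :: real ^ 'n. \<bar>x $ i - t\<bar> \<le> \<rho>})"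
      by (intro closed_Collect_le continuous_intros)
    then have "closed (cbox (\<chi> j. - b) (\<chi> j. b) \<inter> {x :: real ^ 'n. \<bar>x $ i - t\<bar> \<le> \<rho>})"
      by (intro closed_Int closed_cbox)
    then show "{x \<in> cbox (\<chi> j. - b) (\<chi> j. b) :: (real ^ 'n) set. \<bar>x $ i - t\<bar> \<le> \<rho>} \<in> sets lebesgue"
      by (simp add: Collect_conj_eq borel_closed)
  qed simp
  also have "measure lebesgue (cbox lo hi) = (\<Prod>j\<in>UNIV. hi $ j - lo $ j)"
    using content_cbox_cart[OF ne] by simp
  also have "\<dots> = (hi $ i - lo $ i) * (\<Prod>j\<in>UNIV - {i}. hi $ j - lo $ j)"
    by (rule prod.remove) auto
  also have "(\<Prod>j\<in>UNIV - {i}. hi $ j - lo $ j) = (\<Prod>j\<in>UNIV - {i}. 2 * b)"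
    by (intro prod.cong) (auto simp: lo_def hi_def)
  finally show ?thesis by (simp add: lo_def hi_def card_Diff_singleton)
qed

text \<open>Both sides equal \<open>\<integral>\<integral> 1\<^sub>E(a x) 1\<^sub>F(a x + y) dx dy\<close>: integrate over \<open>y\<close> first, or substitute
  \<open>x - B y\<close> for \<open>x\<close> and then integrate over \<open>y\<close>. This is the uniqueness proof for Haar measure.\<close>
lemma emeasure_linear_vimage_cross:
  fixes a B :: "'a::euclidean_space \<Rightarrow> 'a"
  assumes a: "linear a" and aB: "\<And>x. a (B x) = x" and E [measurable]: "E \<in> sets borel" and F [measurable]: "F \<in> sets borel"
  shows "emeasure lborel {x. a x \<in> E} * emeasure lborel F = emeasure lborel {x. a x \<in> F} * emeasure lborel E"
proof -
  have a_meas [measurable]: "a \<in> borel_measurable borel"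
    using a by (intro borel_measurable_continuous_onI linear_continuous_on linear_conv_bounded_linear[THEN iffD1])
  have shift: "(\<integral>\<^sup>+y. g (c + y) \<partial>lborel) = (\<integral>\<^sup>+y. g y \<partial>lborel)" if [measurable]: "g \<in> borel_measurable borel" for g :: "'a \<Rightarrow> ennreal" and c
  proof -
    have "(\<integral>\<^sup>+y. g y \<partial>lborel) = (\<integral>\<^sup>+y. g y \<partial>distr lborel borel ((+) c))" by (simp add: lborel_distr_plus)
    also have "\<dots> = (\<integral>\<^sup>+y. g (c + y) \<partial>lborel)" by (subst nn_integral_distr) auto
    finally show ?thesis ..
  qed
  have reflect: "(\<integral>\<^sup>+y. g (c - y) \<partial>lborel) = (\<integral>\<^sup>+y. g y \<partial>lborel)" if [measurable]: "g \<in> borel_measurable borel" for g :: "'a \<Rightarrow> ennreal" and c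
  proof -
    have "distr lborel borel (\<lambda>y. c - y) = (lborel :: 'a measure)"
      by (subst lborel_affine[of "-1" c]) (auto simp: density_1 one_ennreal_def[symmetric])
    then have "(\<integral>\<^sup>+y. g y \<partial>lborel) = (\<integral>\<^sup>+y. g y \<partial>distr lborel borel (\<lambda>y. c - y))" by simp
    also have "\<dots> = (\<integral>\<^sup>+y. g (c - y) \<partial>lborel)" by (subst nn_integral_distr) auto
    finally show ?thesis ..
  qed
  have vim: "emeasure lborel {x. a x \<in> S} = (\<integral>\<^sup>+x. indicator S (a x) \<partial>lborel)" if [measurable]: "S \<in> sets borel" for S
  proof -
    have "{x. a x \<in> S} \<in> sets borel" by measurable
    then have "emeasure lborel {x. a x \<in> S} = (\<integral>\<^sup>+x. indicator {x. a x \<in> S} x \<partial>lborel)" by simp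
    then show ?thesis by (simp add: indicator_def)
  qed
  have "emeasure lborel {x. a x \<in> E} * emeasure lborel F = (\<integral>\<^sup>+x. \<integral>\<^sup>+y. indicator E (a x) * indicator F y \<partial>lborel \<partial>lborel)"
    by (simp add: vim nn_integral_cmult nn_integral_multc)
  also have "\<dots> = (\<integral>\<^sup>+x. \<integral>\<^sup>+y. indicator E (a x) * indicator F (a x + y) \<partial>lborel \<partial>lborel)"
    by (simp add: nn_integral_cmult shift[of "indicator F"])
  also have "\<dots> = (\<integral>\<^sup>+y. \<integral>\<^sup>+x. indicator E (a x) * indicator F (a x + y) \<partial>lborel \<partial>lborel)"
    by (rule lborel_pair.Fubini'[symmetric]) measurable
  also have "\<dots> = (\<integral>\<^sup>+y. \<integral>\<^sup>+x. indicator E (a (- B y + x)) * indicator F (a (- B y + x) + y) \<partial>lborel \<partial>lborel)"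
    by (intro nn_integral_cong shift[symmetric]) measurable
  also have "\<dots> = (\<integral>\<^sup>+y. \<integral>\<^sup>+x. indicator F (a x) * indicator E (a x - y) \<partial>lborel \<partial>lborel)"
    by (simp add: linear_diff[OF a] aB mult.commute)
  also have "\<dots> = (\<integral>\<^sup>+x. \<integral>\<^sup>+y. indicator F (a x) * indicator E (a x - y) \<partial>lborel \<partial>lborel)"
    by (rule lborel_pair.Fubini') measurable
  also have "\<dots> = (\<integral>\<^sup>+x. indicator F (a x) * (\<integral>\<^sup>+y. indicator E y \<partial>lborel) \<partial>lborel)"
    by (simp add: nn_integral_cmult reflect[of "indicator E"])
  also have "\<dots> = emeasure lborel {x. a x \<in> F} * emeasure lborel E"
    by (simp add: vim nn_integral_multc)
  finally show ?thesis .
qed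

text \<open>For the inverse of a map that preserves the lattice, the scaling factor is found later by adding
  up the volumes of all \<open>r\<close> inverse branches.\<close>
lemma measure_linear_bijection:
  fixes a B :: "'a::euclidean_space \<Rightarrow> 'a"
  assumes a: "linear a" and B: "linear B" and aB: "\<And>x. a (B x) = x" and Ba: "\<And>x. B (a x) = x" and "S \<in> lmeasurable"
  shows "B ` S \<in> lmeasurable \<and> measure lebesgue (B ` S) = measure lebesgue (B ` cbox 0 One) * measure lebesgue S"
proof -
  have img: "B ` T = {x. a x \<in> T}" for T
    by (auto simp: image_iff aB) (metis Ba)
  have cube: "measure lebesgue (cbox 0 (One :: 'a)) = 1" by simp
  have "measure lebesgue (B ` cbox l u) = measure lebesgue (B ` cbox 0 One) * measure lebesgue (cbox l u)" for l u
  proof -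
    have "a \<in> borel_measurable borel"
      using a by (intro borel_measurable_continuous_onI linear_continuous_on linear_conv_bounded_linear[THEN iffD1])
    then have sets: "{x. a x \<in> cbox l' u'} \<in> sets borel" for l' u'
      using measurable_sets[of a borel borel "cbox l' u'"] by (simp add: vimage_def)
    have "emeasure lborel {x. a x \<in> cbox l u} * emeasure lborel (cbox 0 (One :: 'a)) = emeasure lborel {x. a x \<in> cbox 0 One} * emeasure lborel (cbox l u)"
      by (rule emeasure_linear_vimage_cross[OF a aB]) auto
    then have "measure lborel {x. a x \<in> cbox l u} * measure lborel (cbox 0 (One :: 'a)) = measure lborel {x. a x \<in> cbox 0 One} * measure lborel (cbox l u)"
      unfolding measure_def enn2real_mult[symmetric] by simp
    then show ?thesis unfolding img using sets cube by simp
  qed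
  from measure_linear_sufficient[OF B \<open>S \<in> lmeasurable\<close> this] show ?thesis by simp
qed

section \<open>Itineraries of uniformly labelled systems\<close>

definition itinerary :: "('a \<Rightarrow> 'a) \<Rightarrow> ('a \<Rightarrow> 'b) \<Rightarrow> 'a \<Rightarrow> nat \<Rightarrow> 'b" where
  "itinerary f l x j = l ((f ^^ j) x)"

definition prefix_word :: "nat \<Rightarrow> (nat \<Rightarrow> 'b) \<Rightarrow> 'b list" where
  "prefix_word n \<omega> = map \<omega> [0..<n]"

lemma length_prefix_word [simp]: "length (prefix_word n \<omega>) = n"
  by (simp add: prefix_word_def)

lemma prefix_word_0 [simp]: "prefix_word 0 \<omega> = []"
  by (simp add: prefix_word_def)

lemma prefix_word_Suc: "prefix_word (Suc n) \<omega> = \<omega> 0 # prefix_word n (left_shift \<omega>)"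
  unfolding prefix_word_def left_shift_def
  by (rule nth_equalityI) (auto simp: nth_Cons split: nat.splits simp del: upt_Suc)

lemma itinerary_0 [simp]: "itinerary f l x 0 = l x"
  by (simp add: itinerary_def)

lemma itinerary_apply: "itinerary f l (f x) = left_shift (itinerary f l x)"
  by (simp add: itinerary_def left_shift_def funpow_swap1 fun_eq_iff)

lemma itinerary_funpow: "itinerary f l ((f ^^ n) x) j = itinerary f l x (n + j)"
  by (simp add: itinerary_def add.commute[of n] funpow_add)

lemma measurable_itinerary:
  assumes f: "f \<in> M \<rightarrow>\<^sub>M M" and lab: "lab \<in> M \<rightarrow>\<^sub>M count_space UNIV"
    and lab_in: "\<And>x. x \<in> space M \<Longrightarrow> lab x \<in> {1..r}"
  shows "itinerary f lab \<in> M \<rightarrow>\<^sub>M PiM UNIV (\<lambda>_::nat. point_measure {1..r :: nat} p)"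
proof (rule measurable_PiM_single')
  have pow: "(f ^^ j) \<in> M \<rightarrow>\<^sub>M M" for j
    by (induction j) (auto intro: measurable_compose[OF _ f] simp: id_def[symmetric])
  then have in_r: "itinerary f lab x j \<in> {1..r}" if "x \<in> space M" for x j
    unfolding itinerary_def using that by (intro lab_in measurable_space[OF pow])
  fix j :: nat
  have "(\<lambda>x. itinerary f lab x j) \<in> M \<rightarrow>\<^sub>M count_space UNIV"
    unfolding itinerary_def using pow lab by measurable
  then have "(\<lambda>x. itinerary f lab x j) \<in> M \<rightarrow>\<^sub>M count_space {1..r}"
    using in_r by (intro measurable_count_space_eq2[THEN iffD2] conjI) (auto intro!: measurable_sets)
  moreover have "sets (point_measure {1..r} p) = sets (count_space {1..r})" by (simp add: sets_point_measure)
  ultimately show "(\<lambda>x. itinerary f lab x j) \<in> M \<rightarrow>\<^sub>M point_measure {1..r} p"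
    using measurable_cong_sets by blast
  show "itinerary f lab \<in> space M \<rightarrow> (UNIV \<rightarrow>\<^sub>E space (point_measure {1..r} p))"
    using in_r by (auto simp: space_point_measure)
qed

text \<open>The last assumption says that the label is uniform and independent of the image point. It holds
  when every point has \<open>r\<close> preimages of equal weight and each label names one of them; summed over
  \<open>i\<close> it makes \<open>f\<close> measure preserving.\<close>
locale uniform_labels = prob_space M for M :: "'a measure" +
  fixes f :: "'a \<Rightarrow> 'a" and lab :: "'a \<Rightarrow> nat" and r :: nat
  assumes f_meas [measurable]: "f \<in> M \<rightarrow>\<^sub>M M"
    and lab_meas [measurable]: "lab \<in> M \<rightarrow>\<^sub>M count_space UNIV"
    and lab_in: "x \<in> space M \<Longrightarrow> lab x \<in> {1..r}"
    and uniform: "E \<in> sets M \<Longrightarrow> i \<in> {1..r} \<Longrightarrow>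
      prob {x \<in> space M. lab x = i \<and> f x \<in> E} = prob E / real r"
begin

abbreviation itin :: "'a \<Rightarrow> nat \<Rightarrow> nat" where
  "itin \<equiv> itinerary f lab"

lemma r_pos: "r > 0"
proof -
  obtain x where "x \<in> space M" using not_empty by blast
  then show ?thesis using lab_in[of x] by auto
qed

lemma funpow_f_meas [measurable]: "(f ^^ n) \<in> M \<rightarrow>\<^sub>M M"
  by (induction n) (auto intro: measurable_comp simp: id_def[symmetric])

lemma itin_meas [measurable]: "(\<lambda>x. itin x j) \<in> M \<rightarrow>\<^sub>M count_space UNIV"
  unfolding itinerary_def by measurable

lemma itin_in: "x \<in> space M \<Longrightarrow> itin x j \<in> {1..r}"
  unfolding itinerary_def by (intro lab_in measurable_space[OF funpow_f_meas])

lemma prefix_word_meas [measurable]: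
  "(\<lambda>x. prefix_word n (itin x)) \<in> M \<rightarrow>\<^sub>M count_space UNIV"
proof (induction n)
  case (Suc n)
  note Suc[measurable]
  have "(\<lambda>x. lab x # prefix_word n (itin (f x))) \<in> M \<rightarrow>\<^sub>M count_space UNIV"
    by (rule measurable_compose_countable[where f = "\<lambda>i x. i # prefix_word n (itin (f x))"]) measurable
  then show ?case by (simp add: prefix_word_Suc itinerary_apply)
qed simp

lemma prob_itinerary_in:
  assumes "\<And>j. A j \<subseteq> {1..r}" and E: "E \<in> sets M"
  shows "prob {x \<in> space M. (\<forall>j<n. itin x j \<in> A j) \<and> (f ^^ n) x \<in> E}
    = (\<Prod>j<n. card (A j) / real r) * prob E"
  using assms(1)
proof (induction n arbitrary: A)
  case 0
  have "{x \<in> space M. x \<in> E} = E" using sets.sets_into_space[OF E] by auto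
  then show ?case by simp
next
  case (Suc n)
  define D where "D = {x \<in> space M. (\<forall>j<n. itin x j \<in> A (Suc j)) \<and> (f ^^ n) x \<in> E}"
  have D [measurable]: "D \<in> sets M" unfolding D_def using E by measurable
  have fin: "finite (A 0)" using Suc.prems[of 0] finite_subset by blast
  have "{x \<in> space M. (\<forall>j<Suc n. itin x j \<in> A j) \<and> (f ^^ Suc n) x \<in> E}
      = (\<Union>i\<in>A 0. {x \<in> space M. lab x = i \<and> f x \<in> D})"
    using measurable_space[OF f_meas]
    by (auto simp: D_def itinerary_apply left_shift_def less_Suc_eq_0_disj funpow_swap1)
  also have "prob \<dots> = (\<Sum>i\<in>A 0. prob {x \<in> space M. lab x = i \<and> f x \<in> D})"
    by (rule finite_measure_finite_Union) (use fin in \<open>auto simp: disjoint_family_on_def\<close>)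
  also have "\<dots> = (\<Sum>i\<in>A 0. prob D / real r)"
    using Suc.prems[of 0] by (intro sum.cong uniform D) auto
  also have "\<dots> = card (A 0) / real r * prob D" by simp
  also have "prob D = (\<Prod>j<n. card (A (Suc j)) / real r) * prob E"
    unfolding D_def by (rule Suc.IH) (rule Suc.prems)
  finally show ?case by (simp only: prod.lessThan_Suc_shift mult.assoc)
qed

lemma prefix_word_eq_iff:
  "prefix_word n \<omega> = w \<longleftrightarrow> length w = n \<and> (\<forall>j<n. \<omega> j = w ! j)"
  by (auto simp: prefix_word_def list_eq_iff_nth_eq)

lemma set_prefix_word: "x \<in> space M \<Longrightarrow> set (prefix_word n (itin x)) \<subseteq> {1..r}"
  using itin_in by (auto simp: prefix_word_def)

lemma prob_prefix_word_in:
  assumes G: "G \<subseteq> {w. set w \<subseteq> {1..r} \<and> length w = n}" and E [measurable]: "E \<in> sets M"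
  shows "prob {x \<in> space M. prefix_word n (itin x) \<in> G \<and> (f ^^ n) x \<in> E} = card G / real r ^ n * prob E"
proof -
  have "finite G" using G finite_lists_length_eq[of "{1..r}" n] finite_subset by auto
  have "{x \<in> space M. prefix_word n (itin x) \<in> G \<and> (f ^^ n) x \<in> E}
      = (\<Union>w\<in>G. {x \<in> space M. prefix_word n (itin x) = w \<and> (f ^^ n) x \<in> E})" by auto
  also have "prob \<dots> = (\<Sum>w\<in>G. prob {x \<in> space M. prefix_word n (itin x) = w \<and> (f ^^ n) x \<in> E})"
    by (rule finite_measure_finite_Union) (use \<open>finite G\<close> in \<open>auto simp: disjoint_family_on_def\<close>)
  also have "\<dots> = (\<Sum>w\<in>G. prob E / real r ^ n)"
  proof (intro sum.cong refl)
    fix w assume "w \<in> G"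
    then have w: "set w \<subseteq> {1..r}" "length w = n" using G by auto
    define A where "A j = (if j < n then {w ! j} else {})" for j
    have "{x \<in> space M. prefix_word n (itin x) = w \<and> (f ^^ n) x \<in> E}
        = {x \<in> space M. (\<forall>j<n. itin x j \<in> A j) \<and> (f ^^ n) x \<in> E}"
      using w by (auto simp: prefix_word_eq_iff A_def)
    moreover have "A j \<subseteq> {1..r}" for j using subsetD[OF w(1) nth_mem[of j]] w(2) by (auto simp: A_def)
    ultimately show "prob {x \<in> space M. prefix_word n (itin x) = w \<and> (f ^^ n) x \<in> E} = prob E / real r ^ n"
      using prob_itinerary_in[of A E n] by (simp add: A_def power_divide)
  qed
  finally show ?thesis by simp
qed

lemma prob_funpow_vimage:
  assumes "E \<in> sets M"
  shows "prob {x \<in> space M. (f ^^ n) x \<in> E} = prob E"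
proof -
  have "{x \<in> space M. (f ^^ n) x \<in> E} = {x \<in> space M. (\<forall>j<n. itin x j \<in> {1..r}) \<and> (f ^^ n) x \<in> E}"
    using itin_in by blast
  then show ?thesis using prob_itinerary_in[of "\<lambda>_. {1..r}" E n] assms r_pos by simp
qed

text \<open>The prefix up to time \<open>n\<close> is independent of everything from time \<open>n\<close> on, hence of the event that
  the \<^emph>\<open>last\<close> run of \<open>z\<close>s in a long window starts at \<open>n\<close>. These events are disjoint, and some run occurs
  in a long window with probability close to one.\<close>
lemma prob_good_prefix_before_run:
  assumes z: "z \<in> {1..r}"
    and bad: "\<And>n. real (card {w. set w \<subseteq> {1..r} \<and> length w = n \<and> w \<notin> G}) \<le> \<eta> * real r ^ n"
  shows "1 - \<eta> \<le> prob {x \<in> space M. \<exists>n\<ge>n0. prefix_word n (itin x) \<in> G \<and> (\<forall>j<K. itin x (n + j) = z)}"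
    (is "_ \<le> prob ?Goal")
proof -
  have words: "finite {w. set w \<subseteq> {1..r} \<and> length w = n}" "card {w. set w \<subseteq> {1..r} \<and> length w = n} = r ^ n" for n
    by (simp_all add: finite_lists_length_eq card_lists_length_eq)
  define R where "R = {y \<in> space M. \<forall>j<K. itin y j = z}"
  have R [measurable]: "R \<in> sets M" unfolding R_def by measurable
  have Goal [measurable]: "?Goal \<in> sets M" by measurable
  define \<rho> where "\<rho> = 1 - 1 / real r ^ K"
  have \<rho>: "0 \<le> \<rho>" "\<rho> < 1" using r_pos by (auto simp: \<rho>_def)
  \<comment> \<open>looking for runs only at multiples of \<open>K\<close> gives independent trials\<close>
  define U where "U q = {y \<in> space M. \<forall>l<q. (f ^^ (l * K)) y \<notin> R}" for q
  have U [measurable]: "U q \<in> sets M" for q unfolding U_def by measurable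
  have probU: "prob (U q) = \<rho> ^ q" for q
  proof (induction q)
    case 0
    then show ?case by (simp add: U_def prob_space)
  next
    case (Suc q)
    let ?G = "{w. set w \<subseteq> {1..r} \<and> length w = K} - {replicate K z}"
    have "U (Suc q) = {y \<in> space M. prefix_word K (itin y) \<in> ?G \<and> (f ^^ K) y \<in> U q}"
    proof -
      have "prefix_word K (itin y) \<in> ?G \<longleftrightarrow> y \<notin> R" if "y \<in> space M" for y
        using that set_prefix_word[OF that, of K] by (simp add: R_def prefix_word_eq_iff)
      moreover have "(\<forall>l<Suc q. (f ^^ (l * K)) y \<notin> R) \<longleftrightarrow> y \<notin> R \<and> (\<forall>l<q. (f ^^ (l * K)) ((f ^^ K) y) \<notin> R)" for y
        unfolding less_Suc_eq_0_disj by (auto simp: funpow_add[symmetric] add.commute simp flip: comp_apply[of "f ^^ _" "f ^^ _"])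
      ultimately show ?thesis
        using measurable_space[OF funpow_f_meas] unfolding U_def by blast
    qed
    then have "prob (U (Suc q)) = card ?G / real r ^ K * prob (U q)"
      using prob_prefix_word_in[of ?G K "U q"] by auto
    also have "card ?G = r ^ K - 1"
      using z by (subst card_Diff_subset) (auto simp: words[simplified])
    also have "real (r ^ K - 1) / real r ^ K = \<rho>"
      using r_pos by (simp add: \<rho>_def field_simps of_nat_diff)
    finally show ?case using Suc by simp
  qed
  have \<eta>: "0 \<le> \<eta>" using order_trans[OF of_nat_0_le_iff bad[of 0]] by simp
  have bound: "(1 - \<eta>) * (1 - \<rho> ^ q) \<le> prob ?Goal" for q
  proof (cases "\<eta> \<le> 1")
    case True
    define L where "L = Suc (q * K)"
    \<comment> \<open>\<open>T i\<close>: the last run in the window \<open>[n0, n0 + L)\<close> starts at \<open>n0 + i\<close>; \<open>S i\<close> expresses this in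
      terms of the iterate at that time, which is independent of the prefix\<close>
    define S where "S i = {y \<in> space M. y \<in> R \<and> (\<forall>j. 0 < j \<and> i + j < L \<longrightarrow> (f ^^ j) y \<notin> R)}" for i
    have S [measurable]: "S i \<in> sets M" for i unfolding S_def by measurable
    define T where "T i = {x \<in> space M. (f ^^ (n0 + i)) x \<in> S i}" for i
    have T [measurable]: "T i \<in> sets M" for i unfolding T_def by measurable
    define P where "P i = {x \<in> space M. prefix_word (n0 + i) (itin x) \<in> G \<and> (f ^^ (n0 + i)) x \<in> S i}" for i
    have P [measurable]: "P i \<in> sets M" for i unfolding P_def by measurable
    have T_iff: "x \<in> T i \<longleftrightarrow> x \<in> space M \<and> (f ^^ (n0 + i)) x \<in> R \<and> (\<forall>j. i < j \<and> j < L \<longrightarrow> (f ^^ (n0 + j)) x \<notin> R)" for x i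
    proof -
      have "(\<forall>j. 0 < j \<and> i + j < L \<longrightarrow> (f ^^ j) ((f ^^ (n0 + i)) x) \<notin> R)
          \<longleftrightarrow> (\<forall>j. i < j \<and> j < L \<longrightarrow> (f ^^ (n0 + j)) x \<notin> R)" (is "?l \<longleftrightarrow> ?r")
      proof
        assume l: ?l
        show ?r
        proof (intro allI impI)
          fix j assume j: "i < j \<and> j < L"
          then have "(f ^^ (j - i)) ((f ^^ (n0 + i)) x) \<notin> R" using l by simp
          moreover have "(f ^^ (j - i)) ((f ^^ (n0 + i)) x) = (f ^^ (j - i + (n0 + i))) x" by (simp only: funpow_add comp_apply)
          moreover have "j - i + (n0 + i) = n0 + j" using j by simp
          ultimately show "(f ^^ (n0 + j)) x \<notin> R" by simp
        qed
      next
        assume r: ?r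
        show ?l
        proof (intro allI impI)
          fix j assume j: "0 < j \<and> i + j < L"
          then have "(f ^^ (n0 + (i + j))) x \<notin> R" using r by simp
          moreover have "(f ^^ j) ((f ^^ (n0 + i)) x) = (f ^^ (j + (n0 + i))) x" by (simp only: funpow_add comp_apply)
          moreover have "j + (n0 + i) = n0 + (i + j)" by simp
          ultimately show "(f ^^ j) ((f ^^ (n0 + i)) x) \<notin> R" by simp
        qed
      qed
      then show ?thesis using measurable_space[OF funpow_f_meas] by (auto simp: T_def S_def)
    qed
    have "1 - \<rho> ^ q = prob (space M - {x \<in> space M. (f ^^ n0) x \<in> U q})"
      by (subst prob_compl) (simp_all add: prob_funpow_vimage probU)
    also have "\<dots> \<le> prob (\<Union>i<L. T i)"
    proof (intro finite_measure_mono subsetI)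
      fix x assume "x \<in> space M - {x \<in> space M. (f ^^ n0) x \<in> U q}"
      then have x: "x \<in> space M" "(f ^^ n0) x \<notin> U q" by auto
      then obtain l where l: "l < q" "(f ^^ (l * K)) ((f ^^ n0) x) \<in> R"
        using measurable_space[OF funpow_f_meas, of x n0] by (auto simp: U_def)
      have eq: "(f ^^ (l * K)) ((f ^^ n0) x) = (f ^^ (n0 + l * K)) x"
        by (simp add: add.commute[of n0] funpow_add)
      define I where "I = {i. i < L \<and> (f ^^ (n0 + i)) x \<in> R}"
      have "l * K \<in> I" using l eq by (auto simp: I_def L_def le_imp_less_Suc)
      moreover have "finite I" by (simp add: I_def)
      ultimately have "Max I \<in> I" "\<And>j. j \<in> I \<Longrightarrow> j \<le> Max I" by (auto intro: Max_in)
      then have "x \<in> T (Max I)" "Max I < L"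
        unfolding T_iff using x by (auto simp: I_def not_less[symmetric])
      then show "x \<in> (\<Union>i<L. T i)" by blast
    qed measurable
    also have "\<dots> \<le> (\<Sum>i<L. prob (T i))"
      by (rule finite_measure_subadditive_finite) auto
    finally have "(1 - \<eta>) * (1 - \<rho> ^ q) \<le> (1 - \<eta>) * (\<Sum>i<L. prob (T i))"
      using True by (intro mult_left_mono) auto
    also have "\<dots> = (\<Sum>i<L. (1 - \<eta>) * prob (S i))"
      by (simp add: T_def prob_funpow_vimage sum_distrib_left)
    also have "\<dots> \<le> (\<Sum>i<L. prob (P i))"
    proof (rule sum_mono)
      fix i
      let ?W = "{w. set w \<subseteq> {1..r} \<and> length w = n0 + i}"
      let ?Bad = "{w. set w \<subseteq> {1..r} \<and> length w = n0 + i \<and> w \<notin> G}"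
      have P_eq: "P i = {x \<in> space M. prefix_word (n0 + i) (itin x) \<in> ?W - ?Bad \<and> (f ^^ (n0 + i)) x \<in> S i}"
        using set_prefix_word by (auto simp: P_def)
      have "real (card (?W - ?Bad)) = real r ^ (n0 + i) - real (card ?Bad)"
      proof -
        have sub: "?Bad \<subseteq> ?W" by auto
        then have "finite ?Bad" using words(1) finite_subset by blast
        then show ?thesis
          using card_Diff_subset[OF _ sub] card_mono[OF words(1) sub] by (simp only: of_nat_diff words of_nat_power)
      qed
      then have "real (card (?W - ?Bad)) \<ge> (1 - \<eta>) * real r ^ (n0 + i)"
        using bad[of "n0 + i"] by (simp only: left_diff_distrib mult_1)
      then have "1 - \<eta> \<le> card (?W - ?Bad) / real r ^ (n0 + i)"
        using r_pos by (simp add: pos_le_divide_eq)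
      then have "(1 - \<eta>) * prob (S i) \<le> card (?W - ?Bad) / real r ^ (n0 + i) * prob (S i)"
        by (intro mult_right_mono) auto
      also have "\<dots> = prob (P i)"
        unfolding P_eq by (subst prob_prefix_word_in) auto
      finally show "(1 - \<eta>) * prob (S i) \<le> prob (P i)" .
    qed
    also have "\<dots> = prob (\<Union>i<L. P i)"
    proof (rule finite_measure_finite_Union[symmetric])
      have "P i \<subseteq> T i" for i by (auto simp: P_def T_def)
      moreover have "T i \<inter> T j = {}" if "i < j" "j < L" for i j
        using that by (auto simp: T_iff)
      ultimately show "disjoint_family_on P {..<L}"
        unfolding disjoint_family_on_def by (metis (no_types, lifting) disjoint_iff lessThan_iff linorder_neqE_nat subset_iff)
    qed auto
    also have "\<dots> \<le> prob ?Goal"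
    proof (intro finite_measure_mono subsetI)
      fix x assume "x \<in> (\<Union>i<L. P i)"
      then obtain i where i: "x \<in> P i" by blast
      then have "\<forall>j<K. itin x (n0 + i + j) = z"
        by (auto simp: P_def S_def R_def itinerary_funpow)
      with i show "x \<in> ?Goal" by (auto simp: P_def intro!: exI[of _ "n0 + i"])
    qed measurable
    finally show ?thesis .
  next
    case False
    have "\<rho> ^ q \<le> 1" using \<rho> by (simp add: power_le_one)
    then have "(1 - \<eta>) * (1 - \<rho> ^ q) \<le> 0" using False by (intro mult_nonpos_nonneg) auto
    then show ?thesis using measure_nonneg order_trans by blast
  qed
  have "(\<lambda>q. (1 - \<eta>) * (1 - \<rho> ^ q)) \<longlonglongrightarrow> (1 - \<eta>) * (1 - 0)"
    using \<rho> by (intro tendsto_intros LIMSEQ_power_zero) auto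
  then show ?thesis
    using bound by (intro LIMSEQ_le_const2[where X = "\<lambda>q. (1 - \<eta>) * (1 - \<rho> ^ q)"]) auto
qed

lemma distr_itinerary:
  defines "N \<equiv> PiM UNIV (\<lambda>_::nat. point_measure {1..r} (\<lambda>i. ennreal (1 / real r)))"
  shows "itin \<in> M \<rightarrow>\<^sub>M N" "distr M N itin = N"
proof -
  let ?P = "point_measure {1..r} (\<lambda>i. ennreal (1 / real r))"
  have emP: "emeasure ?P X = ennreal (card X / real r)" if "X \<subseteq> {1..r}" for X
    using that by (subst emeasure_point_measure_finite)
      (auto simp: ennreal_of_nat_eq_real_of_nat ennreal_mult'[symmetric])
  have "prob_space ?P"
    by standard (use r_pos in \<open>simp only: emP[OF order_refl] space_point_measure, simp\<close>)
  then interpret P: product_prob_space "\<lambda>_. ?P" "UNIV :: nat set"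
    by (simp add: product_prob_space_def product_sigma_finite_def prob_space_imp_sigma_finite product_prob_space_axioms_def)
  show meas: "itin \<in> M \<rightarrow>\<^sub>M N"
    unfolding N_def by (rule measurable_itinerary[OF f_meas lab_meas lab_in])
  have "N = distr M N itin"
    unfolding N_def
  proof (rule measure_eqI_PiM_infinite)
    fix A J assume J: "finite (J :: nat set)" and A: "\<And>i. i \<in> J \<Longrightarrow> A i \<in> sets ?P"
    let ?X = "prod_emb UNIV (\<lambda>_. ?P) J (Pi\<^sub>E J A)"
    obtain n where n: "J \<subseteq> {..<n}" using J finite_nat_iff_bounded by blast
    then have J_less: "j < n" if "j \<in> J" for j using that by auto
    define A' where "A' j = (if j \<in> J then A j else {1..r})" for j
    have A': "A' j \<subseteq> {1..r}" for j using A by (auto simp: A'_def sets_point_measure)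
    have X: "?X \<in> sets (PiM UNIV (\<lambda>_. ?P))" using J A by (intro sets_PiM_I) auto
    have "itin -` ?X \<inter> space M = {x \<in> space M. (\<forall>j<n. itin x j \<in> A' j) \<and> (f ^^ n) x \<in> space M}"
      using itin_in measurable_space[OF funpow_f_meas] J_less
      by (auto simp: prod_emb_def A'_def space_point_measure PiE_iff)
    then have "emeasure (distr M (PiM UNIV (\<lambda>_. ?P)) itin) ?X = ennreal (\<Prod>j<n. card (A' j) / real r)"
      using emeasure_distr[OF meas[unfolded N_def] X] prob_itinerary_in[of A' "space M" n] A'
      by (simp add: emeasure_eq_measure prob_space)
    also have "(\<Prod>j<n. card (A' j) / real r) = (\<Prod>j\<in>J. card (A j) / real r)"
      using n r_pos by (intro prod.mono_neutral_cong_right) (auto simp: A'_def)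
    also have "ennreal \<dots> = (\<Prod>j\<in>J. emeasure ?P (A j))"
      using A by (subst prod_ennreal[symmetric]) (auto simp: emP[simplified] sets_point_measure intro!: prod.cong)
    also have "\<dots> = emeasure (PiM UNIV (\<lambda>_. ?P)) ?X"
      using J A by (subst P.emeasure_PiM_emb) auto
    finally show "emeasure (PiM UNIV (\<lambda>_. ?P)) ?X = emeasure (distr M (PiM UNIV (\<lambda>_. ?P)) itin) ?X" ..
  next
    show "finite_measure (PiM UNIV (\<lambda>_::nat. ?P))"
      by (intro prob_space.finite_measure prob_space_PiM \<open>prob_space ?P\<close>)
  qed auto
  then show "distr M N itin = N" ..
qed

end

section \<open>From almost sure decoding to an isomorphism\<close>

text \<open>A factor map \<open>\<phi>\<close> with an almost sure left inverse \<open>\<Psi>\<close> is an isomorphism. The set \<open>X\<close> of points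
  all of whose iterates are recovered by \<open>\<Psi>\<close> is forward invariant, and \<open>\<phi>\<close> is injective on it.
  Its image is measurable because it contains a set of full measure defined through \<open>\<Psi>\<close>, and the
  target measure is complete.

  Both sides are completed, but \<open>\<phi>\<close> and \<open>\<Psi>\<close> are measurable for the smaller sigma-algebras; the
  sandwich assumption says that \<open>M\<close> is the completion of the smaller one.\<close>
lemma mp_isomorphic_completionI:
  fixes M M0 :: "'a measure" and N :: "'b measure"
  assumes "prob_space M" "complete_measure M"
    and M0: "space M0 = space M" "sets M0 \<subseteq> sets M"
    and sandwich: "\<And>E. E \<in> sets M \<Longrightarrow> \<exists>E1\<in>sets M0. \<exists>E2\<in>sets M0. E1 \<subseteq> E \<and> E \<subseteq> E2 \<and> E2 - E1 \<in> null_sets M"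
    and \<phi>: "\<phi> \<in> M0 \<rightarrow>\<^sub>M N" and distr_\<phi>: "distr M N \<phi> = N"
    and \<Psi>: "\<Psi> \<in> N \<rightarrow>\<^sub>M M0"
    and section_sets: "{\<omega> \<in> space N. \<phi> (\<Psi> \<omega>) = \<omega>} \<in> sets N"
    and recover: "AE x in M. \<Psi> (\<phi> x) = x"
    and f: "f \<in> M \<rightarrow>\<^sub>M M" "distr M M f = M"
    and conj: "\<And>x. x \<in> space M \<Longrightarrow> \<phi> (f x) = g (\<phi> x)"
  shows "mp_isomorphic M f (completion N) g"
proof -
  interpret M: prob_space M by fact
  interpret M: complete_measure M by fact
  have \<phi>_M: "\<phi> \<in> M \<rightarrow>\<^sub>M N"
    using \<phi> M0 by (auto simp: measurable_def)
  have pow: "(f ^^ n) \<in> M \<rightarrow>\<^sub>M M \<and> distr M M (f ^^ n) = M" for n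
  proof (induction n)
    case 0
    then show ?case using distr_id[of M] by (simp add: id_def)
  next
    case (Suc n)
    have "distr M M (f \<circ> (f ^^ n)) = distr (distr M M (f ^^ n)) M f"
      using Suc f by (intro distr_distr[symmetric]) auto
    then show ?case using Suc f by (auto intro: measurable_comp simp: o_def)
  qed
  define X where "X = {x \<in> space M. \<forall>n. \<Psi> (\<phi> ((f ^^ n) x)) = (f ^^ n) x}"
  have "AE x in M. \<forall>n. \<Psi> (\<phi> ((f ^^ n) x)) = (f ^^ n) x"
    unfolding AE_all_countable
  proof
    fix n
    have "AE y in distr M M (f ^^ n). \<Psi> (\<phi> y) = y" using recover by (simp only: pow[THEN conjunct2])
    then show "AE x in M. \<Psi> (\<phi> ((f ^^ n) x)) = (f ^^ n) x"
      by (rule AE_distrD[OF pow[THEN conjunct1]])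
  qed
  then have "{x \<in> space M. \<not> (\<forall>n. \<Psi> (\<phi> ((f ^^ n) x)) = (f ^^ n) x)} \<in> null_sets M"
    by (simp only: M.AE_iff_null_sets)
  moreover have "{x \<in> space M. \<not> (\<forall>n. \<Psi> (\<phi> ((f ^^ n) x)) = (f ^^ n) x)} = space M - X"
    by (auto simp: X_def)
  ultimately have X_null: "space M - X \<in> null_sets M" by simp
  have X_sub: "X \<subseteq> space M" by (auto simp: X_def)
  have X_sets: "X \<in> sets M"
  proof -
    have "X = space M - (space M - X)" using X_sub by blast
    then show ?thesis using X_null by (metis null_setsD2 sets.compl_sets)
  qed
  have AE_X: "AE x in M. x \<in> X"
    using X_null X_sub by (auto intro!: AE_I'[of "space M - X"])
  \<comment> \<open>the exceptional set is enlarged to one that \<open>\<Psi>\<close> can pull back\<close>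
  obtain E1 Z where Z: "E1 \<in> sets M0" "Z \<in> sets M0" "E1 \<subseteq> space M - X" "space M - X \<subseteq> Z" "Z - E1 \<in> null_sets M"
    using sandwich[OF null_setsD2[OF X_null]] by blast
  have "Z \<subseteq> (Z - E1) \<union> (space M - X)" using Z by blast
  then have Z_null: "Z \<in> null_sets M"
    by (rule null_sets_subset[OF null_sets.Un[OF Z(5) X_null] subsetD[OF M0(2) Z(2)]])
  define Y where "Y = \<phi> ` X"
  define Y' where "Y' = {\<omega> \<in> space N. \<phi> (\<Psi> \<omega>) = \<omega>} \<inter> (\<Psi> -` (space M - Z) \<inter> space N)"
  have Y'_sets: "Y' \<in> sets N"
    unfolding Y'_def
    by (intro sets.Int section_sets measurable_sets[OF \<Psi>]) (use sets.compl_sets[OF Z(2)] M0(1) in simp)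
  then have Y'_eq: "{\<omega> \<in> space N. \<omega> \<in> Y'} = Y'" using sets.sets_into_space by blast
  have "AE x in M. \<phi> x \<in> Y'"
    using AE_X AE_not_in[OF Z_null] AE_space
  proof eventually_elim
    case (elim x)
    then have "\<Psi> (\<phi> x) = x" by (auto simp: X_def dest: spec[of _ 0])
    then show ?case using elim measurable_space[OF \<phi>_M] by (auto simp: Y'_def)
  qed
  then have "AE \<omega> in distr M N \<phi>. \<omega> \<in> Y'"
    using AE_distr_iff[OF \<phi>_M, of "\<lambda>\<omega>. \<omega> \<in> Y'"] Y'_eq Y'_sets by simp
  then have "AE \<omega> in N. \<omega> \<in> Y'" by (simp only: distr_\<phi>)
  then have "AE \<omega> in N. \<omega> \<notin> space N - Y'" by eventually_elim simp
  then have Y'_null: "space N - Y' \<in> null_sets N"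
    using Y'_sets AE_iff_null_sets[of "space N - Y'" N] by blast
  have "Y' \<subseteq> Y"
  proof
    fix \<omega> assume \<omega>: "\<omega> \<in> Y'"
    then have "\<Psi> \<omega> \<in> X" using Z(4) by (auto simp: Y'_def)
    moreover have "\<phi> (\<Psi> \<omega>) = \<omega>" using \<omega> by (simp add: Y'_def)
    ultimately show "\<omega> \<in> Y" unfolding Y_def by (metis imageI)
  qed
  have Y_sub: "Y \<subseteq> space N" using X_sub measurable_space[OF \<phi>_M] by (auto simp: Y_def)
  have Y_null: "space N - Y \<in> null_sets (completion N)"
    using Y'_null \<open>Y' \<subseteq> Y\<close> null_sets_completion_iff2 by blast
  have Y_sets: "Y \<in> sets (completion N)"
  proof -
    have "Y = space (completion N) - (space N - Y)" using Y_sub by auto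
    then show ?thesis using Y_null by (metis null_setsD2 sets.compl_sets)
  qed
  have \<Psi>\<phi>: "\<Psi> (\<phi> x) = x" if "x \<in> X" for x
    using that by (auto simp: X_def dest: spec[of _ 0])
  have bij: "bij_betw \<phi> X Y"
    unfolding Y_def by (intro inj_on_imp_bij_betw inj_on_inverseI[of _ \<Psi>] \<Psi>\<phi>)
  have inv: "inv_into X \<phi> \<omega> = \<Psi> \<omega>" if \<omega>: "\<omega> \<in> Y" for \<omega>
  proof -
    obtain x where x: "x \<in> X" "\<omega> = \<phi> x" using \<omega> by (auto simp: Y_def)
    then show ?thesis using bij by (simp add: bij_betw_def inv_into_f_f \<Psi>\<phi>)
  qed
  have \<phi>_c: "\<phi> \<in> M \<rightarrow>\<^sub>M completion N"
    using \<phi>_M by (rule M.measurable_completion2) (simp add: distr_\<phi>)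
  have distr_c: "distr M (completion N) \<phi> = completion N"
    using M.completion_distr_eq[OF \<phi>_M] by (simp add: distr_\<phi>)
  have \<Psi>_M: "\<Psi> \<in> completion N \<rightarrow>\<^sub>M M"
  proof (rule measurableI)
    fix \<omega> assume "\<omega> \<in> space (completion N)"
    then show "\<Psi> \<omega> \<in> space M" using measurable_space[OF \<Psi>] M0 by simp
  next
    fix E assume "E \<in> sets M"
    from sandwich[OF this]
    obtain E1 E2 where E: "E1 \<in> sets M0" "E2 \<in> sets M0" "E1 \<subseteq> E" "E \<subseteq> E2" "E2 - E1 \<in> null_sets M"
      by (elim bexE conjE) (rule that)
    define D where "D = \<Psi> -` (E2 - E1) \<inter> space N"
    have D: "D \<in> sets N" unfolding D_def using \<Psi> E by (intro measurable_sets) auto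
    have "AE x in M. \<phi> x \<notin> D"
      using AE_X AE_not_in[OF E(5)] by eventually_elim (auto simp: D_def \<Psi>\<phi>)
    then have "AE \<omega> in distr M N \<phi>. \<omega> \<notin> D"
      using AE_distr_iff[OF \<phi>_M, of "\<lambda>\<omega>. \<omega> \<notin> D"] sets.compl_sets[OF D] by (simp add: set_diff_eq)
    then have "AE \<omega> in N. \<omega> \<notin> D" by (simp only: distr_\<phi>)
    then have "D \<in> null_sets N" using D AE_iff_null_sets[of D N] by blast
    moreover have "\<Psi> -` E1 \<inter> space N \<in> sets N" using \<Psi> E by (intro measurable_sets)
    moreover have "\<Psi> -` E \<inter> space N = (\<Psi> -` E1 \<inter> space N) \<union> (\<Psi> -` (E - E1) \<inter> space N)"
      using E by auto
    moreover have "\<Psi> -` (E - E1) \<inter> space N \<subseteq> D" using E by (auto simp: D_def)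
    ultimately show "\<Psi> -` E \<inter> space (completion N) \<in> sets (completion N)"
      by (metis sets_completionI space_completion)
  qed
  show ?thesis
    unfolding mp_isomorphic_def
  proof (intro exI conjI ballI)
    show "X \<in> sets M" "space M - X \<in> null_sets M" "Y \<in> sets (completion N)" "bij_betw \<phi> X Y"
      using X_sets X_null Y_sets bij by auto
    show "space (completion N) - Y \<in> null_sets (completion N)" using Y_null by simp
    show fX: "f ` X \<subseteq> X"
    proof safe
      fix x assume x: "x \<in> X"
      then have "f x \<in> space M" using measurable_space[OF f(1)] X_sub by blast
      moreover have "\<Psi> (\<phi> ((f ^^ n) (f x))) = (f ^^ n) (f x)" for n
        using x by (auto simp: X_def funpow_swap1 dest: spec[of _ "Suc n"])
      ultimately show "f x \<in> X" by (simp add: X_def)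
    qed
    show "g ` Y \<subseteq> Y"
      using fX conj X_sub by (force simp: Y_def simp flip: conj)
    show "\<phi> (f x) = g (\<phi> x)" if "x \<in> X" for x using that X_sub conj by blast
    show meas: "\<phi> \<in> restrict_space M X \<rightarrow>\<^sub>M restrict_space (completion N) Y"
      using \<phi>_c by (rule measurable_restrict_space3) (auto simp: Y_def)
    have "\<Psi> \<in> restrict_space (completion N) Y \<rightarrow>\<^sub>M restrict_space M X"
      using \<Psi>_M by (rule measurable_restrict_space3) (auto simp: Y_def \<Psi>\<phi>)
    then show "inv_into X \<phi> \<in> restrict_space (completion N) Y \<rightarrow>\<^sub>M restrict_space M X"
      by (subst measurable_cong[where g = \<Psi>]) (auto simp: space_restrict_space inv)
    show "distr (restrict_space M X) (restrict_space (completion N) Y) \<phi> = restrict_space (completion N) Y"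
    proof (rule measure_eqI)
      fix A assume "A \<in> sets (distr (restrict_space M X) (restrict_space (completion N) Y) \<phi>)"
      then have A': "A \<in> sets (restrict_space (completion N) Y)" by simp
      have YI: "Y \<inter> space (completion N) \<in> sets (completion N)" and XI: "X \<inter> space M \<in> sets M"
        using Y_sets X_sets by auto
      have A: "A \<in> sets (completion N)" "A \<subseteq> Y"
        using A' sets_restrict_space_iff[OF YI] by auto
      have pre: "\<phi> -` A \<inter> space (restrict_space M X) = \<phi> -` A \<inter> X"
        using X_sub by (auto simp: space_restrict_space)
      have "emeasure (distr (restrict_space M X) (restrict_space (completion N) Y) \<phi>) A = emeasure (restrict_space M X) (\<phi> -` A \<inter> X)"
        using emeasure_distr[OF meas A'] by (simp add: pre)
      also have "\<dots> = emeasure M (\<phi> -` A \<inter> X)"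
        by (rule emeasure_restrict_space[OF XI]) auto
      also have "\<dots> = emeasure M (\<phi> -` A \<inter> space M)"
      proof (rule emeasure_eq_AE)
        show "AE x in M. x \<in> \<phi> -` A \<inter> X \<longleftrightarrow> x \<in> \<phi> -` A \<inter> space M"
          using AE_X by eventually_elim (use X_sub in auto)
        have "\<phi> -` A \<inter> space M \<in> sets M" using measurable_sets[OF \<phi>_c A(1)] .
        moreover have "\<phi> -` A \<inter> X = (\<phi> -` A \<inter> space M) \<inter> X" using X_sub by auto
        ultimately show "\<phi> -` A \<inter> X \<in> sets M" "\<phi> -` A \<inter> space M \<in> sets M"
          using X_sets by auto
      qed
      also have "\<dots> = emeasure (completion N) A"
        using emeasure_distr[OF \<phi>_c A(1)] by (simp add: distr_c)
      also have "\<dots> = emeasure (restrict_space (completion N) Y) A"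
        using emeasure_restrict_space[OF YI A(2)] by simp
      finally show "emeasure (distr (restrict_space M X) (restrict_space (completion N) Y) \<phi>) A
        = emeasure (restrict_space (completion N) Y) A" .
    qed simp
  qed
qed

section \<open>Expanding lattice maps and labelled inverse branches\<close>

locale lattice_expansion =
  fixes a B :: "real ^ 'n::finite \<Rightarrow> real ^ 'n" and N :: "real ^ 'n \<Rightarrow> real" and \<theta> C :: real
  assumes lin_a: "linear a" and lin_B: "linear B"
    and aB [simp]: "a (B x) = x" and Ba [simp]: "B (a x) = x"
    and a_lattice [intro]: "x \<in> int_lattice \<Longrightarrow> a x \<in> int_lattice"
    and \<theta>: "0 < \<theta>" "\<theta> < 1"
    and norm_le_N: "norm x \<le> N x" and N_le_norm: "N x \<le> C * norm x"
    and N_triangle: "N (x + y) \<le> N x + N y" and N_minus [simp]: "N (- x) = N x"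
    and N_B: "N (B x) \<le> \<theta> * N x"
begin

lemmas a_add = linear_add[OF lin_a] and a_diff = linear_diff[OF lin_a] and a_0 = linear_0[OF lin_a]
  and B_add = linear_add[OF lin_B] and B_diff = linear_diff[OF lin_B] and B_0 = linear_0[OF lin_B]

lemma N_nonneg: "0 \<le> N x"
  using norm_ge_zero norm_le_N by (rule order_trans)

lemma N_funpow_B: "N ((B ^^ k) x) \<le> \<theta> ^ k * N x"
proof (induction k)
  case (Suc k)
  have "N ((B ^^ Suc k) x) \<le> \<theta> * N ((B ^^ k) x)" using N_B by simp
  also have "\<dots> \<le> \<theta> * (\<theta> ^ k * N x)" using Suc \<theta> by simp
  finally show ?case by (simp add: mult_ac)
qed simp

lemma funpow_a_lattice: "e \<in> int_lattice \<Longrightarrow> (a ^^ j) e \<in> int_lattice"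
  by (induction j) auto

lemma funpow_a_add: "(a ^^ j) (x + y) = (a ^^ j) x + (a ^^ j) y"
  by (induction j) (auto simp: a_add)

lemma funpow_a_diff: "(a ^^ j) (x - y) = (a ^^ j) x - (a ^^ j) y"
  by (induction j) (auto simp: a_diff)

lemma funpow_a_B: "(a ^^ j) ((B ^^ j) x) = x"
  by (induction j arbitrary: x) (auto simp: funpow_swap1[of a] simp flip: funpow_swap1)

lemma funpow_B_a: "(B ^^ j) ((a ^^ j) x) = x"
  by (induction j arbitrary: x) (auto simp: funpow_swap1[of B] simp flip: funpow_swap1)

end

definition grid_cell :: "nat \<Rightarrow> real \<Rightarrow> real ^ 'n \<Rightarrow> int ^ 'n" where
  "grid_cell m s x = (\<chi> i. \<lfloor>real m * (x $ i - s)\<rfloor>)"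

text \<open>The data of the labelling: \<open>H\<close> chooses the near-minimal lift \<open>y + H y\<close> of the torus point \<open>y\<close>, in
  a way that depends only on the grid cell of \<open>y\<close>; \<open>d\<close> lists representatives of the lattice modulo
  its image under \<open>a\<close> (the difference of \<open>e\<close> and \<open>d i\<close> lies in that image iff \<open>B\<close> maps it into the
  lattice); \<open>z\<close> is the digit \<open>0\<close>. The grid avoids all points that \<open>a\<close> eventually maps into the
  lattice. The bound on \<open>\<epsilon>\<close> leaves room for the geometric series in the lemma on the synchronising
  word.\<close>
locale lattice_coding = lattice_expansion a B N \<theta> C
  for a B :: "real ^ 'n::finite \<Rightarrow> real ^ 'n" and N \<theta> C +
  fixes H :: "real ^ 'n \<Rightarrow> real ^ 'n" and \<epsilon> :: real and m :: nat and s :: real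
    and d :: "nat \<Rightarrow> real ^ 'n" and r z :: nat
  assumes H_lattice [simp, intro]: "H x \<in> int_lattice"
    and H_shift: "e \<in> int_lattice \<Longrightarrow> H (x + e) = H x - e"
    and H_near_min: "e \<in> int_lattice \<Longrightarrow> N (x + H x) \<le> N (x + e) + \<epsilon>"
    and \<epsilon>: "0 < \<epsilon>" "5 * \<epsilon> < 1 - \<theta>"
    and H_cell: "grid_cell m s x = grid_cell m s y \<Longrightarrow> H x = H y"
    and m_pos: "0 < m"
    and generic: "(a ^^ j) p \<in> int_lattice \<Longrightarrow> real m * (p $ k - s) \<notin> \<int>"
    and digit_lattice [intro]: "i \<in> {1..r} \<Longrightarrow> d i \<in> int_lattice"
    and digits: "e \<in> int_lattice \<Longrightarrow> \<exists>!i. i \<in> {1..r} \<and> B (e - d i) \<in> int_lattice"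
    and z_digit [intro]: "z \<in> {1..r}" and d_z [simp]: "d z = 0"
begin

definition lift :: "real ^ 'n \<Rightarrow> real ^ 'n" where
  "lift y = y + H y"

text \<open>Torus points are represented by arbitrary real vectors; \<open>branch i\<close> is periodic, but its value is a
  definite vector, so that composites of branches can be compared in \<open>\<real>\<^sup>n\<close>.\<close>
definition branch :: "nat \<Rightarrow> real ^ 'n \<Rightarrow> real ^ 'n" where
  "branch i y = B (lift y + d i)"

text \<open>The index of the branch through \<open>x\<close>: the difference of \<open>x\<close> and \<open>branch i (a x)\<close> is
  \<open>B (- H (a x) - d i)\<close>.\<close>
definition label :: "real ^ 'n \<Rightarrow> nat" where
  "label x = (THE i. i \<in> {1..r} \<and> B (- H (a x) - d i) \<in> int_lattice)"

lemma label_in: "label x \<in> {1..r}" and label_lattice: "B (- H (a x) - d (label x)) \<in> int_lattice"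
  using theI'[OF digits[of "- H (a x)"]] unfolding label_def by auto

lemma label_eqI: "i \<in> {1..r} \<Longrightarrow> B (- H (a x) - d i) \<in> int_lattice \<Longrightarrow> label x = i"
  unfolding label_def by (rule the1_equality[OF digits]) auto

lemma label_shift:
  assumes "e \<in> int_lattice"
  shows "label (x + e) = label x"
proof (rule label_eqI[OF label_in])
  have "B (- H (a (x + e)) - d (label x)) = B (- H (a x) - d (label x)) + e"
    using assms by (simp add: a_add H_shift a_lattice B_add B_diff linear_neg[OF lin_B])
  then show "B (- H (a (x + e)) - d (label x)) \<in> int_lattice"
    using label_lattice assms by auto
qed

lemma branch_shift: "e \<in> int_lattice \<Longrightarrow> branch i (y + e) = branch i y"
  by (simp add: branch_def lift_def H_shift)

lemma a_branch: "a (branch i y) = y + (H y + d i)"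
  by (simp add: branch_def lift_def)

lemma label_branch:
  assumes i: "i \<in> {1..r}"
  shows "label (branch i y) = i"
proof -
  have "H (a (branch i y)) = - d i"
    using i by (simp add: a_branch H_shift int_lattice_add digit_lattice)
  then show ?thesis using i by (intro label_eqI) (auto simp: B_0)
qed

lemma branch_label: "x - branch (label x) (a x) \<in> int_lattice"
  using label_lattice[of x]
  by (simp add: branch_def lift_def B_add B_diff linear_neg[OF lin_B] algebra_simps)

lemma itinerary_shift: "e \<in> int_lattice \<Longrightarrow> itinerary a label (x + e) = itinerary a label x"
  by (auto simp: itinerary_def fun_eq_iff funpow_a_add label_shift funpow_a_lattice)

lemma itinerary_cong: "x - y \<in> int_lattice \<Longrightarrow> itinerary a label x = itinerary a label y"
  using itinerary_shift[of "x - y" y] by simp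

lemma branches_itinerary:
  "x - foldr branch (prefix_word n (itinerary a label x)) ((a ^^ n) x) \<in> int_lattice"
proof (induction n arbitrary: x)
  case (Suc n)
  let ?q = "foldr branch (prefix_word n (itinerary a label (a x))) ((a ^^ n) (a x))"
  have "branch (label x) (?q + (a x - ?q)) = branch (label x) ?q"
    by (intro branch_shift Suc)
  then show ?case
    using branch_label[of x] by (simp add: prefix_word_Suc itinerary_apply funpow_swap1)
qed simp

lemma funpow_a_branches:
  assumes "set w \<subseteq> {1..r}"
  shows "(a ^^ length w) (foldr branch w y) - y \<in> int_lattice"
  using assms
proof (induction w)
  case (Cons i w)
  let ?q = "foldr branch w y"
  have "(a ^^ length (i # w)) (branch i ?q) - y
      = ((a ^^ length w) ?q - y) + (a ^^ length w) (H ?q + d i)"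
    by (simp only: length_Cons funpow_Suc_right comp_apply a_branch funpow_a_add) simp
  moreover have "(a ^^ length w) (H ?q + d i) \<in> int_lattice"
    using Cons.prems by (intro funpow_a_lattice int_lattice_add) auto
  moreover have "(a ^^ length w) ?q - y \<in> int_lattice" using Cons by simp
  ultimately show ?case by (metis int_lattice_add foldr.simps(2) comp_apply)
qed simp

lemma prefix_word_itinerary_branches:
  assumes "set w \<subseteq> {1..r}"
  shows "prefix_word (length w) (itinerary a label (foldr branch w y)) = w"
  using assms
proof (induction w)
  case (Cons i w)
  let ?q = "foldr branch w y"
  have "itinerary a label (a (branch i ?q)) = itinerary a label ?q"
    unfolding a_branch using Cons.prems by (intro itinerary_shift int_lattice_add) auto
  with Cons show ?case by (simp add: prefix_word_Suc label_branch flip: itinerary_apply)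
qed simp

text \<open>A near-minimal lift of a vector close to \<open>0\<close> differs from it by a lattice vector of norm less than
  \<open>1\<close>.\<close>
lemma lift_small:
  assumes "N y \<le> 2 * \<epsilon> / (1 - \<theta>)"
  shows "lift y = y"
proof -
  have "N (H y) \<le> N (y + H y) + N (- y)" using N_triangle[of "y + H y" "- y"] by simp
  also have "N (y + H y) \<le> N y + \<epsilon>" using H_near_min[of 0 y] by simp
  finally have "N (H y) \<le> 2 * N y + \<epsilon>" by simp
  moreover have "\<epsilon> / (1 - \<theta>) < 1 / 5" using \<epsilon> \<theta> by (simp add: divide_less_eq)
  moreover have "N y \<le> 2 * (\<epsilon> / (1 - \<theta>))" using assms by simp
  ultimately have "N (H y) < 1" using \<epsilon> \<theta> by linarith
  then have "H y = 0" by (intro int_lattice_norm_less_1) (use norm_le_N[of "H y"] in auto)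
  then show ?thesis by (simp add: lift_def)
qed

lemma branch_z: "branch z y = B (lift y)"
  by (simp add: branch_def)

text \<open>With \<open>t = N (lift y)\<close>, one application of \<open>branch z\<close> replaces \<open>t\<close> by at most \<open>\<theta> t + \<epsilon>\<close>, so all
  points enter the ball of radius \<open>2 \<epsilon> / (1 - \<theta>)\<close> within a uniform time. There the lift is the
  identity, the error \<open>\<epsilon>\<close> disappears and \<open>branch z\<close> is the contraction \<open>B\<close>.\<close>
lemma synchronising_word:
  assumes "\<delta> > 0"
  obtains K where "\<And>y. N ((branch z ^^ K) y) \<le> \<delta>"
proof -
  define R where "R = C * CARD('n) + \<epsilon>"
  have C0: "C \<ge> 0"
    using N_le_norm[of "axis undefined 1"] N_nonneg[of "axis undefined 1"] by simp
  have lift_bounded: "N (lift y) \<le> R" for y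
  proof -
    have "N (lift y) \<le> N (y - vec_floor y) + \<epsilon>"
      using H_near_min[of "- vec_floor y" y] by (simp add: lift_def)
    also have "N (y - vec_floor y) \<le> C * norm (y - vec_floor y)" by (rule N_le_norm)
    also have "\<dots> \<le> C * CARD('n)"
      using C0 norm_unit_cube[OF vec_floor_unit_cube] by (intro mult_left_mono)
    finally show ?thesis by (simp add: R_def)
  qed
  have lift_decr: "N (lift ((branch z ^^ k) y)) \<le> \<theta> ^ k * R + \<epsilon> / (1 - \<theta>)" for k y
  proof (induction k)
    case 0
    have "0 \<le> \<epsilon> / (1 - \<theta>)" using \<epsilon> \<theta> by simp
    then show ?case using lift_bounded[of y] by simp
  next
    case (Suc k)
    let ?y = "(branch z ^^ k) y"
    have "N (lift (branch z ?y)) \<le> N (branch z ?y) + \<epsilon>"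
      using H_near_min[of 0 "branch z ?y"] by (simp add: lift_def)
    also have "N (branch z ?y) \<le> \<theta> * N (lift ?y)" unfolding branch_z by (rule N_B)
    also have "\<dots> \<le> \<theta> * (\<theta> ^ k * R + \<epsilon> / (1 - \<theta>))" using Suc \<theta> by (intro mult_left_mono) auto
    also have "\<dots> + \<epsilon> = \<theta> ^ Suc k * R + \<epsilon> / (1 - \<theta>)" using \<theta> by (simp add: field_simps)
    finally show ?case by simp
  qed
  have R0: "R > 0" using C0 \<epsilon> by (simp add: R_def add_nonneg_pos)
  obtain k0 where k0: "\<theta> ^ k0 < \<epsilon> / (1 - \<theta>) / R"
    using real_arch_pow_inv[of "\<epsilon> / (1 - \<theta>) / R" \<theta>] \<epsilon> \<theta> R0 by auto
  have small: "N ((branch z ^^ Suc k) y) \<le> 2 * \<epsilon> / (1 - \<theta>)" if "k \<ge> k0" for k y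
  proof -
    have "N ((branch z ^^ Suc k) y) \<le> \<theta> * N (lift ((branch z ^^ k) y))"
      by (simp add: branch_z N_B)
    also have "\<dots> \<le> 1 * N (lift ((branch z ^^ k) y))" using \<theta> N_nonneg by (intro mult_right_mono) auto
    also have "\<dots> \<le> \<theta> ^ k * R + \<epsilon> / (1 - \<theta>)" using lift_decr by simp
    also have "\<theta> ^ k * R \<le> \<theta> ^ k0 * R" using that \<theta> R0 by (intro mult_right_mono power_decreasing) auto
    also have "\<theta> ^ k0 * R \<le> \<epsilon> / (1 - \<theta>)"
      using k0 R0 unfolding pos_less_divide_eq[OF R0] by (rule_tac less_imp_le)
    finally show ?thesis by simp
  qed
  have contract: "N ((branch z ^^ (j + Suc k0)) y) \<le> \<theta> ^ j * (2 * \<epsilon> / (1 - \<theta>))" for j y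
  proof (induction j)
    case 0
    then show ?case using small[of k0 y] by simp
  next
    case (Suc j)
    let ?y = "(branch z ^^ (j + Suc k0)) y"
    have "lift ?y = ?y" using small[of "j + k0" y] by (intro lift_small) simp
    then have "N ((branch z ^^ (Suc j + Suc k0)) y) \<le> \<theta> * N ?y"
      using N_B[of ?y] by (simp add: branch_z)
    also have "\<dots> \<le> \<theta> * (\<theta> ^ j * (2 * \<epsilon> / (1 - \<theta>)))" using Suc \<theta> by (intro mult_left_mono) auto
    finally show ?case by simp
  qed
  have e: "2 * \<epsilon> / (1 - \<theta>) > 0" using \<epsilon> \<theta> by simp
  obtain j where j: "\<theta> ^ j < \<delta> / (2 * \<epsilon> / (1 - \<theta>))"
    using real_arch_pow_inv[OF divide_pos_pos[OF assms e]] \<theta> by auto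
  have "\<theta> ^ j * (2 * \<epsilon> / (1 - \<theta>)) \<le> \<delta>" using j e by (simp only: pos_less_divide_eq less_imp_le)
  then show thesis using that[of "j + Suc k0"] order_trans[OF contract[of j]] by blast
qed

text \<open>Words act from the right: the last letter is applied first. If the letters of \<open>w\<close> have carried the
  \<open>\<delta>\<close>-ball about \<open>0\<close> to a ball of radius \<open>\<theta>\<^sup>j \<delta>\<close>, then \<open>w\<close> splits if the grid cuts that ball, which
  makes the next branch discontinuous there.\<close>
definition splits :: "real \<Rightarrow> nat list \<Rightarrow> bool" where
  "splits \<delta> w \<longleftrightarrow> (\<exists>u. N u \<le> \<theta> ^ length w * \<delta> \<and>
     grid_cell m s (foldr branch w 0 + u) \<noteq> grid_cell m s (foldr branch w 0))"

fun unsplit :: "real \<Rightarrow> nat list \<Rightarrow> bool" where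
  "unsplit \<delta> [] \<longleftrightarrow> True"
| "unsplit \<delta> (i # w) \<longleftrightarrow> unsplit \<delta> w \<and> \<not> splits \<delta> w"

lemma branches_unsplit:
  assumes "unsplit \<delta> w" "N v \<le> \<delta>"
  shows "foldr branch w v = foldr branch w 0 + (B ^^ length w) v"
  using assms
proof (induction w)
  case (Cons i w)
  let ?p = "foldr branch w 0" and ?u = "(B ^^ length w) v"
  have "N ?u \<le> \<theta> ^ length w * \<delta>"
    using \<theta> by (intro order_trans[OF N_funpow_B mult_left_mono[OF Cons.prems(2)]]) simp
  then have "H (?p + ?u) = H ?p"
    using Cons.prems by (intro H_cell) (auto simp: splits_def)
  then have "branch i (?p + ?u) = branch i ?p + B ?u"
    by (simp add: branch_def lift_def B_add)
  then show ?case using Cons by simp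
qed simp

text \<open>Two points in different cells have a grid hyperplane between them.\<close>
lemma splits_near_grid:
  assumes "splits \<delta> w" "\<delta> \<le> 1"
  obtains i k where "\<bar>real m * (foldr branch w 0 $ i - s) - of_int k\<bar> \<le> real m * \<theta> ^ length w"
proof -
  let ?p = "foldr branch w 0"
  obtain u where u: "N u \<le> \<theta> ^ length w * \<delta>" "grid_cell m s (?p + u) \<noteq> grid_cell m s ?p"
    using assms unfolding splits_def by blast
  then obtain i where i: "\<lfloor>real m * ((?p + u) $ i - s)\<rfloor> \<noteq> \<lfloor>real m * (?p $ i - s)\<rfloor>"
    unfolding grid_cell_def by (auto simp: vec_eq_iff)
  have "\<theta> ^ length w * \<delta> \<le> \<theta> ^ length w" using mult_left_mono[OF assms(2), of "\<theta> ^ length w"] \<theta> by simp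
  then have "\<bar>u $ i\<bar> \<le> \<theta> ^ length w"
    using component_le_norm_cart[of u i] norm_le_N[of u] u(1) by linarith
  then have "\<bar>real m * u $ i\<bar> \<le> real m * \<theta> ^ length w"
    by (simp add: abs_mult mult_left_mono)
  moreover define X Y where "X = real m * (?p $ i - s)" "Y = real m * u $ i"
  moreover have "real m * ((?p + u) $ i - s) = X + Y" by (simp add: X_Y_def algebra_simps)
  ultimately have "\<lfloor>X + Y\<rfloor> \<noteq> \<lfloor>X\<rfloor>" "\<bar>Y\<bar> \<le> real m * \<theta> ^ length w" using i by auto
  then have "\<exists>k. \<bar>X - of_int k\<bar> \<le> real m * \<theta> ^ length w"
    by (intro exI[of _ "max \<lfloor>X + Y\<rfloor> \<lfloor>X\<rfloor>"]) linarith
  then show thesis using that X_Y_def(1) by blast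
qed

text \<open>The centre \<open>foldr branch w 0\<close> is eventually mapped into the lattice by \<open>a\<close>, hence is at positive
  distance from the grid.\<close>
lemma eventually_not_splits:
  assumes "set w \<subseteq> {1..r}"
  shows "\<exists>\<delta>>0. \<not> splits \<delta> w"
proof -
  let ?p = "foldr branch w 0"
  define g where "g i = min (frac (real m * (?p $ i - s))) (1 - frac (real m * (?p $ i - s)))" for i
  have "(a ^^ length w) ?p \<in> int_lattice" using funpow_a_branches[OF assms, of 0] by simp
  then have nint: "real m * (?p $ i - s) \<notin> \<int>" for i by (rule generic)
  have g: "g i > 0" for i
    using nint[of i] frac_lt_1[of "real m * (?p $ i - s)"] by (simp add: g_def frac_gt_0_iff)
  define \<delta> where "\<delta> = Min (range g) / (2 * real m)"
  have Mg: "Min (range g) > 0" "Min (range g) \<le> g i" for i using g by auto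
  have \<delta>: "\<delta> > 0" using Mg m_pos by (simp add: \<delta>_def)
  have "\<not> splits \<delta> w"
  proof
    assume "splits \<delta> w"
    then obtain u where u: "N u \<le> \<theta> ^ length w * \<delta>" "grid_cell m s (?p + u) \<noteq> grid_cell m s ?p"
      unfolding splits_def by blast
    then obtain i where i: "\<lfloor>real m * ((?p + u) $ i - s)\<rfloor> \<noteq> \<lfloor>real m * (?p $ i - s)\<rfloor>"
      unfolding grid_cell_def by (auto simp: vec_eq_iff)
    have "\<theta> ^ length w * \<delta> \<le> \<delta>" using \<theta> \<delta> by (simp add: mult_le_cancel_right1 power_le_one)
    then have "\<bar>u $ i\<bar> \<le> \<delta>"
      using component_le_norm_cart[of u i] norm_le_N[of u] u(1) by linarith
    then have "\<bar>real m * u $ i\<bar> \<le> real m * \<delta>" by (simp add: abs_mult mult_left_mono)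
    also have "\<dots> = Min (range g) / 2" using m_pos by (simp add: \<delta>_def)
    also have "\<dots> < g i" using Mg(2)[of i] Mg(1) by linarith
    finally have "\<bar>real m * u $ i\<bar> < g i" .
    moreover have "real m * ((?p + u) $ i - s) = real m * (?p $ i - s) + real m * u $ i"
      by (simp add: algebra_simps)
    ultimately show False using i unfolding g_def frac_def by linarith
  qed
  with \<delta> show ?thesis by blast
qed

lemma splits_mono: "splits \<delta> w \<Longrightarrow> \<delta> \<le> \<delta>' \<Longrightarrow> splits \<delta>' w"
  unfolding splits_def using \<theta> by (meson mult_left_mono order_trans zero_le_power less_imp_le)

lemma short_words_not_split:
  obtains \<delta> where "0 < \<delta>" "\<delta> \<le> 1" "\<And>w. set w \<subseteq> {1..r} \<Longrightarrow> length w < J \<Longrightarrow> \<not> splits \<delta> w"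
proof -
  define W where "W = {w. set w \<subseteq> {1..r} \<and> length w \<le> J}"
  have "finite W" unfolding W_def by (rule finite_lists_length_le) simp
  obtain D where D: "\<And>w. w \<in> W \<Longrightarrow> D w > 0 \<and> \<not> splits (D w) w"
    using eventually_not_splits by (metis (mono_tags, lifting) W_def mem_Collect_eq)
  define \<delta> where "\<delta> = Min (insert 1 (D ` W))"
  have "0 < \<delta>" "\<delta> \<le> 1" "\<And>w. w \<in> W \<Longrightarrow> \<delta> \<le> D w"
    using \<open>finite W\<close> D by (auto simp: \<delta>_def)
  then show thesis
    using that[of \<delta>] D splits_mono unfolding W_def by (metis (mono_tags, lifting) mem_Collect_eq less_imp_le)
qed

text \<open>Union bound over the suffix at which the ball is first cut.\<close>
lemma card_split_words:
  assumes "\<And>j. real (card {w. set w \<subseteq> {1..r} \<and> length w = j \<and> splits \<delta> w}) \<le> \<beta> j * real r ^ j"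
  shows "real (card {w. set w \<subseteq> {1..r} \<and> length w = n \<and> \<not> unsplit \<delta> w}) \<le> (\<Sum>j<n. \<beta> j) * real r ^ n"
proof (induction n)
  case 0
  have "{w. set w \<subseteq> {1..r} \<and> length w = 0 \<and> \<not> unsplit \<delta> w} = {}" by auto
  then show ?case by simp
next
  case (Suc n)
  let ?S = "{w. set w \<subseteq> {1..r} \<and> length w = n \<and> splits \<delta> w}"
  let ?U = "{w. set w \<subseteq> {1..r} \<and> length w = n \<and> \<not> unsplit \<delta> w}"
  have fin: "finite {w. set w \<subseteq> {1..r} \<and> length w = n}"
    by (rule finite_lists_length_eq) simp
  then have fin: "finite ?S" "finite ?U" by (auto elim!: rev_finite_subset)
  have "{w. set w \<subseteq> {1..r} \<and> length w = Suc n \<and> \<not> unsplit \<delta> w}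
      \<subseteq> (\<lambda>(i, w). i # w) ` ({1..r} \<times> (?S \<union> ?U))"
    by (auto simp: length_Suc_conv image_iff)
  then have "card {w. set w \<subseteq> {1..r} \<and> length w = Suc n \<and> \<not> unsplit \<delta> w}
      \<le> card ({1..r} \<times> (?S \<union> ?U))"
    using fin by (intro surj_card_le) auto
  also have "\<dots> \<le> r * (card ?S + card ?U)"
    by (simp add: card_cartesian_product card_Un_le)
  finally have "real (card {w. set w \<subseteq> {1..r} \<and> length w = Suc n \<and> \<not> unsplit \<delta> w})
      \<le> real (r * (card ?S + card ?U))" by (rule of_nat_mono)
  also have "\<dots> = real r * (real (card ?S) + real (card ?U))" by simp
  also have "\<dots> \<le> real r * (\<beta> n * real r ^ n + (\<Sum>j<n. \<beta> j) * real r ^ n)"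
    using assms[of n] Suc by (intro mult_left_mono add_mono) auto
  finally show ?case by (simp add: algebra_simps)
qed

end

section \<open>Volumes of branches and the rarity of split words\<close>

lemma grid_cell_sets: "{y :: real ^ 'n::finite. grid_cell m s y \<in> S} \<in> sets borel"
proof -
  have 1: "{y :: real ^ 'n. grid_cell m s y = c} \<in> sets borel" for c
  proof -
    have "{y :: real ^ 'n. grid_cell m s y = c} = {y. \<forall>i\<in>UNIV. \<lfloor>real m * (y $ i - s)\<rfloor> = c $ i}"
      by (auto simp: grid_cell_def vec_eq_iff)
    also have "\<dots> \<in> sets borel" by measurable
    finally show ?thesis .
  qed
  have "{y :: real ^ 'n. grid_cell m s y \<in> S} = (\<Union>c\<in>S. {y. grid_cell m s y = c})" by auto
  also have "\<dots> \<in> sets borel" using 1 by (intro sets.countable_UN') auto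
  finally show ?thesis .
qed

context lattice_coding
begin

lemma H_sets: "{y. P (H y)} \<in> sets borel"
proof -
  have "{y. P (H y)} = {y. grid_cell m s y \<in> grid_cell m s ` {y. P (H y)}}"
  proof (intro set_eqI iffI)
    fix y assume "y \<in> {y. grid_cell m s y \<in> grid_cell m s ` {y. P (H y)}}"
    then obtain y' where "P (H y')" "grid_cell m s y = grid_cell m s y'" by auto
    then show "y \<in> {y. P (H y)}" using H_cell[of y y'] by simp
  qed simp
  also have "\<dots> \<in> sets borel" by (rule grid_cell_sets)
  finally show ?thesis .
qed

lemma a_borel [measurable]: "a \<in> borel_measurable borel"
  using lin_a by (intro borel_measurable_continuous_onI linear_continuous_on linear_conv_bounded_linear[THEN iffD1])

lemma label_sets: "{x. label x \<in> S} \<in> sets borel"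
proof -
  have "{x. label x \<in> S} = a -` {y. (THE i. i \<in> {1..r} \<and> B (- H y - d i) \<in> int_lattice) \<in> S} \<inter> space borel"
    by (auto simp: label_def)
  also have "\<dots> \<in> sets borel" by (intro measurable_sets[OF a_borel] H_sets)
  finally show ?thesis .
qed

lemma a_vimage_sets:
  assumes "E \<in> sets lebesgue"
  shows "{x. a x \<in> E} \<in> sets lebesgue"
proof -
  have "{x. a x \<in> E} = B ` E" by (auto simp: image_iff) (metis Ba)
  also have "\<dots> \<in> sets lebesgue"
    using assms lin_B by (intro differentiable_image_in_sets_lebesgue linear_imp_differentiable_on) auto
  finally show ?thesis .
qed

definition volume_factor :: real where
  "volume_factor = measure lebesgue (B ` cbox 0 One)"

lemma measure_B_image:
  assumes "S \<in> lmeasurable"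
  shows "B ` S \<in> lmeasurable \<and> measure lebesgue (B ` S) = volume_factor * measure lebesgue S"
  using measure_linear_bijection[OF lin_a lin_B aB Ba assms] by (simp add: volume_factor_def)

text \<open>The proof replaces the unit cube by better adapted fundamental domains. The image \<open>F0\<close> of the lift
  is one, and so is the union \<open>F1\<close> of the sets \<open>B (F0 + d i)\<close>; inside \<open>F1\<close> the set in question is
  exactly the linear image of \<open>(E \<inter> F0) + d i\<close>.\<close>
lemma measure_branch:
  assumes E: "E \<in> sets lebesgue" "lattice_invariant E" and i: "i \<in> {1..r}"
  shows "measure lebesgue ({x. label x = i \<and> a x \<in> E} \<inter> unit_cube)
    = volume_factor * measure lebesgue (E \<inter> unit_cube)"
proof -
  define F0 where "F0 = {y. H y = 0}"
  have F0: "fundamental_domain F0"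
    unfolding fundamental_domain_def
  proof (intro conjI allI)
    show "F0 \<in> sets lebesgue" unfolding F0_def using H_sets by auto
    fix x
    show "\<exists>!e. e \<in> int_lattice \<and> x + e \<in> F0"
      by (rule ex1I[of _ "H x"]) (auto simp: F0_def H_shift)
  qed
  define F1 where "F1 = {x. \<exists>i\<in>{1..r}. a x - d i \<in> F0}"
  have F1_iff: "a x - d i \<in> F0 \<longleftrightarrow> H (a x) = - d i" if "i \<in> {1..r}" for x i
    using H_shift[of "- d i" "a x"] digit_lattice[OF that] by (auto simp: F0_def eq_neg_iff_add_eq_0)
  have F1: "fundamental_domain F1"
    unfolding fundamental_domain_def
  proof (intro conjI allI)
    have "F1 = (\<Union>i\<in>{1..r}. {x. a x \<in> (+) (d i) ` F0})"
    proof -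
      have img: "y \<in> (+) v ` F0 \<longleftrightarrow> y - v \<in> F0" for y v by force
      show ?thesis unfolding F1_def img by blast
    qed
    moreover have "F0 \<in> sets lebesgue" using F0 by (simp add: fundamental_domain_def)
    ultimately show "F1 \<in> sets lebesgue"
      by (simp only:) (intro sets.finite_UN a_vimage_sets lebesgue_sets_translation, simp_all)
    fix x
    define e0 where "e0 = B (H (a x) + d (label x))"
    have "e0 = - B (- H (a x) - d (label x))" by (simp add: e0_def B_add B_diff linear_neg[OF lin_B])
    then have e0: "e0 \<in> int_lattice" using label_lattice by simp
    have F1_e: "x + e \<in> F1 \<longleftrightarrow> (\<exists>i\<in>{1..r}. e = B (H (a x) + d i))" if "e \<in> int_lattice" for e
    proof -
      have "H (a (x + e)) = - d i \<longleftrightarrow> e = B (H (a x) + d i)" for i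
      proof -
        have "H (a (x + e)) = - d i \<longleftrightarrow> a e = H (a x) + d i"
          using that by (simp add: a_add H_shift a_lattice diff_eq_eq add.commute[of "a e"] eq_diff_eq[symmetric] minus_equation_iff) (auto simp: algebra_simps)
        also have "\<dots> \<longleftrightarrow> e = B (H (a x) + d i)" by (metis aB Ba)
        finally show ?thesis .
      qed
      then show ?thesis unfolding F1_def using F1_iff by auto
    qed
    show "\<exists>!e. e \<in> int_lattice \<and> x + e \<in> F1"
    proof (rule ex1I[of _ e0])
      show "e0 \<in> int_lattice \<and> x + e0 \<in> F1"
        using e0 F1_e[OF e0] label_in by (auto simp: e0_def)
      fix e assume e: "e \<in> int_lattice \<and> x + e \<in> F1"
      then obtain i where i: "i \<in> {1..r}" "e = B (H (a x) + d i)" using F1_e by blast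
      then have "- B (- H (a x) - d i) \<in> int_lattice" using e by (simp add: B_add B_diff linear_neg[OF lin_B] add.commute)
      then have "label x = i" using i by (intro label_eqI) auto
      then show "e = e0" using i by (simp add: e0_def)
    qed
  qed
  define Q where "Q = {x. label x = i \<and> a x \<in> E}"
  have Q: "Q \<in> sets lebesgue"
    unfolding Q_def Collect_conj_eq using label_sets[of "{i}"] by (intro sets.Int a_vimage_sets E) auto
  have "lattice_invariant Q"
    unfolding lattice_invariant_def Q_def
    using E(2) by (simp add: label_shift a_add lattice_invariant_def a_lattice)
  have "Q \<inter> F1 = B ` ((+) (d i) ` (E \<inter> F0))"
  proof (intro equalityI subsetI)
    fix x assume x: "x \<in> Q \<inter> F1"
    then obtain i' where i': "i' \<in> {1..r}" "a x - d i' \<in> F0" by (auto simp: F1_def)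
    then have "label x = i'" using F1_iff by (intro label_eqI) (auto simp: B_0)
    then have i': "a x - d i \<in> F0" using x i' by (simp add: Q_def)
    moreover have "a x + - d i \<in> E"
      using x i E(2) unfolding lattice_invariant_def Q_def by (metis (mono_tags, lifting) IntD1 digit_lattice int_lattice_minus_iff mem_Collect_eq)
    ultimately show "x \<in> B ` ((+) (d i) ` (E \<inter> F0))"
      by (intro image_eqI[of _ _ "a x"] image_eqI[of _ _ "a x - d i"]) auto
  next
    fix x assume "x \<in> B ` ((+) (d i) ` (E \<inter> F0))"
    then obtain y where y: "y \<in> E" "y \<in> F0" "x = B (d i + y)" by auto
    then have F: "a x - d i \<in> F0" by simp
    then have "label x = i" using F1_iff i by (intro label_eqI) (auto simp: B_0)
    moreover have "a x \<in> E"
      using y E(2) i unfolding lattice_invariant_def by (simp add: add.commute digit_lattice)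
    ultimately show "x \<in> Q \<inter> F1" using F i by (auto simp: Q_def F1_def)
  qed
  have "measure lebesgue (Q \<inter> unit_cube) = measure lebesgue (Q \<inter> F1)"
    unfolding measure_def
    using emeasure_fundamental_domains[OF Q \<open>lattice_invariant Q\<close> fundamental_domain_unit_cube F1] by simp
  also have "\<dots> = volume_factor * measure lebesgue ((+) (d i) ` (E \<inter> F0))"
    unfolding \<open>Q \<inter> F1 = _\<close>
  proof (rule measure_B_image[OF measurable_translation, THEN conjunct2])
    have "emeasure lebesgue (E \<inter> F0) = emeasure lebesgue (E \<inter> unit_cube)"
      by (rule emeasure_fundamental_domains[OF E F0 fundamental_domain_unit_cube])
    also have "\<dots> \<le> emeasure lebesgue (cbox 0 1 :: (real ^ 'n) set)"
      by (intro emeasure_mono) (auto simp: unit_cube_def mem_box_cart less_imp_le)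
    also have "\<dots> < \<infinity>" using emeasure_lborel_cbox_finite[of 0 1] by simp
    finally show "E \<inter> F0 \<in> lmeasurable"
      using E F0 by (intro fmeasurableI) (auto simp: fundamental_domain_def)
  qed
  also have "measure lebesgue ((+) (d i) ` (E \<inter> F0)) = measure lebesgue (E \<inter> unit_cube)"
    using emeasure_fundamental_domains[OF E F0 fundamental_domain_unit_cube]
    by (simp only: measure_translation) (simp add: measure_def)
  finally show ?thesis by (simp add: Q_def)
qed

lemma unit_cube_lmeasurable: "(unit_cube :: (real ^ 'n) set) \<in> lmeasurable"
  by (rule bounded_set_imp_lmeasurable[OF _ unit_cube_sets])
    (auto simp: bounded_iff intro: norm_unit_cube)

lemma measure_unit_cube: "measure lebesgue (unit_cube :: (real ^ 'n) set) = 1"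
proof -
  have "emeasure torus_lebesgue (UNIV :: 'n torus set) = 1"
    using prob_space.emeasure_space_1[OF prob_space_torus_lebesgue] by simp
  then show ?thesis
    by (simp add: emeasure_torus_lebesgue sets_torus_lebesgue measure_def)
qed

text \<open>The \<open>r\<close> label sets have equal volume and partition the torus.\<close>
lemma volume_factor_eq: "volume_factor = 1 / real r"
proof -
  have "unit_cube = (\<Union>i\<in>{1..r}. {x. label x = i \<and> a x \<in> UNIV} \<inter> (unit_cube :: (real ^ 'n) set))"
    using label_in by auto
  also have "measure lebesgue \<dots> = (\<Sum>i\<in>{1..r}. measure lebesgue ({x. label x = i \<and> a x \<in> UNIV} \<inter> (unit_cube :: (real ^ 'n) set)))"
  proof (rule measure_finite_Union)
    show "(\<lambda>i. {x. label x = i \<and> a x \<in> UNIV} \<inter> unit_cube) ` {1..r} \<subseteq> sets lebesgue"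
      using label_sets[of "{_}"] unit_cube_sets by (auto intro!: sets.Int)
    show "emeasure lebesgue ({x. label x = i \<and> a x \<in> UNIV} \<inter> (unit_cube :: (real ^ 'n) set)) \<noteq> \<infinity>" for i
    proof -
      have "emeasure lebesgue ({x. label x = i \<and> a x \<in> UNIV} \<inter> (unit_cube :: (real ^ 'n) set)) \<le> emeasure lebesgue (unit_cube :: (real ^ 'n) set)"
        by (intro emeasure_mono unit_cube_sets) auto
      then show ?thesis using unit_cube_lmeasurable by (auto simp: fmeasurable_def top_unique)
    qed
  qed (auto simp: disjoint_family_on_def)
  also have "\<dots> = (\<Sum>i\<in>{1..r}. volume_factor)"
    by (intro sum.cong refl) (subst measure_branch, auto simp: lattice_invariant_def measure_unit_cube)
  finally have "1 = real r * volume_factor" by (simp add: measure_unit_cube)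
  then show ?thesis by (metis nonzero_mult_div_cancel_left mult_eq_0_iff zero_neq_one)
qed

lemma measure_funpow_B:
  assumes "S \<in> lmeasurable"
  shows "(B ^^ j) ` S \<in> lmeasurable \<and> measure lebesgue ((B ^^ j) ` S) = measure lebesgue S / real r ^ j"
proof (induction j)
  case (Suc j)
  have "(B ^^ Suc j) ` S = B ` ((B ^^ j) ` S)" by auto
  then show ?case
    using Suc measure_B_image[of "(B ^^ j) ` S"] by (simp add: volume_factor_eq)
qed (use assms in simp)

text \<open>The points \<open>foldr branch w 0\<close> for the \<open>r\<^sup>j\<close> words \<open>w\<close> of length \<open>j\<close> form the lattice \<open>B\<^sup>j(\<int>\<^sup>n)\<close>
  modulo \<open>\<int>\<^sup>n\<close>. Around each of them sits a tile of volume \<open>r\<^sup>-\<^sup>j\<close> and diameter of order \<open>\<theta>\<^sup>j\<close>, and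
  the tiles at the points near the grid all lie in a slab neighbourhood of the grid.\<close>
lemma card_split_words_le:
  obtains K where "0 \<le> K" "\<And>\<delta> j. \<delta> \<le> 1 \<Longrightarrow>
    real (card {w. set w \<subseteq> {1..r} \<and> length w = j \<and> splits \<delta> w}) \<le> K * \<theta> ^ j * real r ^ j"
proof -
  define D where "D = C * CARD('n)"
  have C0: "C \<ge> 0"
    using N_le_norm[of "axis undefined 1"] N_nonneg[of "axis undefined 1"] by simp
  then have D0: "D \<ge> 0" by (simp add: D_def)
  have N_cube: "N u \<le> D" if "u \<in> unit_cube" for u
    using N_le_norm[of u] norm_unit_cube[OF that] C0 unfolding D_def by (meson mult_left_mono order_trans)
  have B_cube: "\<bar>(B ^^ j) u $ i\<bar> \<le> \<theta> ^ j * D" if "u \<in> unit_cube" for u i j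
  proof -
    have "\<bar>(B ^^ j) u $ i\<bar> \<le> N ((B ^^ j) u)" using component_le_norm_cart norm_le_N by (rule order_trans)
    also have "\<dots> \<le> \<theta> ^ j * N u" by (rule N_funpow_B)
    also have "\<dots> \<le> \<theta> ^ j * D" using N_cube[OF that] \<theta> by simp
    finally show ?thesis .
  qed
  define b where "b = 1 + D"
  define k0 where "k0 = \<lceil>real m * (b + \<bar>s\<bar>) + real m * (1 + D)\<rceil>"
  define Slab where "Slab i k \<rho> = {x \<in> cbox (\<chi> j. - b) (\<chi> j. b) :: (real ^ 'n) set. \<bar>x $ i - (s + of_int k / real m)\<bar> \<le> \<rho>}" for i k \<rho>
  have Slab: "Slab i k \<rho> \<in> lmeasurable" for i k \<rho>
  proof (rule bounded_set_imp_lmeasurable)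
    show "bounded (Slab i k \<rho>)" using bounded_cbox by (rule bounded_subset) (auto simp: Slab_def)
    have "closed ({x :: real ^ 'n. \<bar>x $ i - (s + of_int k / real m)\<bar> \<le> \<rho>})"
      by (intro closed_Collect_le continuous_intros)
    then have "closed (Slab i k \<rho>)"
      unfolding Slab_def Collect_conj_eq by (intro closed_Int) auto
    then show "Slab i k \<rho> \<in> sets lebesgue" by auto
  qed
  define K where "K = CARD('n) * real (card {-k0..k0}) * (2 * (1 + D) * (2 * b) ^ (CARD('n) - 1))"
  have bpos: "b \<ge> 0" using D0 by (simp add: b_def)
  have "K \<ge> 0" using D0 bpos by (simp add: K_def)
  moreover have "real (card {w. set w \<subseteq> {1..r} \<and> length w = j \<and> splits \<delta> w}) \<le> K * \<theta> ^ j * real r ^ j" if \<delta>: "\<delta> \<le> 1" for \<delta> j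
  proof -
    let ?W = "{w. set w \<subseteq> {1..r} \<and> length w = j \<and> splits \<delta> w}"
    define p where "p w = foldr branch w 0 - vec_floor (foldr branch w 0)" for w
    define T where "T w = (+) (p w) ` ((B ^^ j) ` unit_cube)" for w
    have fin: "finite ?W"
      using finite_lists_length_eq[of "{1..r}" j] by (rule rev_finite_subset) auto
    have T: "T w \<in> lmeasurable" "measure lebesgue (T w) = 1 / real r ^ j" for w
      using measure_funpow_B[OF unit_cube_lmeasurable, of j]
      by (auto simp: T_def measurable_translation measure_translation measure_unit_cube)
    have disj: "disjoint_family_on T ?W"
      unfolding disjoint_family_on_def
    proof (intro ballI impI, rule ccontr)
      fix w w' assume w: "w \<in> ?W" "w' \<in> ?W" "w \<noteq> w'" and "T w \<inter> T w' \<noteq> {}"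
      then obtain u u' where u: "u \<in> unit_cube" "u' \<in> unit_cube" "p w + (B ^^ j) u = p w' + (B ^^ j) u'"
        by (auto simp: T_def)
      have p_lattice: "(a ^^ j) (p v) \<in> int_lattice" if "v \<in> ?W" for v
        using funpow_a_branches[of v 0] that funpow_a_lattice[OF vec_floor_lattice, of j "foldr branch v 0"]
        unfolding p_def funpow_a_diff by auto
      have "(a ^^ j) (p w) + u = (a ^^ j) (p w') + u'"
        using arg_cong[OF u(3), of "a ^^ j"] by (simp add: funpow_a_add funpow_a_B)
      then have "u - u' = (a ^^ j) (p w') - (a ^^ j) (p w)" by (simp add: algebra_simps)
      then have "u = u'" using p_lattice w u by (intro unit_cube_lattice_unique) auto
      then have "p w = p w'" using u(3) by simp
      then have "foldr branch w 0 - foldr branch w' 0 = vec_floor (foldr branch w 0) - vec_floor (foldr branch w' 0)"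
        by (simp add: p_def algebra_simps)
      then have "foldr branch w 0 - foldr branch w' 0 \<in> int_lattice" by (metis int_lattice_diff vec_floor_lattice)
      then have "itinerary a label (foldr branch w 0) = itinerary a label (foldr branch w' 0)" by (rule itinerary_cong)
      then have "w = w'"
        using prefix_word_itinerary_branches[of w 0] prefix_word_itinerary_branches[of w' 0] w by auto
      then show False using w by simp
    qed
    have sub: "(\<Union>w\<in>?W. T w) \<subseteq> (\<Union>i. \<Union>k\<in>{-k0..k0}. Slab i k ((1 + D) * \<theta> ^ j))"
    proof
      fix x assume "x \<in> (\<Union>w\<in>?W. T w)"
      then obtain w u where w: "set w \<subseteq> {1..r}" "length w = j" "splits \<delta> w" and u: "u \<in> unit_cube" "x = p w + (B ^^ j) u"
        by (auto simp: T_def)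
      obtain i k where ik: "\<bar>real m * (foldr branch w 0 $ i - s) - of_int k\<bar> \<le> real m * \<theta> ^ j"
        using splits_near_grid[OF w(3) \<delta>] w(2) by metis
      define k' where "k' = k - int m * \<lfloor>foldr branch w 0 $ i\<rfloor>"
      have "real m * (foldr branch w 0 $ i - s) - of_int k = real m * (p w $ i - (s + of_int k' / real m))"
        using m_pos by (simp add: p_def vec_floor_def k'_def field_simps)
      then have "real m * \<bar>p w $ i - (s + of_int k' / real m)\<bar> \<le> real m * \<theta> ^ j"
        using ik by (simp add: abs_mult)
      then have near_p: "\<bar>p w $ i - (s + of_int k' / real m)\<bar> \<le> \<theta> ^ j" using m_pos by simp
      have Bu: "\<bar>(B ^^ j) u $ l\<bar> \<le> \<theta> ^ j * D" for l by (rule B_cube[OF u(1)])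
      have \<theta>1: "\<theta> ^ j \<le> 1" using \<theta> by (simp add: power_le_one)
      have "\<theta> ^ j * D \<le> D" using mult_right_mono[OF \<theta>1 D0] by simp
      have near: "\<bar>x $ i - (s + of_int k' / real m)\<bar> \<le> (1 + D) * \<theta> ^ j"
        using near_p Bu[of i] u(2) by (simp add: algebra_simps)
      have pw: "0 \<le> p w $ l" "p w $ l < 1" for l
        using vec_floor_unit_cube[of "foldr branch w 0"] by (auto simp: p_def unit_cube_def)
      have box: "\<bar>x $ l\<bar> \<le> b" for l
        using pw[of l] Bu[of l] \<open>\<theta> ^ j * D \<le> D\<close> u(2) D0 by (simp add: b_def)
      have "\<bar>of_int k' / real m\<bar> \<le> b + \<bar>s\<bar> + (1 + D) * \<theta> ^ j" using near box[of i] by linarith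
      also have "(1 + D) * \<theta> ^ j \<le> 1 + D" using mult_left_mono[OF \<theta>1, of "1 + D"] D0 by simp
      finally have "\<bar>of_int k'\<bar> \<le> real m * (b + \<bar>s\<bar>) + real m * (1 + D)"
        using m_pos by (simp add: abs_divide divide_le_eq algebra_simps)
      then have "\<bar>k'\<bar> \<le> k0" unfolding k0_def by (simp add: le_ceiling_iff)
      then have "k' \<in> {-k0..k0}" by auto
      moreover have "- b \<le> x $ l" "x $ l \<le> b" for l using box[of l] by (auto simp: abs_le_iff)
      then have "x \<in> Slab i k' ((1 + D) * \<theta> ^ j)"
        using near by (simp add: Slab_def mem_box_cart)
      ultimately show "x \<in> (\<Union>i. \<Union>k\<in>{-k0..k0}. Slab i k ((1 + D) * \<theta> ^ j))" by blast
    qed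
    have "real (card ?W) / real r ^ j = (\<Sum>w\<in>?W. measure lebesgue (T w))"
      by (simp add: T)
    also have "\<dots> = measure lebesgue (\<Union>w\<in>?W. T w)"
      by (rule measure_finite_Union[symmetric]) (use fin disj fmeasurableD[OF T(1)] fmeasurableD2[OF T(1)] in auto)
    also have "\<dots> \<le> measure lebesgue (\<Union>i. \<Union>k\<in>{-k0..k0}. Slab i k ((1 + D) * \<theta> ^ j))"
      by (intro measure_mono_fmeasurable sub fmeasurable.finite_UN sets.finite_UN fmeasurableD fin)
        (auto intro: T Slab)
    also have "\<dots> \<le> (\<Sum>i\<in>UNIV. measure lebesgue (\<Union>k\<in>{-k0..k0}. Slab i k ((1 + D) * \<theta> ^ j)))"
      by (intro measure_UNION_le) (auto intro!: sets.finite_UN fmeasurableD Slab)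
    also have "\<dots> \<le> (\<Sum>i\<in>(UNIV :: 'n set). \<Sum>k\<in>{-k0..k0}. measure lebesgue (Slab i k ((1 + D) * \<theta> ^ j)))"
      by (intro sum_mono measure_UNION_le) (auto intro!: fmeasurableD Slab)
    also have "\<dots> \<le> (\<Sum>i\<in>(UNIV :: 'n set). \<Sum>k\<in>{-k0..k0}. 2 * ((1 + D) * \<theta> ^ j) * (2 * b) ^ (CARD('n) - 1))"
      unfolding Slab_def using D0 \<theta> bpos by (intro sum_mono measure_slab_le) auto
    also have "\<dots> = K * \<theta> ^ j" by (simp add: K_def mult_ac)
    finally show ?thesis
      using z_digit by (simp add: pos_divide_le_eq)
  qed
  ultimately show thesis using that by blast
qed

text \<open>Summing the geometric bound, and using that finitely many short words do not split at a small
  enough scale.\<close>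
lemma few_split_words:
  assumes "\<eta> > 0"
  obtains \<delta> where "0 < \<delta>" "\<delta> \<le> 1"
    "\<And>n. real (card {w. set w \<subseteq> {1..r} \<and> length w = n \<and> \<not> unsplit \<delta> w}) \<le> \<eta> * real r ^ n"
proof -
  obtain K where K: "0 \<le> K" "\<And>\<delta> j. \<delta> \<le> 1 \<Longrightarrow>
    real (card {w. set w \<subseteq> {1..r} \<and> length w = j \<and> splits \<delta> w}) \<le> K * \<theta> ^ j * real r ^ j"
    using card_split_words_le by blast
  have sm: "summable (\<lambda>j. K * \<theta> ^ j)" using \<theta> by (intro summable_mult summable_geometric) auto
  obtain J where J: "(\<Sum>j. K * \<theta> ^ (j + J)) < \<eta>"
    using suminf_exist_split[OF assms sm] K \<theta> by (auto simp: abs_less_iff)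
  obtain \<delta> where \<delta>: "0 < \<delta>" "\<delta> \<le> 1" "\<And>w. set w \<subseteq> {1..r} \<Longrightarrow> length w < J \<Longrightarrow> \<not> splits \<delta> w"
    using short_words_not_split by blast
  define \<beta> where "\<beta> j = (if j < J then 0 else K * \<theta> ^ j)" for j
  have "real (card {w. set w \<subseteq> {1..r} \<and> length w = j \<and> splits \<delta> w}) \<le> \<beta> j * real r ^ j" for j
  proof (cases "j < J")
    case True
    then have empty: "{w. set w \<subseteq> {1..r} \<and> length w = j \<and> splits \<delta> w} = {}" using \<delta>(3) by auto
    show ?thesis unfolding empty using True by (simp add: \<beta>_def)
  qed (use K \<delta> in \<open>auto simp: \<beta>_def\<close>)
  then have "real (card {w. set w \<subseteq> {1..r} \<and> length w = n \<and> \<not> unsplit \<delta> w}) \<le> (\<Sum>j<n. \<beta> j) * real r ^ n" for n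
    by (rule card_split_words)
  moreover have "(\<Sum>j<n. \<beta> j) \<le> \<eta>" for n
  proof -
    have "(\<Sum>j<n. \<beta> j) \<le> (\<Sum>j<n + J. \<beta> j)"
      using K \<theta> by (intro sum_mono2) (auto simp: \<beta>_def)
    also have "\<dots> = (\<Sum>j\<in>{J..<n + J}. K * \<theta> ^ j)"
      by (intro sum.mono_neutral_cong_right) (auto simp: \<beta>_def)
    also have "\<dots> = (\<Sum>j<n. K * \<theta> ^ (j + J))"
      using sum.shift_bounds_nat_ivl[of "\<lambda>j. K * \<theta> ^ j" 0 J n] by (simp add: lessThan_atLeast0)
    also have "\<dots> \<le> (\<Sum>j. K * \<theta> ^ (j + J))"
      using sm[THEN summable_ignore_initial_segment, of J] K \<theta> by (intro sum_le_suminf) auto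
    finally show ?thesis using J by simp
  qed
  ultimately have "real (card {w. set w \<subseteq> {1..r} \<and> length w = n \<and> \<not> unsplit \<delta> w}) \<le> \<eta> * real r ^ n" for n
    by (meson mult_right_mono order_trans of_nat_0_le_iff zero_le_power)
  then show thesis using that \<delta> by blast
qed

end

section \<open>The torus\<close>

lemma torus_proj_eq_iff: "torus_proj x = torus_proj y \<longleftrightarrow> x - y \<in> int_lattice"
  by (simp add: torus.abs_eq_iff lattice_rel_iff)

lemma torus_proj_rep [simp]: "torus_proj (rep_torus t) = t"
  by (rule Quotient3_abs_rep[OF Quotient3_torus])

lemma rep_torus_proj: "rep_torus (torus_proj x) - x \<in> int_lattice"
  by (simp flip: torus_proj_eq_iff)

definition torus_borel :: "'n::finite torus measure" where
  "torus_borel = sigma UNIV {B. torus_proj -` B \<in> sets borel}"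

lemma space_torus_borel [simp]: "space torus_borel = UNIV"
  by (simp add: torus_borel_def)

lemma sets_torus_borel: "sets torus_borel = {B. torus_proj -` B \<in> sets borel}"
proof -
  have "sigma_algebra UNIV {B :: 'a torus set. torus_proj -` B \<in> sets borel}"
    unfolding sigma_algebra_iff2
  proof (intro conjI ballI allI impI)
    fix B :: "'a torus set"
    assume "B \<in> {B. torus_proj -` B \<in> sets borel}"
    then have "space borel - torus_proj -` B \<in> sets borel" by (intro sets.compl_sets) simp
    then show "UNIV - B \<in> {B. torus_proj -` B \<in> sets borel}" by (simp add: vimage_Diff)
  next
    fix B :: "nat \<Rightarrow> 'a torus set"
    assume "range B \<subseteq> {B. torus_proj -` B \<in> sets borel}"
    then have "(\<Union>i. torus_proj -` B i) \<in> sets borel" by (intro sets.countable_UN) auto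
    then show "\<Union> (range B) \<in> {B. torus_proj -` B \<in> sets borel}" by (simp add: vimage_UN)
  qed simp_all
  then show ?thesis by (simp add: torus_borel_def sigma_algebra.sigma_sets_eq)
qed

lemma sets_torus_borel_lebesgue: "sets torus_borel \<subseteq> sets torus_lebesgue"
  by (auto simp: sets_torus_borel sets_torus_lebesgue)

text \<open>Take a Borel set inside the trace of \<open>E\<close> on the unit cube and spread it out by the lattice.\<close>
lemma torus_borel_inner:
  fixes E :: "'n::finite torus set"
  assumes "E \<in> sets torus_lebesgue"
  obtains E1 where "E1 \<in> sets torus_borel" "E1 \<subseteq> E" "E - E1 \<in> null_sets torus_lebesgue"
proof -
  have "torus_proj -` E \<inter> unit_cube \<in> sets lebesgue"
    using assms unit_cube_sets by (auto simp: sets_torus_lebesgue)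
  then obtain S N N' where S: "torus_proj -` E \<inter> unit_cube = S \<union> N" "N \<subseteq> N'" "N' \<in> null_sets lborel" "S \<in> sets lborel"
    by (rule sets_completionE)
  define E1 where "E1 = torus_proj ` S"
  have "torus_proj -` E1 = (\<Union>e\<in>int_lattice. {x. x + e \<in> S})"
  proof (intro equalityI subsetI)
    fix x assume "x \<in> torus_proj -` E1"
    then obtain y where y: "y \<in> S" "y - x \<in> int_lattice" by (auto simp: E1_def) (metis torus_proj_eq_iff)
    then show "x \<in> (\<Union>e\<in>int_lattice. {x. x + e \<in> S})" by (intro UN_I[of "y - x"]) auto
  next
    fix x assume "x \<in> (\<Union>e\<in>int_lattice. {x. x + e \<in> S})"
    then obtain e where e: "e \<in> int_lattice" "x + e \<in> S" by blast
    then have "torus_proj x = torus_proj (x + e)" by (simp add: torus_proj_eq_iff)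
    then show "x \<in> torus_proj -` E1" using e by (auto simp: E1_def)
  qed
  also have "\<dots> \<in> sets borel"
  proof (rule sets.countable_UN''[OF countable_int_lattice])
    fix e :: "real ^ 'n"
    have "(\<lambda>x. x + e) -` S \<inter> space borel \<in> sets borel"
      using S(4) by (intro measurable_sets[of _ borel borel]) auto
    then show "{x. x + e \<in> S} \<in> sets borel" by (simp add: vimage_def)
  qed
  finally have E1: "E1 \<in> sets torus_borel" by (simp add: sets_torus_borel)
  have "E1 \<subseteq> E" using S(1) by (auto simp: E1_def)
  moreover have "E - E1 \<in> null_sets torus_lebesgue"
  proof -
    have sets: "E - E1 \<in> sets torus_lebesgue"
      using assms E1 sets_torus_borel_lebesgue by blast
    have "torus_proj -` (E - E1) \<inter> unit_cube \<subseteq> N'" using S(1,2) by (auto simp: E1_def)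
    moreover have "N' \<in> null_sets lebesgue" using S(3) by (rule null_sets_completionI)
    ultimately have "emeasure lebesgue (torus_proj -` (E - E1) \<inter> unit_cube) = 0"
      by (meson completion.complete2 null_setsD1)
    then show ?thesis using sets by (simp add: null_sets_def emeasure_torus_lebesgue)
  qed
  ultimately show thesis using that E1 by blast
qed

lemma torus_borel_sandwich:
  fixes E :: "'n::finite torus set"
  assumes E: "E \<in> sets torus_lebesgue"
  shows "\<exists>E1\<in>sets torus_borel. \<exists>E2\<in>sets torus_borel. E1 \<subseteq> E \<and> E \<subseteq> E2 \<and> E2 - E1 \<in> null_sets torus_lebesgue"
proof -
  have "- E \<in> sets torus_lebesgue" using sets.compl_sets[OF E] by (simp add: Compl_eq_Diff_UNIV)
  then obtain D where D: "D \<in> sets torus_borel" "D \<subseteq> - E" "- E - D \<in> null_sets torus_lebesgue"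
    by (rule torus_borel_inner)
  obtain E1 where E1: "E1 \<in> sets torus_borel" "E1 \<subseteq> E" "E - E1 \<in> null_sets torus_lebesgue"
    using torus_borel_inner[OF E] by blast
  have "- D \<in> sets torus_borel" using sets.compl_sets[OF D(1)] by (simp add: Compl_eq_Diff_UNIV)
  moreover have "- D - E1 = (- E - D) \<union> (E - E1)" using D E1 by auto
  ultimately show ?thesis using D E1 null_sets.Un[OF D(3) E1(3)] by (intro bexI[of _ E1] bexI[of _ "- D"]) auto
qed

lemma complete_torus_lebesgue: "complete_measure (torus_lebesgue :: 'n::finite torus measure)"
proof
  fix A B :: "'n torus set" assume B: "B \<subseteq> A" "A \<in> null_sets torus_lebesgue"
  have sets: "torus_proj -` A \<in> sets lebesgue" using B by (auto simp: sets_torus_lebesgue null_sets_def)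
  have null: "torus_proj -` A \<inter> unit_cube \<in> null_sets lebesgue"
    using B sets unit_cube_sets by (auto simp: null_sets_def emeasure_torus_lebesgue)
  have "torus_proj -` B = (\<Union>e\<in>int_lattice. (+) e ` (torus_proj -` B \<inter> unit_cube))"
  proof (intro equalityI subsetI)
    fix x assume x: "x \<in> torus_proj -` B"
    have "torus_proj (x - vec_floor x) = torus_proj x" by (simp add: torus_proj_eq_iff)
    then show "x \<in> (\<Union>e\<in>int_lattice. (+) e ` (torus_proj -` B \<inter> unit_cube))"
      using x vec_floor_unit_cube[of x] by (intro UN_I[of "vec_floor x"] image_eqI[of _ _ "x - vec_floor x"]) auto
  next
    fix x assume "x \<in> (\<Union>e\<in>int_lattice. (+) e ` (torus_proj -` B \<inter> unit_cube))"
    then obtain e y where "e \<in> int_lattice" "torus_proj y \<in> B" "x = e + y" by auto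
    moreover from this have "torus_proj x = torus_proj y" by (simp add: torus_proj_eq_iff)
    ultimately show "x \<in> torus_proj -` B" by simp
  qed
  also have "\<dots> \<in> sets lebesgue"
  proof (intro sets.countable_UN'' countable_int_lattice lebesgue_sets_translation)
    show "torus_proj -` B \<inter> unit_cube \<in> sets lebesgue"
      using B by (intro completion.complete[OF _ null]) auto
  qed
  finally show "B \<in> sets torus_lebesgue" by (simp add: sets_torus_lebesgue)
qed

lemma measurable_prefix_word:
  "prefix_word n \<in> PiM UNIV (\<lambda>_::nat. point_measure {1..r::nat} p) \<rightarrow>\<^sub>M count_space UNIV"
proof (induction n)
  case (Suc n)
  let ?N = "PiM UNIV (\<lambda>_::nat. point_measure {1..r::nat} p)"
  have "(\<lambda>x. x) \<in> point_measure {1..r} p \<rightarrow>\<^sub>M count_space UNIV"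
    by (simp add: measurable_point_measure_eq1)
  with measurable_component_singleton[of n UNIV "\<lambda>_. point_measure {1..r} p", OF UNIV_I]
  have component: "(\<lambda>\<omega>. \<omega> n) \<in> ?N \<rightarrow>\<^sub>M count_space UNIV" by (rule measurable_compose)
  have "(\<lambda>\<omega>. prefix_word n \<omega> @ [i]) \<in> ?N \<rightarrow>\<^sub>M count_space UNIV" for i
    by (rule measurable_compose[OF Suc]) simp
  from measurable_compose_countable[of "\<lambda>i \<omega>. prefix_word n \<omega> @ [i]", OF this component]
  have "(\<lambda>\<omega>. prefix_word n \<omega> @ [\<omega> n]) \<in> ?N \<rightarrow>\<^sub>M count_space UNIV" .
  then show ?case by (simp add: prefix_word_def[abs_def])
qed (simp add: prefix_word_def[abs_def])

lemma prefix_word_add: "prefix_word (n + k) \<omega> = prefix_word n \<omega> @ prefix_word k (\<lambda>j. \<omega> (n + j))"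
  by (rule nth_equalityI) (auto simp: prefix_word_def nth_append)

context lattice_coding
begin

definition torus_map :: "'n torus \<Rightarrow> 'n torus" where
  "torus_map t = torus_proj (a (rep_torus t))"

definition torus_label :: "'n torus \<Rightarrow> nat" where
  "torus_label t = label (rep_torus t)"

lemma torus_map_proj: "torus_map (torus_proj x) = torus_proj (a x)"
  using rep_torus_proj[of x] by (auto simp: torus_map_def torus_proj_eq_iff simp flip: a_diff)

lemma torus_label_proj: "torus_label (torus_proj x) = label x"
  using label_shift[OF rep_torus_proj, of x x] by (simp add: torus_label_def)

lemma itinerary_torus_proj: "itinerary torus_map torus_label (torus_proj x) = itinerary a label x"
proof -
  have "(torus_map ^^ j) (torus_proj x) = torus_proj ((a ^^ j) x)" for j
    by (induction j) (simp_all add: torus_map_proj)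
  then show ?thesis by (simp add: itinerary_def torus_label_proj fun_eq_iff)
qed

lemma torus_label_in: "torus_label t \<in> {1..r}"
  unfolding torus_label_def by (rule label_in)

lemma vimage_torus_label: "torus_proj -` (torus_label -` S) = {x. label x \<in> S}"
  by (auto simp: torus_label_proj)

lemma torus_borel_measurable:
  "torus_map \<in> torus_borel \<rightarrow>\<^sub>M torus_borel" "torus_label \<in> torus_borel \<rightarrow>\<^sub>M count_space UNIV"
proof -
  show "torus_map \<in> torus_borel \<rightarrow>\<^sub>M torus_borel"
  proof (rule measurableI)
    fix E :: "'n torus set" assume "E \<in> sets torus_borel"
    then have "torus_proj -` E \<in> sets borel" by (simp add: sets_torus_borel)
    from measurable_sets[OF a_borel this]
    show "torus_map -` E \<inter> space torus_borel \<in> sets torus_borel"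
      by (simp add: sets_torus_borel vimage_def torus_map_proj)
  qed simp
  show "torus_label \<in> torus_borel \<rightarrow>\<^sub>M count_space UNIV"
    by (rule measurableI) (simp_all add: sets_torus_borel vimage_torus_label label_sets)
qed

lemma torus_lebesgue_measurable:
  "torus_map \<in> torus_lebesgue \<rightarrow>\<^sub>M torus_lebesgue" "torus_label \<in> torus_lebesgue \<rightarrow>\<^sub>M count_space UNIV"
proof -
  show "torus_map \<in> torus_lebesgue \<rightarrow>\<^sub>M torus_lebesgue"
  proof (rule measurableI)
    fix E :: "'n torus set" assume "E \<in> sets torus_lebesgue"
    then show "torus_map -` E \<inter> space torus_lebesgue \<in> sets torus_lebesgue"
      using a_vimage_sets[of "torus_proj -` E"]
      by (simp add: sets_torus_lebesgue vimage_def torus_map_proj)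
  qed simp
  show "torus_label \<in> torus_lebesgue \<rightarrow>\<^sub>M count_space UNIV"
    using label_sets by (intro measurableI) (auto simp: sets_torus_lebesgue vimage_torus_label)
qed

sublocale torus: uniform_labels torus_lebesgue torus_map torus_label r
proof (intro uniform_labels.intro prob_space_torus_lebesgue uniform_labels_axioms.intro)
  fix E :: "'n torus set" and i assume E: "E \<in> sets torus_lebesgue" and i: "i \<in> {1..r}"
  let ?E = "torus_proj -` E"
  let ?Q = "{t. torus_label t = i \<and> torus_map t \<in> E}"

  have E_sets: "?E \<in> sets lebesgue" using E by (simp add: sets_torus_lebesgue)
  have "torus_proj (x + e) = torus_proj x" if "e \<in> int_lattice" for x e :: "real ^ 'n"
    using that by (simp add: torus_proj_eq_iff)
  then have "lattice_invariant ?E" by (simp add: lattice_invariant_def)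
  have "?Q = torus_label -` {i} \<inter> torus_map -` E" by auto
  moreover have "torus_label -` {i} \<in> sets torus_lebesgue" "torus_map -` E \<in> sets torus_lebesgue"
    using measurable_sets[OF torus_lebesgue_measurable(2), of "{i}"] measurable_sets[OF torus_lebesgue_measurable(1) E] by auto
  ultimately have Q: "?Q \<in> sets torus_lebesgue" by (metis sets.Int)
  have "measure torus_lebesgue ?Q = measure lebesgue ({x. label x = i \<and> a x \<in> ?E} \<inter> unit_cube)"
    using Q by (simp add: measure_def emeasure_torus_lebesgue vimage_def torus_map_proj torus_label_proj)
  also have "\<dots> = measure lebesgue (?E \<inter> unit_cube) / r"
    using measure_branch[OF E_sets \<open>lattice_invariant ?E\<close> i] by (simp add: volume_factor_eq)
  also have "\<dots> = measure torus_lebesgue E / r"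
    using E by (simp add: measure_def emeasure_torus_lebesgue)
  finally show "measure torus_lebesgue {t \<in> space torus_lebesgue. torus_label t = i \<and> torus_map t \<in> E} = measure torus_lebesgue E / real r"
    by simp
qed (use torus_lebesgue_measurable torus_label_in in auto)

text \<open>The first \<open>n\<close> letters form a good word, and the run of \<open>z\<close> that follows is long enough to send
  everything into the ball for which it is good.\<close>
definition synchronised :: "nat \<Rightarrow> (nat \<Rightarrow> nat) \<Rightarrow> bool" where
  "synchronised n \<omega> \<longleftrightarrow> (\<exists>K \<delta>. \<delta> \<le> 1 \<and> (\<forall>y. N ((branch z ^^ K) y) \<le> \<delta>) \<and>
     unsplit \<delta> (prefix_word n \<omega>) \<and> (\<forall>j<K. \<omega> (n + j) = z))"

text \<open>For each \<open>\<eta> > 0\<close> a suitable scale \<open>\<delta>\<close> and run length \<open>K\<close> show that synchronisation after time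
  \<open>n0\<close> has probability at least \<open>1 - \<eta>\<close>.\<close>
lemma AE_synchronised: "AE t in torus_lebesgue. \<forall>n0. \<exists>n\<ge>n0. synchronised n (torus.itin t)"
  unfolding AE_all_countable
proof
  fix n0
  define Q where "Q K w \<longleftrightarrow> (\<exists>\<delta>\<le>1. (\<forall>y. N ((branch z ^^ K) y) \<le> \<delta>) \<and> unsplit \<delta> w)" for K w
  have sync_Q: "synchronised n \<omega> \<longleftrightarrow> (\<exists>K. Q K (prefix_word n \<omega>) \<and> (\<forall>j<K. \<omega> (n + j) = z))" for n \<omega>
    unfolding synchronised_def Q_def by blast
  let ?S = "{t \<in> space torus_lebesgue. \<exists>n\<ge>n0. synchronised n (torus.itin t)}"
  have S [measurable]: "?S \<in> sets torus_lebesgue"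
    unfolding sync_Q by measurable
  have bound: "1 - \<eta> \<le> torus.prob ?S" if \<eta>: "\<eta> > 0" for \<eta>
  proof -
    obtain \<delta> where \<delta>: "0 < \<delta>" "\<delta> \<le> 1"
      "\<And>n. real (card {w. set w \<subseteq> {1..r} \<and> length w = n \<and> \<not> unsplit \<delta> w}) \<le> \<eta> * real r ^ n"
      by (rule few_split_words[OF \<eta>]) (rule that)
    obtain K where K: "\<And>y. N ((branch z ^^ K) y) \<le> \<delta>" by (rule synchronising_word[OF \<delta>(1)]) (rule that)
    have "1 - \<eta> \<le> torus.prob {t \<in> space torus_lebesgue. \<exists>n\<ge>n0.
        prefix_word n (torus.itin t) \<in> {w. unsplit \<delta> w} \<and> (\<forall>j<K. torus.itin t (n + j) = z)}"
    proof (rule torus.prob_good_prefix_before_run[OF z_digit])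
      show "real (card {w. set w \<subseteq> {1..r} \<and> length w = n \<and> w \<notin> {w. unsplit \<delta> w}}) \<le> \<eta> * real r ^ n" for n
        using \<delta>(3)[of n] by (simp only: mem_Collect_eq)
    qed
    also have "\<dots> \<le> torus.prob ?S"
      using K \<delta>(2) S by (intro torus.finite_measure_mono) (auto simp: synchronised_def)
    finally show ?thesis .
  qed
  have "1 \<le> torus.prob ?S"
  proof (rule field_le_epsilon)
    fix \<eta> :: real assume "0 < \<eta>"
    from bound[OF this] show "1 \<le> torus.prob ?S + \<eta>" by linarith
  qed
  then have "torus.prob ?S = 1" using torus.prob_le_1[of ?S] by linarith
  then show "AE t in torus_lebesgue. \<exists>n\<ge>n0. synchronised n (torus.itin t)"
    by (rule torus.prob_Collect_eq_1[OF S, THEN iffD1])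
qed

lemma synchronised_imp_close:
  assumes "synchronised n \<omega>"
  obtains p n1 where "\<And>n' y. n1 \<le> n' \<Longrightarrow> N (foldr branch (prefix_word n' \<omega>) y - p) \<le> \<theta> ^ n"
proof -
  obtain K \<delta> where \<delta>: "\<delta> \<le> 1" "\<And>y. N ((branch z ^^ K) y) \<le> \<delta>"
    "unsplit \<delta> (prefix_word n \<omega>)" "\<And>j. j < K \<Longrightarrow> \<omega> (n + j) = z"
    using assms unfolding synchronised_def by blast
  have run: "prefix_word K (\<lambda>j. \<omega> (n + j)) = replicate K z"
    using \<delta>(4) by (auto simp: prefix_word_def list_eq_iff_nth_eq)
  define p where "p = foldr branch (prefix_word n \<omega>) 0"
  have "N (foldr branch (prefix_word n' \<omega>) y - p) \<le> \<theta> ^ n" if "n + K \<le> n'" for n' y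
  proof -
    obtain l where l: "n' = n + K + l" using \<open>n + K \<le> n'\<close> le_iff_add by blast
    define v where "v = (branch z ^^ K) (foldr branch (prefix_word l (\<lambda>j. \<omega> (n + K + j))) y)"
    have "foldr branch (prefix_word n' \<omega>) y = foldr branch (prefix_word n \<omega>) v"
      unfolding l by (simp add: prefix_word_add run v_def foldr_replicate)
    also have "\<dots> = p + (B ^^ n) v"
      using branches_unsplit[OF \<delta>(3), of v] \<delta>(2) by (simp add: p_def v_def)
    finally have "N (foldr branch (prefix_word n' \<omega>) y - p) = N ((B ^^ n) v)" by simp
    also have "\<dots> \<le> \<theta> ^ n * N v" by (rule N_funpow_B)
    also have "\<dots> \<le> \<theta> ^ n * 1"
      using \<theta> \<delta>(1) \<delta>(2) unfolding v_def by (intro mult_left_mono) (auto intro: order_trans)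
    finally show ?thesis by simp
  qed
  then show thesis using that by blast
qed

text \<open>At a synchronised time all later composites of branches agree up to \<open>2 \<theta>\<^sup>n\<close>, whatever point they
  are applied to. Applied to \<open>0\<close> they form the sequence in question; applied to iterates of \<open>x\<close>
  they give \<open>x\<close> up to the lattice, which is closed.\<close>
lemma limit_of_branches:
  assumes sync: "\<And>n0. \<exists>n\<ge>n0. synchronised n (itinerary a label x)"
  shows "x - lim (\<lambda>n. foldr branch (prefix_word n (itinerary a label x)) 0) \<in> int_lattice"
proof -
  define \<omega> where "\<omega> = itinerary a label x"
  define X where "X n = foldr branch (prefix_word n \<omega>) 0" for n
  have close: "\<exists>p n1. \<forall>n' y. n1 \<le> n' \<longrightarrow> norm (foldr branch (prefix_word n' \<omega>) y - p) < e" if e: "e > 0" for e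
  proof -
    obtain n0 where n0: "\<theta> ^ n0 < e" using real_arch_pow_inv[OF e] \<theta> by blast
    obtain n where n: "n \<ge> n0" "synchronised n \<omega>" using sync unfolding \<omega>_def by blast
    then have "\<theta> ^ n \<le> \<theta> ^ n0" using \<theta> by (intro power_decreasing) auto
    obtain p n1 where p: "\<And>n' y. n1 \<le> n' \<Longrightarrow> N (foldr branch (prefix_word n' \<omega>) y - p) \<le> \<theta> ^ n"
      by (rule synchronised_imp_close[OF n(2)]) (rule that)
    have "norm (foldr branch (prefix_word n' \<omega>) y - p) < e" if "n1 \<le> n'" for n' y
      using p[OF that, of y] norm_le_N[of "foldr branch (prefix_word n' \<omega>) y - p"] \<open>\<theta> ^ n \<le> \<theta> ^ n0\<close> n0
      by linarith
    then show ?thesis by blast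
  qed
  have "Cauchy X"
  proof (rule metric_CauchyI)
    fix e :: real assume "e > 0"
    then obtain p n1 where p: "\<And>n' y. n1 \<le> n' \<Longrightarrow> norm (foldr branch (prefix_word n' \<omega>) y - p) < e / 2"
      using close[OF half_gt_zero[OF \<open>e > 0\<close>]] by metis
    have "dist (X n) p < e / 2" if "n \<ge> n1" for n
      using p[OF that, of 0] by (simp only: X_def dist_norm)
    then have "dist (X m) (X n) < e" if "m \<ge> n1" "n \<ge> n1" for m n
      using that dist_triangle_half_l by blast
    then show "\<exists>M. \<forall>m\<ge>M. \<forall>n\<ge>M. dist (X m) (X n) < e" by blast
  qed
  then have X_lim: "X \<longlonglongrightarrow> lim X" by (simp add: Cauchy_convergent_iff convergent_LIMSEQ_iff)
  have "(x - lim X) $ i \<in> \<int>" for i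
  proof -
    have "\<exists>k\<in>\<int>. dist k ((x - lim X) $ i) < e" if "e > 0" for e
    proof -
      obtain p n1 where p: "\<And>n' y. n1 \<le> n' \<Longrightarrow> norm (foldr branch (prefix_word n' \<omega>) y - p) < e / 3"
        using close[of "e / 3"] \<open>e > 0\<close> by (metis zero_less_divide_iff zero_less_numeral)
      have "\<forall>\<^sub>F n in sequentially. dist (X n) (lim X) < e / 3"
        using X_lim \<open>e > 0\<close> by (intro tendstoD) auto
      then obtain n2 where n2: "\<And>n. n \<ge> n2 \<Longrightarrow> dist (X n) (lim X) < e / 3"
        unfolding eventually_sequentially by blast
      define n where "n = max n1 n2"
      define q where "q = foldr branch (prefix_word n \<omega>) ((a ^^ n) x)"
      have "x - q \<in> int_lattice" unfolding q_def \<omega>_def by (rule branches_itinerary)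
      moreover have "norm ((x - q) - (x - lim X)) < e"
      proof -
        have "norm (q - p) < e / 3" "norm (X n - p) < e / 3" "norm (X n - lim X) < e / 3"
          using p[of n] n2[of n] by (auto simp: n_def q_def X_def dist_norm)
        moreover have eq: "(x - q) - (x - lim X) = (X n - p) - (q - p) - (X n - lim X)" by simp
        moreover have "norm ((X n - p) - (q - p) - (X n - lim X)) \<le> norm (X n - p) + norm (q - p) + norm (X n - lim X)"
          by (meson norm_triangle_ineq4 order_trans add_right_mono)
        ultimately show ?thesis unfolding eq by linarith
      qed
      ultimately show ?thesis
        using component_le_norm_cart[of "(x - q) - (x - lim X)" i]
        by (intro bexI[of _ "(x - q) $ i"]) (auto simp: dist_real_def int_lattice_def)
    qed
    then show ?thesis using closed_approachable[OF closed_Ints, of "(x - lim X) $ i"] by blast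
  qed
  then show ?thesis by (simp add: int_lattice_def X_def[abs_def] \<omega>_def)
qed

definition decode :: "(nat \<Rightarrow> nat) \<Rightarrow> 'n torus" where
  "decode \<omega> = torus_proj (lim (\<lambda>n. foldr branch (prefix_word n \<omega>) 0))"

lemma decode_itinerary: "AE t in torus_lebesgue. decode (torus.itin t) = t"
  using AE_synchronised
proof eventually_elim
  case (elim t)
  let ?x = "rep_torus t"
  have "torus.itin t = itinerary a label ?x" using itinerary_torus_proj[of ?x] by simp
  with elim have "?x - lim (\<lambda>n. foldr branch (prefix_word n (torus.itin t)) 0) \<in> int_lattice"
    using limit_of_branches[of ?x] by simp
  then have "torus_proj ?x = decode (torus.itin t)"
    unfolding decode_def torus_proj_eq_iff .
  then show ?case by simp
qed

lemma torus_map_isomorphic_bernoulli: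
  "mp_isomorphic torus_lebesgue torus_map (bernoulli_measure r (\<lambda>_. 1 / real r)) left_shift"
proof -
  let ?N = "PiM UNIV (\<lambda>_::nat. point_measure {1..r} (\<lambda>i. ennreal (1 / real r)))"
  have \<phi>: "torus.itin \<in> torus_borel \<rightarrow>\<^sub>M ?N"
    by (rule measurable_itinerary[OF torus_borel_measurable torus_label_in])
  have "(\<lambda>\<omega>. foldr branch (prefix_word n \<omega>) 0) \<in> borel_measurable ?N" for n
    by (rule measurable_compose[OF measurable_prefix_word]) simp
  then have "(\<lambda>\<omega>. lim (\<lambda>n. foldr branch (prefix_word n \<omega>) 0)) \<in> borel_measurable ?N"
    by (rule borel_measurable_lim_metric)
  moreover have "torus_proj \<in> borel \<rightarrow>\<^sub>M torus_borel"
    by (rule measurableI) (simp_all add: sets_torus_borel)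
  ultimately have \<Psi>: "decode \<in> ?N \<rightarrow>\<^sub>M torus_borel"
    unfolding decode_def[abs_def] by (rule measurable_compose)
  have component: "(\<lambda>\<omega>. \<omega> j) \<in> ?N \<rightarrow>\<^sub>M count_space UNIV" for j
  proof -
    have "(\<lambda>\<omega>. hd (drop j (prefix_word (Suc j) \<omega>))) \<in> ?N \<rightarrow>\<^sub>M count_space UNIV"
      by (rule measurable_compose[OF measurable_prefix_word]) simp
    then show ?thesis by (simp add: prefix_word_def)
  qed
  have section_sets: "{\<omega> \<in> space ?N. torus.itin (decode \<omega>) = \<omega>} \<in> sets ?N"
  proof -
    have "(\<lambda>\<omega>. torus.itin (decode \<omega>) j) \<in> ?N \<rightarrow>\<^sub>M count_space UNIV" for j
      using measurable_compose[OF measurable_compose[OF \<Psi> \<phi>] component] by simp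
    note [measurable] = this component
    have "{\<omega> \<in> space ?N. torus.itin (decode \<omega>) = \<omega>} = {\<omega> \<in> space ?N. \<forall>j. torus.itin (decode \<omega>) j = \<omega> j}"
      by auto
    also have "\<dots> \<in> sets ?N" by measurable
    finally show ?thesis .
  qed
  have invariant: "distr torus_lebesgue torus_lebesgue torus_map = torus_lebesgue"
  proof (rule measure_eqI)
    fix E assume "E \<in> sets (distr torus_lebesgue torus_lebesgue torus_map)"
    then have E: "E \<in> sets torus_lebesgue" by simp
    then show "emeasure (distr torus_lebesgue torus_lebesgue torus_map) E = emeasure torus_lebesgue E"
      using torus.prob_funpow_vimage[OF E, of 1]
      by (simp add: emeasure_distr[OF torus_lebesgue_measurable(1)] torus.emeasure_eq_measure vimage_def)
  qed simp
  show ?thesis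
    unfolding bernoulli_measure_def
  proof (intro mp_isomorphic_completionI[where ?M0.0 = torus_borel and \<phi> = torus.itin and \<Psi> = decode])
    show "\<exists>E1\<in>sets torus_borel. \<exists>E2\<in>sets torus_borel. E1 \<subseteq> E \<and> E \<subseteq> E2 \<and> E2 - E1 \<in> null_sets torus_lebesgue"
      if "E \<in> sets torus_lebesgue" for E :: "'n torus set"
      using that by (rule torus_borel_sandwich)
    show "torus.itin (torus_map t) = left_shift (torus.itin t)" for t by (rule itinerary_apply)
  qed (fact prob_space_torus_lebesgue complete_torus_lebesgue sets_torus_borel_lebesgue \<phi> \<Psi> section_sets
      torus.distr_itinerary(2) decode_itinerary torus_lebesgue_measurable(1) invariant | simp)+
qed

end

section \<open>Choosing lifts, digits and grid\<close>

lemma finite_bounded_int_lattice: "finite {x :: real ^ 'n::finite. x \<in> int_lattice \<and> norm x \<le> R}"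
proof -
  define k where "k = \<lceil>R\<rceil>"
  have "{x :: real ^ 'n. x \<in> int_lattice \<and> norm x \<le> R} \<subseteq> (\<lambda>g. \<chi> i. real_of_int (g i)) ` (UNIV \<rightarrow>\<^sub>E {-k..k})"
  proof
    fix x :: "real ^ 'n" assume x: "x \<in> {x. x \<in> int_lattice \<and> norm x \<le> R}"
    define g where "g i = \<lfloor>x $ i\<rfloor>" for i
    have g: "x $ i = real_of_int (g i)" for i using x by (simp add: g_def int_lattice_def)
    have "\<bar>g i\<bar> \<le> k" for i
      using component_le_norm_cart[of x i] x unfolding g k_def by simp linarith
    then have "g \<in> UNIV \<rightarrow>\<^sub>E {-k..k}" by (auto simp: abs_le_iff minus_le_iff)
    moreover have "x = (\<chi> i. real_of_int (g i))" using g by (simp add: vec_eq_iff)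
    ultimately show "x \<in> (\<lambda>g. \<chi> i. real_of_int (g i)) ` (UNIV \<rightarrow>\<^sub>E {-k..k})" by blast
  qed
  then show ?thesis by (rule finite_subset) (intro finite_imageI finite_PiE, auto)
qed

context lattice_expansion
begin

text \<open>Each class modulo the image of \<open>a\<close> has a canonical member, namely \<open>a\<close> of a vector in the unit
  cube; these are bounded integer vectors, hence finitely many.\<close>
lemma digits_exist:
  obtains d :: "nat \<Rightarrow> real ^ 'n" and r z where
    "\<And>i. i \<in> {1..r} \<Longrightarrow> d i \<in> int_lattice"
    "\<And>e. e \<in> int_lattice \<Longrightarrow> \<exists>!i. i \<in> {1..r} \<and> B (e - d i) \<in> int_lattice"
    "z \<in> {1..r}" "d z = 0"
proof -
  define c where "c k = k - a (vec_floor (B k))" for k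
  define S where "S = c ` int_lattice"
  have Bc: "B (c k) = B k - vec_floor (B k)" for k
    by (simp add: c_def B_diff)
  have c_a: "c k = a (B k - vec_floor (B k))" for k by (simp add: c_def a_diff)
  obtain b where b: "norm (a x) \<le> b * norm x" "b > 0" for x
    using linear_bounded_pos[OF lin_a] by (metis mult.commute)
  have "S \<subseteq> {x. x \<in> int_lattice \<and> norm x \<le> b * CARD('n)}"
  proof
    fix x assume "x \<in> S"
    then obtain k where k: "k \<in> int_lattice" "x = c k" by (auto simp: S_def)
    have "norm x \<le> b * norm (B k - vec_floor (B k))" using b(1) k(2) c_a by metis
    also have "\<dots> \<le> b * CARD('n)"
      using b(2) norm_unit_cube[OF vec_floor_unit_cube] by (intro mult_left_mono) auto
    finally show "x \<in> {x. x \<in> int_lattice \<and> norm x \<le> b * CARD('n)}"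
      using k by (auto simp: c_def intro!: int_lattice_diff a_lattice)
  qed
  then have "finite S" using finite_bounded_int_lattice finite_subset by blast
  then obtain d where d: "bij_betw d {1..card S} S" using ex_bij_betw_nat_finite_1 by blast
  have d_S: "d i \<in> S" if "i \<in> {1..card S}" for i using d that by (auto simp: bij_betw_def)
  have S_lattice: "x \<in> int_lattice" if "x \<in> S" for x
    using that by (auto simp: S_def c_def intro!: int_lattice_diff a_lattice)
  have "c 0 = 0" by (simp add: c_def B_0 vec_floor_def a_0 flip: zero_vec_def)
  then have "0 \<in> S" unfolding S_def by (metis imageI int_lattice_0)
  then have "0 \<in> d ` {1..card S}" using d by (simp add: bij_betw_def)
  then obtain z where z: "z \<in> {1..card S}" "d z = 0" by (metis imageE)
  show thesis
  proof (rule that[where d = d and r = "card S" and z = z, OF _ _ z])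
    show "d i \<in> int_lattice" if "i \<in> {1..card S}" for i using d_S[OF that] S_lattice by blast
    fix e :: "real ^ 'n" assume e: "e \<in> int_lattice"
    then have "c e \<in> d ` {1..card S}" using d by (auto simp: bij_betw_def S_def)
    then obtain i where i: "i \<in> {1..card S}" "d i = c e" by (metis imageE)
    show "\<exists>!i. i \<in> {1..card S} \<and> B (e - d i) \<in> int_lattice"
    proof (rule ex1I[of _ i])
      show "i \<in> {1..card S} \<and> B (e - d i) \<in> int_lattice" using i by (simp add: B_diff Bc)
      fix j assume j: "j \<in> {1..card S} \<and> B (e - d j) \<in> int_lattice"
      then obtain k where k: "k \<in> int_lattice" "d j = c k" using d_S by (auto simp: S_def)
      have "B (c e) - B (c k) = B (e - d j) - vec_floor (B e)"
        by (simp add: k Bc B_diff)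
      then have "B (c e) - B (c k) \<in> int_lattice" using j by (metis int_lattice_diff vec_floor_lattice)
      then have "B (c e) = B (c k)"
        unfolding Bc by (rule unit_cube_lattice_unique[OF vec_floor_unit_cube vec_floor_unit_cube])
      then have "a (B (c e)) = a (B (c k))" by (rule arg_cong)
      then have "d j = d i" using i k by simp
      then show "j = i" using inj_onD[OF bij_betw_imp_inj_on[OF d]] i j by blast
    qed
  qed
qed

text \<open>Each excluded offset is determined by one of countably many points \<open>p\<close>, a coordinate and an
  integer.\<close>
lemma generic_offset:
  assumes m: "m > 0"
  obtains s where "\<And>j p k. (a ^^ j) p \<in> int_lattice \<Longrightarrow> real m * (p $ k - s) \<notin> \<int>"
proof -
  define P where "P = (\<Union>j. (B ^^ j) ` (int_lattice :: (real ^ 'n) set))"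
  define Bad where "Bad = (\<lambda>(p, k, l). p $ k - real_of_int l / real m) ` (P \<times> UNIV \<times> UNIV)"
  have "countable (int_lattice :: (real ^ 'n) set)" by (rule countable_int_lattice)
  then have "countable P" by (auto simp: P_def)
  then have "countable Bad" by (auto simp: Bad_def intro!: countable_image countable_SIGMA countable_finite)
  then obtain s where s: "s \<notin> insert 0 Bad"
    using uncountable_UNIV_real by (metis UNIV_eq_I countable_insert)
  show thesis
  proof (rule that, rule notI)
    fix j k and p :: "real ^ 'n" assume p: "(a ^^ j) p \<in> int_lattice" and int: "real m * (p $ k - s) \<in> \<int>"
    have "p = (B ^^ j) ((a ^^ j) p)" by (simp add: funpow_B_a)
    then have "p \<in> P" using p by (auto simp: P_def)
    obtain l where "real m * (p $ k - s) = of_int l" using int by (auto elim: Ints_cases)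
    then have "s = p $ k - of_int l / real m" using m by (simp add: field_simps)
    then have "s \<in> Bad" using \<open>p \<in> P\<close> by (auto simp: Bad_def intro!: image_eqI[of _ _ "(p, k, l)"])
    then show False using s by simp
  qed
qed

lemma approx_nearest_lattice_point:
  assumes "\<epsilon> > 0"
  obtains n where "n \<in> int_lattice" "\<And>e. e \<in> int_lattice \<Longrightarrow> N (v + n) \<le> N (v + e) + \<epsilon>"
proof -
  let ?I = "INF e\<in>int_lattice. N (v + e)"
  have bdd: "bdd_below ((\<lambda>e. N (v + e)) ` int_lattice)" using N_nonneg by (intro bdd_belowI2)
  have "\<exists>n\<in>int_lattice. N (v + n) < ?I + \<epsilon>"
    using assms bdd by (subst cINF_less_iff[symmetric]) auto
  then obtain n where n: "n \<in> int_lattice" "N (v + n) < ?I + \<epsilon>" by blast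
  have "N (v + n) \<le> N (v + e) + \<epsilon>" if "e \<in> int_lattice" for e
    using cINF_lower[OF bdd that] n by simp
  then show thesis using that n by blast
qed

text \<open>Choose a near-minimiser for the corner of each of the \<open>m\<^sup>n\<close> cells modulo the lattice, and extend
  periodically. The mesh is so fine that passing from a corner to a point of its cell costs at most
  \<open>\<epsilon> / 3\<close>; this happens twice, and the choice itself costs another \<open>\<epsilon> / 3\<close>.\<close>
lemma near_minimal_lift_exists:
  assumes \<epsilon>: "\<epsilon> > 0" and m: "m > 0" "C * CARD('n) / m \<le> \<epsilon> / 3"
  obtains H :: "real ^ 'n \<Rightarrow> real ^ 'n" where
    "\<And>x. H x \<in> int_lattice"
    "\<And>e x. e \<in> int_lattice \<Longrightarrow> H (x + e) = H x - e"
    "\<And>e x. e \<in> int_lattice \<Longrightarrow> N (x + H x) \<le> N (x + e) + \<epsilon>"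
    "\<And>x y. grid_cell m s x = grid_cell m s y \<Longrightarrow> H x = H y"
proof -
  define corner :: "int ^ 'n \<Rightarrow> real ^ 'n" where "corner c = (\<chi> i. real_of_int (c $ i) / real m + s)" for c
  define cell_mod :: "int ^ 'n \<Rightarrow> int ^ 'n" where "cell_mod c = (\<chi> i. c $ i mod int m)" for c
  define cell_div :: "int ^ 'n \<Rightarrow> real ^ 'n" where "cell_div c = (\<chi> i. real_of_int (c $ i div int m))" for c
  have "\<forall>c. \<exists>n. n \<in> int_lattice \<and> (\<forall>e\<in>int_lattice. N (corner c + n) \<le> N (corner c + e) + \<epsilon> / 3)"
    using approx_nearest_lattice_point[of "\<epsilon> / 3"] \<epsilon> by (metis zero_less_divide_iff zero_less_numeral)
  then obtain h where h: "h c \<in> int_lattice"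
      "e \<in> int_lattice \<Longrightarrow> N (corner c + h c) \<le> N (corner c + e) + \<epsilon> / 3" for c e
    by metis
  define H where "H x = h (cell_mod (grid_cell m s x)) - cell_div (grid_cell m s x)" for x
  have cell_div: "cell_div c \<in> int_lattice" for c by (simp add: cell_div_def int_lattice_def)
  have corner_split: "corner c = corner (cell_mod c) + cell_div c" for c
  proof -
    have "real_of_int (c $ i) = real_of_int (c $ i mod int m) + real m * real_of_int (c $ i div int m)" for i
      by (metis add.commute mult_div_mod_eq of_int_add of_int_mult of_int_of_nat_eq)
    then show ?thesis using m by (simp add: corner_def cell_mod_def cell_div_def vec_eq_iff field_simps)
  qed
  have N_corner: "N (x - corner (grid_cell m s x)) \<le> \<epsilon> / 3" for x
  proof -
    let ?u = "x - corner (grid_cell m s x)"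
    have "real m *\<^sub>R ?u \<in> unit_cube"
    proof -
      have "(real m *\<^sub>R ?u) $ i = frac (real m * (x $ i - s))" for i
        using m by (simp add: corner_def grid_cell_def frac_def field_simps)
      then show ?thesis by (simp add: unit_cube_def frac_ge_0 frac_lt_1)
    qed
    then have "real m * norm ?u \<le> CARD('n)" using norm_unit_cube[of "real m *\<^sub>R ?u"] by simp
    then have "norm ?u \<le> CARD('n) / m" using m by (simp add: field_simps)
    moreover have "C \<ge> 0"
      using N_le_norm[of "axis undefined 1"] N_nonneg[of "axis undefined 1"] by simp
    ultimately have "C * norm ?u \<le> C * (CARD('n) / m)" by (intro mult_left_mono)
    then have "C * norm ?u \<le> \<epsilon> / 3" using m(2) unfolding times_divide_eq_right by (rule order_trans)
    with N_le_norm[of ?u] show ?thesis by (rule order_trans)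
  qed
  show thesis
  proof (rule that)
    show "H x \<in> int_lattice" for x by (auto simp: H_def h cell_div)
    show "H x = H y" if "grid_cell m s x = grid_cell m s y" for x y using that by (simp add: H_def)
    show "H (x + e) = H x - e" if e: "e \<in> int_lattice" for x e
    proof -
      define k where "k i = \<lfloor>e $ i\<rfloor>" for i
      have k: "e $ i = real_of_int (k i)" for i using e by (simp add: k_def int_lattice_def)
      have "grid_cell m s (x + e) $ i = grid_cell m s x $ i + int m * k i" for i
      proof -
        have "real m * ((x + e) $ i - s) = real m * (x $ i - s) + of_int (int m * k i)"
          by (simp add: k algebra_simps)
        then show ?thesis unfolding grid_cell_def by (simp only: vec_lambda_beta floor_add_int)
      qed
      then have "cell_mod (grid_cell m s (x + e)) = cell_mod (grid_cell m s x)" "cell_div (grid_cell m s (x + e)) = cell_div (grid_cell m s x) + e"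
        using m k by (auto simp: cell_mod_def cell_div_def vec_eq_iff)
      then show ?thesis by (simp add: H_def)
    qed
    show "N (x + H x) \<le> N (x + e) + \<epsilon>" if e: "e \<in> int_lattice" for x e
    proof -
      let ?c = "grid_cell m s x"
      let ?u = "x - corner ?c"
      have "x + H x = ?u + (corner (cell_mod ?c) + h (cell_mod ?c))"
        by (simp add: H_def corner_split[of ?c])
      then have "N (x + H x) \<le> N ?u + N (corner (cell_mod ?c) + h (cell_mod ?c))" by (metis N_triangle)
      also have "N (corner (cell_mod ?c) + h (cell_mod ?c)) \<le> N (corner (cell_mod ?c) + (cell_div ?c + e)) + \<epsilon> / 3"
        using e cell_div by (intro h) auto
      also have "corner (cell_mod ?c) + (cell_div ?c + e) = (x + e) + - ?u"
        by (simp add: corner_split[of ?c])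
      also have "N ((x + e) + - ?u) \<le> N (x + e) + N ?u" using N_triangle[of "x + e" "- ?u"] by (simp only: N_minus)
      finally show ?thesis using N_corner[of x] by simp
    qed
  qed
qed

end

section \<open>Expanding toral endomorphisms\<close>

theorem theorem1:
  fixes A :: "int ^ 'n::finite ^ 'n"
  assumes "CARD('n) \<ge> 2"
    and "\<And>c. complex_eigenvalue A c \<Longrightarrow> 1 < cmod c"
  shows "\<exists>r::nat. r > 0 \<and>
    mp_isomorphic torus_lebesgue (toral_endomorphism A)
      (bernoulli_measure r (\<lambda>_. 1 / real r)) left_shift"
proof -
  obtain B :: "real ^ 'n \<Rightarrow> real ^ 'n" and C \<theta> where B': "linear B"
    "\<And>x. of_int_matrix A *v B x = x" "\<And>x. B (of_int_matrix A *v x) = x"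
    and \<theta>: "0 < \<theta>" "\<theta> < 1" and decay: "\<And>k x. norm ((B ^^ k) x) \<le> C * \<theta> ^ k * norm x"
    by (rule expanding_inverse[of A]) (erule assms(2), rule that)
  define a :: "real ^ 'n \<Rightarrow> real ^ 'n" where "a = (*v) (of_int_matrix A)"
  have B: "linear B" "\<And>x. a (B x) = x" "\<And>x. B (a x) = x" using B' by (simp_all add: a_def)
  obtain N where N: "\<And>x. norm x \<le> N x" "\<And>x. N x \<le> C * norm x" "\<And>x y. N (x + y) \<le> N x + N y"
    "\<And>x. N (- x) = N x" "\<And>x. N (B x) \<le> \<theta> * N x"
    by (rule adapted_norm[OF B(1) \<theta>(1) decay]) (rule that)
  have lin_a: "linear a" by (simp add: a_def)
  have a_lattice: "a x \<in> int_lattice" if "x \<in> int_lattice" for x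
    using that unfolding a_def int_lattice_def matrix_vector_mult_def of_int_matrix_def
    by (auto intro!: Ints_sum Ints_mult)
  interpret lattice_expansion a B N \<theta> C
    by (rule lattice_expansion.intro) (fact lin_a B a_lattice \<theta> N)+
  define \<epsilon> where "\<epsilon> = (1 - \<theta>) / 6"
  have \<epsilon>: "0 < \<epsilon>" "5 * \<epsilon> < 1 - \<theta>" using \<theta> by (auto simp: \<epsilon>_def)
  obtain m :: nat where m: "C * CARD('n) / (\<epsilon> / 3) < m" "m > 0"
    using reals_Archimedean2[of "max 0 (C * CARD('n) / (\<epsilon> / 3))"] by (auto simp: max_less_iff_conj)
  then have m_small: "C * CARD('n) / m \<le> \<epsilon> / 3"
    using \<epsilon> by (simp add: field_simps)
  obtain s where s: "\<And>j p k. (a ^^ j) p \<in> int_lattice \<Longrightarrow> real m * (p $ k - s) \<notin> \<int>"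
    by (rule generic_offset[OF m(2)]) (rule that)
  obtain H :: "real ^ 'n \<Rightarrow> real ^ 'n" where H: "\<And>x. H x \<in> int_lattice"
    "\<And>e x. e \<in> int_lattice \<Longrightarrow> H (x + e) = H x - e"
    "\<And>e x. e \<in> int_lattice \<Longrightarrow> N (x + H x) \<le> N (x + e) + \<epsilon>"
    "\<And>x y. grid_cell m s x = grid_cell m s y \<Longrightarrow> H x = H y"
    by (rule near_minimal_lift_exists[OF \<epsilon>(1) m(2) m_small]) (rule that)
  obtain d :: "nat \<Rightarrow> real ^ 'n" and r z where d: "\<And>i. i \<in> {1..r} \<Longrightarrow> d i \<in> int_lattice"
    "\<And>e. e \<in> int_lattice \<Longrightarrow> \<exists>!i. i \<in> {1..r} \<and> B (e - d i) \<in> int_lattice"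
    "z \<in> {1..r}" "d z = 0"
    by (rule digits_exist) (rule that)
  interpret lattice_coding a B N \<theta> C H \<epsilon> m s d r z
    by unfold_locales (fact H \<epsilon> m s d)+
  have "torus_map t = toral_endomorphism A t" for t
  proof -
    have "toral_endomorphism A (torus_proj (rep_torus t)) = torus_proj (a (rep_torus t))"
      by (simp only: toral_endomorphism.abs_eq a_def)
    then show ?thesis by (simp add: torus_map_def)
  qed
  then have "torus_map = toral_endomorphism A" by (rule ext)
  moreover have "r > 0" using d(3) by simp
  ultimately show ?thesis using torus_map_isomorphic_bernoulli by auto
qed

end
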